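(* Let $k$ be a field of characteristic $0$. For every dga $(A,\phi)$ over $k$ there exists a (cohomological) spectral sequence with $$E_2^{p,q}\simeq H^p\big(HCP^q_*(A)\big)$$ that converges to the cyclic cohomology $HC^{p+q}_{dg}(A)$.
   Context: **Dgas.** A dga $(A,\phi)$ over $k$ is a unital associative graded $k$-algebra $A=\bigoplus_{m\ge 0}A^m$ with a $k$-linear map $\phi$ lowering degree by one such that $\phi^2=0$ and $\phi(xy)=\phi(x)y+(-1)^{|x|}x\phi(y)$, where $|x|$ is the degree of a homogeneous element. $(A^{\otimes n})^m$ is the total-degree-$m$ part of $A^{\otimes n}$, and $\phi^{\otimes n}$ denotes the induced differential $\phi^{\otimes n}(a_1\otimes\dots\otimes a_n)=\sum_i(-1)^{|a_1|+\dots+|a_{i-1}|}a_1\otimes\dots\otimes\phi(a_i)\otimes\dots\otimes a_n$. For $n,m\ge 0$ put $C^n(A)^m=\mathrm{Hom}_k((A^{\otimes n+1})^m,k)$. **Operators** (on homogeneous $a_i$, with $\gamma_n=|a_n|(|a_0|+\dots+|a_{n-1}|)$): - $\delta:C^n(A)^m\to C^n(A)^{m+1}$, $\delta f=(-1)^m f\circ\phi^{\otimes n+1}$. - $b:C^{n-1}(A)^m\to C^n(A)^m$, $b(f)(a_0\otimes\dots\otimes a_n)=\sum_{i=0}^{n-1}(-1)^i f(a_0\otimes\dots\otimes a_ia_{i+1}\otimes\dots\otimes a_n)+(-1)^{n+\gamma_n}f(a_na_0\otimes a_1\otimes\dots\otimes a_{n-1})$. - $\tau:C^n(A)^m\to C^n(A)^m$,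 $\tau(f)(a_0\otimes\dots\otimes a_n)=(-1)^{n+\gamma_n}f(a_n\otimes a_0\otimes\dots\otimes a_{n-1})$; $N=\sum_{i=0}^n\tau^i$ on $C^n(A)^m$. - $s:C^{n+1}(A)^m\to C^n(A)^m$, $s(f)(a_0\otimes\dots\otimes a_n)=(-1)^n f(a_0\otimes\dots\otimes a_n\otimes 1)$. - $B=Ns(\mathbf 1-\tau):C^{n+1}(A)^m\to C^n(A)^m$ (and $B=0$ on $C^0(A)^m$). **Cyclic cohomology.** $EC(A)$ is the tricomplex with $EC(A)^{p,q,r}=C^{q-p}(A)^r$ for $0\le p\le q$, $r\ge 0$, and $0$ otherwise. $\mathcal T(EC(A))^n=\bigoplus_{p+q+r=n}EC(A)^{p,q,r}$ has differential $b+B+(-1)^{q-p}\delta$, where $b$ raises $q$, $B$ raises $p$, $\delta$ raises $r$ by one. $HC^n_{dg}(A)=H^n(\mathcal T(EC(A)))$. **Partial cyclic cohomology.** For fixed $n\ge 0$, $\mathcal{BP}^n(A)$ is the bicomplex with $\mathcal{BP}^n(A)^{p,q}=C^{q-p}(A)^n$ for $0\le p\le q$ ($0$ otherwise) and differentials $b$ (raising $q$) and $B$ (raising $p$); its total complex is $\mathcal T(\mathcal{BP}^n(A))^m=\bigoplus_{p+q=m}C^{q-p}(A)^n$ with differential $b+B$. The $n$-th partial cyclic cohomology is $HCP^m_n(A)=H^m(\mathcal T(\mathcal{BP}^n(A)))$. For fixed $q$, $HCP^q_*(A)$ is the cochain complex $HCP^q_0(A)\to HCP^q_1(A)\to HCP^q_2(A)\to\cdots$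 with $HCP^q_p(A)$ in degree $p$ and differential induced by the map acting as $(-1)^n\delta$ on $C^n(A)^p$. **Convergence.** A spectral sequence $(E_r^{p,q},d_r)$, $d_r:E_r^{p,q}\to E_r^{p+r,q-r+1}$, converges to $H^*$ if there is a decreasing filtration of each $H^n$, finite in each degree, with $E_\infty^{p,q}\simeq F^pH^{p+q}/F^{p+1}H^{p+q}$. *)

theory Defs
  imports "Jordan_Normal_Form.VS_Connect" "HOL-Algebra.AbelCoset" "HOL-Library.Poly_Mapping"
begin

section \<open>Vector spaces over a field\<close>

text \<open>
  The ground field is a type \<open>'k\<close> of class \<open>field\<close>, turned into a ring record by \<open>class_ring\<close>;
  vector spaces over it are records \<open>V\<close> with \<open>vectorspace class_ring V\<close>.  The fields \<open>mult\<close>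
  and \<open>one\<close> of such a record carry no meaning unless \<open>V\<close> is an algebra.
\<close>

definition field_vs :: "('k::field, 'k) module" where
  "field_vs = \<lparr>carrier = UNIV, mult = (*), one = 1, zero = 0, add = (+), smult = (*)\<rparr>"

definition zero_vs :: "'v \<Rightarrow> ('k::field, 'v) module" where
  "zero_vs z = \<lparr>carrier = {z}, mult = undefined, one = undefined,
     zero = z, add = (\<lambda>_ _. z), smult = (\<lambda>_ _. z)\<rparr>"

definition free_vs :: "'x set \<Rightarrow> ('k::field, 'x \<Rightarrow>\<^sub>0 'k) module" where
  "free_vs X = \<lparr>carrier = {p. Poly_Mapping.keys p \<subseteq> X}, mult = undefined, one = undefined,
     zero = 0, add = (+), smult = (\<lambda>c. Poly_Mapping.map ((*) c))\<rparr>"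

definition span_of :: "('k::field, 'v) module \<Rightarrow> 'v set \<Rightarrow> 'v set" where
  "span_of V S = LinearCombinations.module.span class_ring V S"

text \<open>The quotient \<open>V / W\<close>, whose elements are the cosets of \<open>W\<close>.\<close>

definition quotient_vs :: "('k::field, 'v) module \<Rightarrow> 'v set \<Rightarrow> ('k, 'v set) module" where
  "quotient_vs V W = \<lparr>carrier = a_rcosets\<^bsub>V\<^esub> W, mult = undefined, one = undefined,
     zero = W, add = (\<lambda>X Y. X <+>\<^bsub>V\<^esub> Y),
     smult = (\<lambda>c X. \<Union>x\<in>X. W +>\<^bsub>V\<^esub> (c \<odot>\<^bsub>V\<^esub> x))\<rparr>"

text \<open>Linear maps are made unique as functions by the value zero outside the carrier.\<close>

definition lin_maps ::
    "('k::field, 'v) module \<Rightarrow> ('k, 'w) module \<Rightarrow> ('v \<Rightarrow> 'w) set" where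
  "lin_maps V W = {T \<in> LinearCombinations.module_hom class_ring V W. \<forall>v. v \<notin> carrier V \<longrightarrow> T v = \<zero>\<^bsub>W\<^esub>}"

definition hom_vs ::
    "('k::field, 'v) module \<Rightarrow> ('k, 'w) module \<Rightarrow> ('k, 'v \<Rightarrow> 'w) module" where
  "hom_vs V W = \<lparr>carrier = lin_maps V W, mult = undefined, one = undefined,
     zero = (\<lambda>_. \<zero>\<^bsub>W\<^esub>), add = (\<lambda>S T v. S v \<oplus>\<^bsub>W\<^esub> T v), smult = (\<lambda>c T v. c \<odot>\<^bsub>W\<^esub> T v)\<rparr>"

definition direct_sum_vs :: "'i set \<Rightarrow> ('i \<Rightarrow> ('k::field, 'v) module) \<Rightarrow> ('k, 'i \<Rightarrow> 'v) module"
  where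
  "direct_sum_vs I V = \<lparr>carrier = {x. (\<forall>i\<in>I. x i \<in> carrier (V i)) \<and> (\<forall>i. i \<notin> I \<longrightarrow> x i = \<zero>\<^bsub>V i\<^esub>)
                                    \<and> finite {i \<in> I. x i \<noteq> \<zero>\<^bsub>V i\<^esub>}},
     mult = undefined, one = undefined,
     zero = (\<lambda>i. \<zero>\<^bsub>V i\<^esub>), add = (\<lambda>x y i. x i \<oplus>\<^bsub>V i\<^esub> y i), smult = (\<lambda>c x i. c \<odot>\<^bsub>V i\<^esub> x i)\<rparr>"

definition vs_iso :: "('k::field, 'v) module \<Rightarrow> ('k, 'w) module \<Rightarrow> bool" where
  "vs_iso V W \<longleftrightarrow> (\<exists>T. linear_map class_ring V W T \<and> bij_betw T (carrier V) (carrier W))"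


section \<open>Cohomology\<close>

text \<open>\<open>ker g / im f\<close> for \<open>U \<rightarrow> V \<rightarrow> W\<close>.\<close>

definition cohomology_at ::
    "('k::field, 'u) module \<Rightarrow> ('u \<Rightarrow> 'v) \<Rightarrow> ('k, 'v) module \<Rightarrow> ('v \<Rightarrow> 'w) \<Rightarrow> ('k, 'w) module
       \<Rightarrow> ('k, 'v set) module" where
  "cohomology_at U f V g W =
     quotient_vs (V\<lparr>carrier := {x \<in> carrier V. g x = \<zero>\<^bsub>W\<^esub>}\<rparr>) (f ` carrier U)"

definition cohomology ::
    "(int \<Rightarrow> ('k::field, 'v) module) \<Rightarrow> (int \<Rightarrow> 'v \<Rightarrow> 'v) \<Rightarrow> int \<Rightarrow> ('k, 'v set) module" where
  "cohomology C d n = cohomology_at (C (n - 1)) (d (n - 1)) (C n) (d n) (C (n + 1))"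

text \<open>The map induced on classes in degree \<open>n\<close> by a cochain map \<open>f\<close> into the complex \<open>(C, d)\<close>.\<close>

definition cohomology_map ::
    "(int \<Rightarrow> ('k::field, 'v) module) \<Rightarrow> (int \<Rightarrow> 'v \<Rightarrow> 'v) \<Rightarrow> int \<Rightarrow> ('u \<Rightarrow> 'v) \<Rightarrow> 'u set \<Rightarrow> 'v set"
  where
  "cohomology_map C d n f X = (\<Union>x\<in>X. (d (n - 1) ` carrier (C (n - 1))) +>\<^bsub>C n\<^esub> f x)"


section \<open>Spectral sequences\<close>

text \<open>Cohomological spectral sequences with pages \<open>r \<ge> r0\<close>.\<close>

definition spectral_sequence ::
    "nat \<Rightarrow> (nat \<Rightarrow> int \<Rightarrow> int \<Rightarrow> ('k::field, 'e) module) \<Rightarrow> (nat \<Rightarrow> int \<Rightarrow> int \<Rightarrow> 'e \<Rightarrow> 'e) \<Rightarrow> bool"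
  where
  "spectral_sequence r0 E d \<longleftrightarrow> (\<forall>r\<ge>r0. \<forall>p q.
     linear_map class_ring (E r p q) (E r (p + int r) (q - int r + 1)) (d r p q) \<and>
     (\<forall>x\<in>carrier (E r p q).
        d r (p + int r) (q - int r + 1) (d r p q x)
          = \<zero>\<^bsub>E r (p + int r + int r) (q - int r + 1 - int r + 1)\<^esub>) \<and>
     vs_iso (E (Suc r) p q)
       (cohomology_at (E r (p - int r) (q + int r - 1)) (d r (p - int r) (q + int r - 1))
          (E r p q) (d r p q) (E r (p + int r) (q - int r + 1))))"

text \<open>
  \<open>V\<close> is the term at \<open>(p, q)\<close> of the limit page: from some page on, the differentials leaving
  and entering that spot vanish, so that all later terms there are isomorphic to each other,
  and they are isomorphic to \<open>V\<close>.
\<close>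

definition limit_term ::
    "nat \<Rightarrow> (nat \<Rightarrow> int \<Rightarrow> int \<Rightarrow> ('k::field, 'e) module) \<Rightarrow> (nat \<Rightarrow> int \<Rightarrow> int \<Rightarrow> 'e \<Rightarrow> 'e)
       \<Rightarrow> int \<Rightarrow> int \<Rightarrow> ('k, 'v) module \<Rightarrow> bool" where
  "limit_term r0 E d p q V \<longleftrightarrow> (\<exists>r1\<ge>r0. \<forall>r\<ge>r1.
     (\<forall>x\<in>carrier (E r p q). d r p q x = \<zero>\<^bsub>E r (p + int r) (q - int r + 1)\<^esub>) \<and>
     (\<forall>x\<in>carrier (E r (p - int r) (q + int r - 1)).
        d r (p - int r) (q + int r - 1) x = \<zero>\<^bsub>E r p q\<^esub>) \<and>
     vs_iso (E r p q) V)"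

definition converges_to ::
    "nat \<Rightarrow> (nat \<Rightarrow> int \<Rightarrow> int \<Rightarrow> ('k::field, 'e) module) \<Rightarrow> (nat \<Rightarrow> int \<Rightarrow> int \<Rightarrow> 'e \<Rightarrow> 'e)
       \<Rightarrow> (int \<Rightarrow> ('k, 'h) module) \<Rightarrow> bool" where
  "converges_to r0 E d H \<longleftrightarrow> (\<exists>F :: int \<Rightarrow> int \<Rightarrow> 'h set.
     (\<forall>p n. subspace class_ring (F p n) (H n)) \<and>
     (\<forall>p n. F (p + 1) n \<subseteq> F p n) \<and>
     (\<forall>n. \<exists>s t. F s n = carrier (H n) \<and> F t n = {\<zero>\<^bsub>H n\<^esub>}) \<and>
     (\<forall>p q. limit_term r0 E d p q
        (quotient_vs ((H (p + q))\<lparr>carrier := F p (p + q)\<rparr>) (F (p + 1) (p + q)))))"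


section \<open>Differential graded algebras\<close>

locale dga = ring A + vectorspace class_ring A
  for A :: "('k::field_char_0, 'a) module" (structure) +
  fixes gr :: "nat \<Rightarrow> 'a set"
    and \<phi> :: "'a \<Rightarrow> 'a"
  assumes smult_mult_left:
      "\<lbrakk>x \<in> carrier A; y \<in> carrier A\<rbrakk> \<Longrightarrow> (c \<odot>\<^bsub>A\<^esub> x) \<otimes> y = c \<odot>\<^bsub>A\<^esub> (x \<otimes> y)"
    and smult_mult_right:
      "\<lbrakk>x \<in> carrier A; y \<in> carrier A\<rbrakk> \<Longrightarrow> x \<otimes> (c \<odot>\<^bsub>A\<^esub> y) = c \<odot>\<^bsub>A\<^esub> (x \<otimes> y)"
    and gr_subspace: "subspace class_ring (gr m) A"
    and gr_direct_sum:
      "x \<in> carrier A \<Longrightarrow>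
         \<exists>!c :: nat \<Rightarrow> 'a. (\<forall>m. c m \<in> gr m) \<and> finite {m. c m \<noteq> \<zero>} \<and> x = (\<Oplus>m\<in>{m. c m \<noteq> \<zero>}. c m)"
    and gr_one: "\<one> \<in> gr 0"
    and gr_mult: "\<lbrakk>x \<in> gr i; y \<in> gr j\<rbrakk> \<Longrightarrow> x \<otimes> y \<in> gr (i + j)"
    and diff_linear: "linear_map class_ring A A \<phi>"
    and diff_Suc: "x \<in> gr (Suc m) \<Longrightarrow> \<phi> x \<in> gr m"
    and diff_0: "x \<in> gr 0 \<Longrightarrow> \<phi> x = \<zero>"
    and diff_diff: "x \<in> carrier A \<Longrightarrow> \<phi> (\<phi> x) = \<zero>"
    and diff_mult:
      "\<lbrakk>x \<in> gr i; y \<in> carrier A\<rbrakk> \<Longrightarrow> \<phi> (x \<otimes> y) = \<phi> x \<otimes> y \<oplus> (- 1) ^ i \<odot>\<^bsub>A\<^esub> (x \<otimes> \<phi> y)"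


section \<open>Tensor powers\<close>

text \<open>
  The \<open>n\<close>-fold tensor power is the quotient of the free vector space on the lists of length \<open>n\<close>
  by the span of the multilinearity relations.
\<close>

definition tensor_relations ::
    "('k::field, 'a) module \<Rightarrow> nat \<Rightarrow> ('a list \<Rightarrow>\<^sub>0 'k) set" where
  "tensor_relations A n =
     {Poly_Mapping.single (us @ (x \<oplus>\<^bsub>A\<^esub> y) # vs) 1
        - Poly_Mapping.single (us @ x # vs) 1 - Poly_Mapping.single (us @ y # vs) 1 | us vs x y.
        set us \<union> set vs \<union> {x, y} \<subseteq> carrier A \<and> length us + 1 + length vs = n}
     \<union> {Poly_Mapping.single (us @ (c \<odot>\<^bsub>A\<^esub> x) # vs) 1 - Poly_Mapping.single (us @ x # vs) c | us vs c x.
        set us \<union> set vs \<union> {x} \<subseteq> carrier A \<and> length us + 1 + length vs = n}"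

definition tensor_null :: "('k::field, 'a) module \<Rightarrow> nat \<Rightarrow> ('a list \<Rightarrow>\<^sub>0 'k) set" where
  "tensor_null A n =
     span_of (free_vs {xs. set xs \<subseteq> carrier A \<and> length xs = n}) (tensor_relations A n)"

definition tensor_power ::
    "('k::field, 'a) module \<Rightarrow> nat \<Rightarrow> ('k, ('a list \<Rightarrow>\<^sub>0 'k) set) module" where
  "tensor_power A n =
     quotient_vs (free_vs {xs. set xs \<subseteq> carrier A \<and> length xs = n}) (tensor_null A n)"

text \<open>\<open>pure_tensor A [a\<^sub>1, \<dots>, a\<^sub>n]\<close> is the class of \<open>a\<^sub>1 \<otimes> \<dots> \<otimes> a\<^sub>n\<close>.\<close>

definition pure_tensor :: "('k::field, 'a) module \<Rightarrow> 'a list \<Rightarrow> ('a list \<Rightarrow>\<^sub>0 'k) set" where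
  "pure_tensor A xs =
     tensor_null A (length xs)
       +>\<^bsub>free_vs {ys. set ys \<subseteq> carrier A \<and> length ys = length xs}\<^esub> Poly_Mapping.single xs 1"

text \<open>
  \<open>homog gr ds as\<close>: the entries of \<open>as\<close> are homogeneous of degrees \<open>ds\<close>.  The degrees are listed
  separately because \<open>0\<close> is homogeneous of every degree.
\<close>

definition homog :: "(nat \<Rightarrow> 'a set) \<Rightarrow> nat list \<Rightarrow> 'a list \<Rightarrow> bool" where
  "homog gr ds as \<longleftrightarrow> list_all2 (\<lambda>d a. a \<in> gr d) ds as"

text \<open>\<open>tensor_part A gr n m\<close> is the part of total degree \<open>m\<close> of the \<open>n\<close>-fold tensor power.\<close>

definition tensor_part ::
    "('k::field, 'a) module \<Rightarrow> (nat \<Rightarrow> 'a set) \<Rightarrow> nat \<Rightarrow> nat \<Rightarrow> ('k, ('a list \<Rightarrow>\<^sub>0 'k) set) module"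
  where
  "tensor_part A gr n m =
     (tensor_power A n)\<lparr>carrier := span_of (tensor_power A n)
        {pure_tensor A as | ds as. homog gr ds as \<and> length as = n \<and> sum_list ds = m}\<rparr>"

text \<open>
  The linear map on \<open>tensor_part A gr n m\<close> with prescribed values on the pure tensors of
  homogeneous elements; it is unique because these span the space.
\<close>

definition tensor_lift ::
    "('k::field, 'a) module \<Rightarrow> (nat \<Rightarrow> 'a set) \<Rightarrow> nat \<Rightarrow> nat \<Rightarrow> ('k, 'w) module
       \<Rightarrow> (nat list \<Rightarrow> 'a list \<Rightarrow> 'w) \<Rightarrow> ('a list \<Rightarrow>\<^sub>0 'k) set \<Rightarrow> 'w" where
  "tensor_lift A gr n m W h =
     (THE T. T \<in> lin_maps (tensor_part A gr n m) W \<and>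
        (\<forall>ds as. homog gr ds as \<and> length as = n \<and> sum_list ds = m \<longrightarrow> T (pure_tensor A as) = h ds as))"

text \<open>The differential of the \<open>n\<close>-fold tensor power, from total degree \<open>m + 1\<close> to \<open>m\<close>.\<close>

definition tensor_diff ::
    "('k::field, 'a) module \<Rightarrow> (nat \<Rightarrow> 'a set) \<Rightarrow> ('a \<Rightarrow> 'a) \<Rightarrow> nat \<Rightarrow> nat
       \<Rightarrow> ('a list \<Rightarrow>\<^sub>0 'k) set \<Rightarrow> ('a list \<Rightarrow>\<^sub>0 'k) set" where
  "tensor_diff A gr \<phi> n m = tensor_lift A gr n (Suc m) (tensor_part A gr n m)
     (\<lambda>ds as. \<Oplus>\<^bsub>tensor_part A gr n m\<^esub>i\<in>{..<n}.
        (- 1) ^ sum_list (take i ds) \<odot>\<^bsub>tensor_part A gr n m\<^esub> pure_tensor A (as[i := \<phi> (as ! i)]))"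


section \<open>Cochains and operators\<close>

type_synonym ('k, 'a) cochain = "('a list \<Rightarrow>\<^sub>0 'k) set \<Rightarrow> 'k"

definition cochains ::
    "('k::field, 'a) module \<Rightarrow> (nat \<Rightarrow> 'a set) \<Rightarrow> nat \<Rightarrow> nat \<Rightarrow> ('k, ('k, 'a) cochain) module" where
  "cochains A gr n m = hom_vs (tensor_part A gr (n + 1) m) field_vs"

text \<open>The exponent \<open>|a\<^sub>n| (|a\<^sub>0| + \<dots> + |a\<^sub>n\<^sub>-\<^sub>1|)\<close> of the sign for moving \<open>a\<^sub>n\<close> to the front.\<close>

definition koszul :: "nat list \<Rightarrow> nat" where
  "koszul ds = last ds * sum_list (butlast ds)"

text \<open>From \<open>cochains A gr n m\<close> to \<open>cochains A gr n (m + 1)\<close>.\<close>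

definition op_delta ::
    "('k::field, 'a) module \<Rightarrow> (nat \<Rightarrow> 'a set) \<Rightarrow> ('a \<Rightarrow> 'a) \<Rightarrow> nat \<Rightarrow> nat
       \<Rightarrow> ('k, 'a) cochain \<Rightarrow> ('k, 'a) cochain" where
  "op_delta A gr \<phi> n m f = (\<lambda>v. (- 1) ^ m * f (tensor_diff A gr \<phi> (n + 1) m v))"

text \<open>From \<open>cochains A gr (n - 1) m\<close> to \<open>cochains A gr n m\<close>, for \<open>n \<ge> 1\<close>.\<close>

definition op_b ::
    "('k::field, 'a) module \<Rightarrow> (nat \<Rightarrow> 'a set) \<Rightarrow> nat \<Rightarrow> nat
       \<Rightarrow> ('k, 'a) cochain \<Rightarrow> ('k, 'a) cochain" where
  "op_b A gr n m f = tensor_lift A gr (n + 1) m field_vs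
     (\<lambda>ds as. (\<Sum>i<n. (- 1) ^ i *
                 f (pure_tensor A (take i as @ (as ! i \<otimes>\<^bsub>A\<^esub> as ! (i + 1)) # drop (i + 2) as)))
            + (- 1) ^ (n + koszul ds) *
                 f (pure_tensor A ((as ! n \<otimes>\<^bsub>A\<^esub> as ! 0) # butlast (tl as))))"

text \<open>\<open>op_tau\<close> and \<open>op_N\<close> are endomorphisms of \<open>cochains A gr n m\<close>.\<close>

definition op_tau ::
    "('k::field, 'a) module \<Rightarrow> (nat \<Rightarrow> 'a set) \<Rightarrow> nat \<Rightarrow> nat
       \<Rightarrow> ('k, 'a) cochain \<Rightarrow> ('k, 'a) cochain" where
  "op_tau A gr n m f = tensor_lift A gr (n + 1) m field_vs
     (\<lambda>ds as. (- 1) ^ (n + koszul ds) * f (pure_tensor A (last as # butlast as)))"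

definition op_N ::
    "('k::field, 'a) module \<Rightarrow> (nat \<Rightarrow> 'a set) \<Rightarrow> nat \<Rightarrow> nat
       \<Rightarrow> ('k, 'a) cochain \<Rightarrow> ('k, 'a) cochain" where
  "op_N A gr n m f = (\<lambda>v. \<Sum>i\<le>n. (op_tau A gr n m ^^ i) f v)"

text \<open>From \<open>cochains A gr (n + 1) m\<close> to \<open>cochains A gr n m\<close>.\<close>

definition op_s ::
    "('k::field, 'a) module \<Rightarrow> (nat \<Rightarrow> 'a set) \<Rightarrow> nat \<Rightarrow> nat
       \<Rightarrow> ('k, 'a) cochain \<Rightarrow> ('k, 'a) cochain" where
  "op_s A gr n m f = tensor_lift A gr (n + 1) m field_vs
     (\<lambda>ds as. (- 1) ^ n * f (pure_tensor A (as @ [\<one>\<^bsub>A\<^esub>])))"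

text \<open>From \<open>cochains A gr l m\<close> to \<open>cochains A gr (l - 1) m\<close>; the index is that of the source.\<close>

definition op_B ::
    "('k::field, 'a) module \<Rightarrow> (nat \<Rightarrow> 'a set) \<Rightarrow> nat \<Rightarrow> nat
       \<Rightarrow> ('k, 'a) cochain \<Rightarrow> ('k, 'a) cochain" where
  "op_B A gr l m f = (case l of
       0 \<Rightarrow> (\<lambda>_. 0)
     | Suc n \<Rightarrow> op_N A gr n m (op_s A gr n m (\<lambda>v. f v - op_tau A gr (Suc n) m f v)))"


section \<open>The tricomplex and cyclic cohomology\<close>

definition EC ::
    "('k::field, 'a) module \<Rightarrow> (nat \<Rightarrow> 'a set) \<Rightarrow> int \<Rightarrow> int \<Rightarrow> int \<Rightarrow> ('k, ('k, 'a) cochain) module"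
  where
  "EC A gr p q r =
     (if 0 \<le> p \<and> p \<le> q \<and> 0 \<le> r then cochains A gr (nat (q - p)) (nat r) else zero_vs (\<lambda>_. 0))"

text \<open>
  The three differentials leaving position \<open>(p, q, r)\<close>, in the directions of \<open>q\<close>, \<open>p\<close> and \<open>r\<close>
  respectively.
\<close>

definition EC_b ::
    "('k::field, 'a) module \<Rightarrow> (nat \<Rightarrow> 'a set) \<Rightarrow> int \<Rightarrow> int \<Rightarrow> int
       \<Rightarrow> ('k, 'a) cochain \<Rightarrow> ('k, 'a) cochain" where
  "EC_b A gr p q r f =
     (if 0 \<le> p \<and> p \<le> q \<and> 0 \<le> r then op_b A gr (nat (q - p) + 1) (nat r) f else (\<lambda>_. 0))"

definition EC_B ::
    "('k::field, 'a) module \<Rightarrow> (nat \<Rightarrow> 'a set) \<Rightarrow> int \<Rightarrow> int \<Rightarrow> int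
       \<Rightarrow> ('k, 'a) cochain \<Rightarrow> ('k, 'a) cochain" where
  "EC_B A gr p q r f =
     (if 0 \<le> p \<and> p \<le> q \<and> 0 \<le> r then op_B A gr (nat (q - p)) (nat r) f else (\<lambda>_. 0))"

definition EC_delta ::
    "('k::field, 'a) module \<Rightarrow> (nat \<Rightarrow> 'a set) \<Rightarrow> ('a \<Rightarrow> 'a) \<Rightarrow> int \<Rightarrow> int \<Rightarrow> int
       \<Rightarrow> ('k, 'a) cochain \<Rightarrow> ('k, 'a) cochain" where
  "EC_delta A gr \<phi> p q r f =
     (if 0 \<le> p \<and> p \<le> q \<and> 0 \<le> r
      then (\<lambda>v. (- 1) ^ nat (q - p) * op_delta A gr \<phi> (nat (q - p)) (nat r) f v) else (\<lambda>_. 0))"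

definition tot_EC ::
    "('k::field, 'a) module \<Rightarrow> (nat \<Rightarrow> 'a set) \<Rightarrow> int
       \<Rightarrow> ('k, int \<times> int \<times> int \<Rightarrow> ('k, 'a) cochain) module" where
  "tot_EC A gr n = direct_sum_vs {(p, q, r). p + q + r = n} (\<lambda>(p, q, r). EC A gr p q r)"

definition tot_EC_diff ::
    "('k::field, 'a) module \<Rightarrow> (nat \<Rightarrow> 'a set) \<Rightarrow> ('a \<Rightarrow> 'a)
       \<Rightarrow> (int \<times> int \<times> int \<Rightarrow> ('k, 'a) cochain) \<Rightarrow> (int \<times> int \<times> int \<Rightarrow> ('k, 'a) cochain)" where
  "tot_EC_diff A gr \<phi> x = (\<lambda>(p, q, r) v.
       EC_b A gr p (q - 1) r (x (p, q - 1, r)) v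
     + EC_B A gr (p - 1) q r (x (p - 1, q, r)) v
     + EC_delta A gr \<phi> p q (r - 1) (x (p, q, r - 1)) v)"

definition HC_dg ::
    "('k::field, 'a) module \<Rightarrow> (nat \<Rightarrow> 'a set) \<Rightarrow> ('a \<Rightarrow> 'a) \<Rightarrow> int
       \<Rightarrow> ('k, (int \<times> int \<times> int \<Rightarrow> ('k, 'a) cochain) set) module" where
  "HC_dg A gr \<phi> n = cohomology (tot_EC A gr) (\<lambda>_. tot_EC_diff A gr \<phi>) n"


section \<open>Partial cyclic cohomology\<close>

text \<open>
  The bicomplex is the slice of the tricomplex at a fixed third index \<open>n\<close>.  It is zero for
  negative \<open>n\<close>, which makes the cochain complexes below indexed by all integers.
\<close>

definition BP ::
    "('k::field, 'a) module \<Rightarrow> (nat \<Rightarrow> 'a set) \<Rightarrow> int \<Rightarrow> int \<Rightarrow> int \<Rightarrow> ('k, ('k, 'a) cochain) module"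
  where
  "BP A gr n p q = EC A gr p q n"

definition tot_BP ::
    "('k::field, 'a) module \<Rightarrow> (nat \<Rightarrow> 'a set) \<Rightarrow> int \<Rightarrow> int
       \<Rightarrow> ('k, int \<times> int \<Rightarrow> ('k, 'a) cochain) module" where
  "tot_BP A gr n m = direct_sum_vs {(p, q). p + q = m} (\<lambda>(p, q). BP A gr n p q)"

definition tot_BP_diff ::
    "('k::field, 'a) module \<Rightarrow> (nat \<Rightarrow> 'a set) \<Rightarrow> int
       \<Rightarrow> (int \<times> int \<Rightarrow> ('k, 'a) cochain) \<Rightarrow> (int \<times> int \<Rightarrow> ('k, 'a) cochain)" where
  "tot_BP_diff A gr n x = (\<lambda>(p, q) v.
       EC_b A gr p (q - 1) n (x (p, q - 1)) v
     + EC_B A gr (p - 1) q n (x (p - 1, q)) v)"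

text \<open>\<open>HCP A gr n m\<close> is the \<open>m\<close>-th cohomology of the total complex for third index \<open>n\<close>.\<close>

definition HCP ::
    "('k::field, 'a) module \<Rightarrow> (nat \<Rightarrow> 'a set) \<Rightarrow> int \<Rightarrow> int
       \<Rightarrow> ('k, (int \<times> int \<Rightarrow> ('k, 'a) cochain) set) module" where
  "HCP A gr n m = cohomology (tot_BP A gr n) (\<lambda>_. tot_BP_diff A gr n) m"

text \<open>
  The differential from \<open>HCP A gr p q\<close> to \<open>HCP A gr (p + 1) q\<close>, induced by the signed \<open>\<delta>\<close>
  (the sign is part of \<open>EC_delta\<close>).
\<close>

definition HCP_diff ::
    "('k::field, 'a) module \<Rightarrow> (nat \<Rightarrow> 'a set) \<Rightarrow> ('a \<Rightarrow> 'a) \<Rightarrow> int \<Rightarrow> int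
       \<Rightarrow> (int \<times> int \<Rightarrow> ('k, 'a) cochain) set \<Rightarrow> (int \<times> int \<Rightarrow> ('k, 'a) cochain) set" where
  "HCP_diff A gr \<phi> p q =
     cohomology_map (tot_BP A gr (p + 1)) (\<lambda>_. tot_BP_diff A gr (p + 1)) q
       (\<lambda>x (i, j). EC_delta A gr \<phi> i j p (x (i, j)))"

text \<open>\<open>H\<^sup>p\<close> of the complex \<open>HCP A gr 0 q \<rightarrow> HCP A gr 1 q \<rightarrow> \<dots>\<close>\<close>

definition H_HCP ::
    "('k::field, 'a) module \<Rightarrow> (nat \<Rightarrow> 'a set) \<Rightarrow> ('a \<Rightarrow> 'a) \<Rightarrow> int \<Rightarrow> int
       \<Rightarrow> ('k, (int \<times> int \<Rightarrow> ('k, 'a) cochain) set set) module" where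
  "H_HCP A gr \<phi> p q = cohomology (\<lambda>i. HCP A gr i q) (\<lambda>i. HCP_diff A gr \<phi> i q) p"

end

theory Submission
  imports Defs "HOL-Library.Function_Algebras"
begin

text \<open>
  Filter the total complex of the tricomplex by its third index \<open>r\<close>.  The differentials \<open>b\<close> and \<open>B\<close>
  keep \<open>r\<close> and \<open>\<delta>\<close> raises it, so the elements with third index at least \<open>s\<close> form a subcomplex;
  and since the tricomplex lives in \<open>0 \<le> p \<le> q\<close>, \<open>0 \<le> r\<close>, the filtration is bounded in every total
  degree.  A bounded filtration has a convergent spectral sequence, with terms
  \<open>E\<^sub>r\<^sup>p = Z\<^sub>r\<^sup>p / (Z\<^sub>r\<^sub>-\<^sub>1\<^sup>p\<^sup>+\<^sup>1 + D Z\<^sub>r\<^sub>-\<^sub>1\<^sup>p\<^sup>-\<^sup>r\<^sup>+\<^sup>1)\<close>, where \<open>Z\<^sub>r\<^sup>p\<close> is the set of elements of filtration \<open>p\<close> whose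
  differential has filtration \<open>p + r\<close> (\<open>next_page\<close>, \<open>converges_to_cohomology\<close>).  The graded pieces of
  the filtration are the total complexes of the bicomplexes with fixed third index, whose cohomology
  is partial cyclic cohomology, and the next differential is the one induced by \<open>\<delta>\<close>; hence the
  second page (\<open>page_2\<close>).

  What has to be proved about dgas is that \<open>b + B \<plusminus> \<delta>\<close> squares to zero.  A cochain is determined by its
  values on tensors of homogeneous elements, so the operators become operators on functions of
  words, a word being a list of homogeneous elements with their degrees.  There
  \<open>b\<^sup>2 = 0\<close>, \<open>B\<^sup>2 = 0\<close> and \<open>b B + B b = 0\<close> follow from the classical relations between \<open>b\<close>, the variant
  \<open>b'\<close> of \<open>b\<close> without its last summand, \<open>\<tau>\<close>, \<open>N\<close> and \<open>s\<close>:
  \<open>(1 - \<tau>) b = b' (1 - \<tau>)\<close>, \<open>N b' = b N\<close>, \<open>s b' + b' s = 1\<close> and \<open>N (1 - \<tau>) = 0 = (1 - \<tau>) N\<close>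
  (\<open>one_minus_rot_bword\<close>, \<open>norm_bword'\<close>, \<open>contraction\<close>, \<open>norm_one_minus_rot\<close>).  The relations with \<open>\<delta>\<close>
  reduce to the Leibniz rule for the product of the first two letters, because all other
  summands of \<open>b\<close> arise from that product by cyclic rotation (\<open>dphi_coface_0\<close>, \<open>dphi_coface\<close>).  That the
  operators map cochains to cochains is the universal property of tensor powers in its graded
  form (\<open>tensor_lift\<close>).
\<close>

section \<open>Presentations of quotient spaces\<close>

text \<open>
  Cohomology spaces, pages and tensor powers are quotients, sometimes quotients of quotients, with
  cosets of cosets as elements.  A presentation hides this: \<open>Q\<close> is the image of a subspace \<open>S\<close> of a
  vector space type under a linear map with kernel \<open>K\<close>, and statements about \<open>Q\<close> become
  statements about representatives in \<open>S\<close>.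
\<close>

definition presents ::
    "('k::field \<Rightarrow> 'v::ab_group_add \<Rightarrow> 'v) \<Rightarrow> 'v set \<Rightarrow> 'v set \<Rightarrow> ('v \<Rightarrow> 'q) \<Rightarrow> ('k, 'q) module \<Rightarrow> bool"
  where
  "presents sc S K \<pi> Q \<longleftrightarrow>
     vector_space sc \<and> Modules.module.subspace sc S \<and> carrier Q = \<pi> ` S \<and>
     (\<forall>x\<in>S. \<forall>y\<in>S. \<pi> x \<oplus>\<^bsub>Q\<^esub> \<pi> y = \<pi> (x + y)) \<and> (\<forall>c. \<forall>x\<in>S. c \<odot>\<^bsub>Q\<^esub> \<pi> x = \<pi> (sc c x)) \<and>
     \<pi> 0 = \<zero>\<^bsub>Q\<^esub> \<and> K = {x \<in> S. \<pi> x = \<zero>\<^bsub>Q\<^esub>}"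

lemma vector_space_module: "vector_space sc \<Longrightarrow> Modules.module sc"
  by (simp add: module_iff_vector_space)

lemma
  assumes "presents sc S K \<pi> Q"
  shows presents_vector_space: "vector_space sc"
    and presents_module: "Modules.module sc"
    and presents_subspace: "Modules.module.subspace sc S"
    and presents_carrier: "carrier Q = \<pi> ` S"
    and presents_in_carrier: "x \<in> S \<Longrightarrow> \<pi> x \<in> carrier Q"
    and presents_add: "x \<in> S \<Longrightarrow> y \<in> S \<Longrightarrow> \<pi> x \<oplus>\<^bsub>Q\<^esub> \<pi> y = \<pi> (x + y)"
    and presents_smult: "x \<in> S \<Longrightarrow> c \<odot>\<^bsub>Q\<^esub> \<pi> x = \<pi> (sc c x)"
    and presents_zero: "\<pi> 0 = \<zero>\<^bsub>Q\<^esub>"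
    and presents_kernel: "K = {x \<in> S. \<pi> x = \<zero>\<^bsub>Q\<^esub>}"
    and presents_eq_zero_iff: "x \<in> S \<Longrightarrow> \<pi> x = \<zero>\<^bsub>Q\<^esub> \<longleftrightarrow> x \<in> K"
  using assms unfolding presents_def by (auto simp: vector_space_module)

lemma presents_subspaceD:
  assumes "presents sc S K \<pi> Q"
  shows "0 \<in> S" and "x \<in> S \<Longrightarrow> y \<in> S \<Longrightarrow> x + y \<in> S" and "x \<in> S \<Longrightarrow> sc c x \<in> S"
    and "x \<in> S \<Longrightarrow> - x \<in> S" and "x \<in> S \<Longrightarrow> y \<in> S \<Longrightarrow> x - y \<in> S"
proof -
  interpret Modules.module sc by (rule presents_module[OF assms])
  note S = presents_subspace[OF assms]
  show "0 \<in> S" and "x \<in> S \<Longrightarrow> y \<in> S \<Longrightarrow> x + y \<in> S" and "x \<in> S \<Longrightarrow> sc c x \<in> S"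
    and "x \<in> S \<Longrightarrow> - x \<in> S" and "x \<in> S \<Longrightarrow> y \<in> S \<Longrightarrow> x - y \<in> S"
    using S by (simp_all add: subspace_0 subspace_add subspace_scale subspace_neg subspace_diff)
qed

lemma presents_vectorspace:
  assumes "presents sc S K \<pi> Q"
  shows "vectorspace class_ring Q"
proof -
  interpret Modules.module sc by (rule presents_module[OF assms])
  note S = presents_subspaceD[OF assms]
  show ?thesis
  proof (rule vs_criteria, rule class_field, goal_cases)
    case 3
    show ?case
    proof
      fix v assume "v \<in> carrier Q"
      then obtain x where x: "x \<in> S" "v = \<pi> x" by (auto simp: presents_carrier[OF assms])
      have "\<pi> (- x) \<in> carrier Q" "v \<oplus>\<^bsub>Q\<^esub> \<pi> (- x) = \<zero>\<^bsub>Q\<^esub>"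
        using x S by (auto simp: presents_carrier[OF assms] presents_add[OF assms] presents_zero[OF assms])
      then show "\<exists>w\<in>carrier Q. v \<oplus>\<^bsub>Q\<^esub> w = \<zero>\<^bsub>Q\<^esub>" by blast
    qed
  qed (use S in \<open>auto simp: presents_carrier[OF assms] presents_add[OF assms] presents_smult[OF assms]
         presents_zero[OF assms, symmetric] add_ac algebra_simps\<close>)
qed

lemma presents_eq_iff:
  assumes "presents sc S K \<pi> Q" "x \<in> S" "y \<in> S"
  shows "\<pi> x = \<pi> y \<longleftrightarrow> x - y \<in> K"
proof -
  interpret Q: vectorspace class_ring Q by (rule presents_vectorspace[OF assms(1)])
  note S = presents_subspaceD[OF assms(1)]
  have "\<pi> x = \<pi> (x - y) \<oplus>\<^bsub>Q\<^esub> \<pi> y"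
    using assms S by (simp add: presents_add[OF assms(1)])
  moreover have "\<pi> (x - y) \<in> carrier Q" "\<pi> y \<in> carrier Q"
    using assms S by (auto simp: presents_carrier[OF assms(1)])
  ultimately have "\<pi> x = \<pi> y \<longleftrightarrow> \<pi> (x - y) = \<zero>\<^bsub>Q\<^esub>"
    by (metis Q.M.l_zero Q.M.add.r_cancel_one')
  then show ?thesis using assms S by (simp add: presents_eq_zero_iff[OF assms(1)])
qed

lemma presents_kernel_subspace:
  assumes "presents sc S K \<pi> Q"
  shows "Modules.module.subspace sc K"
proof -
  interpret Modules.module sc by (rule presents_module[OF assms])
  interpret Q: vectorspace class_ring Q by (rule presents_vectorspace[OF assms])
  note S = presents_subspaceD[OF assms]
  have "c \<odot>\<^bsub>Q\<^esub> \<zero>\<^bsub>Q\<^esub> = \<zero>\<^bsub>Q\<^esub>" for c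
    using Q.smult_r_null[of c] by simp
  then show ?thesis
    using S by (auto intro!: subspaceI simp: presents_kernel[OF assms] presents_zero[OF assms]
        presents_add[OF assms, symmetric] presents_smult[OF assms, symmetric])
qed

lemma linear_map_classI:
  assumes "vectorspace class_ring V" "vectorspace class_ring W"
    and "\<And>v. v \<in> carrier V \<Longrightarrow> g v \<in> carrier W"
    and "\<And>u v. u \<in> carrier V \<Longrightarrow> v \<in> carrier V \<Longrightarrow> g (u \<oplus>\<^bsub>V\<^esub> v) = g u \<oplus>\<^bsub>W\<^esub> g v"
    and "\<And>c v. v \<in> carrier V \<Longrightarrow> g (c \<odot>\<^bsub>V\<^esub> v) = c \<odot>\<^bsub>W\<^esub> g v"
  shows "linear_map class_ring V W g"
  using assms unfolding linear_map_def mod_hom_def mod_hom_axioms_def LinearCombinations.module_hom_def vectorspace_def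
  by auto

lemma presents_descend:
  assumes P: "presents sc S K \<pi> Q" and W: "vectorspace class_ring W"
    and T: "\<And>x. x \<in> S \<Longrightarrow> T x \<in> carrier W"
    and T_add: "\<And>x y. x \<in> S \<Longrightarrow> y \<in> S \<Longrightarrow> T (x + y) = T x \<oplus>\<^bsub>W\<^esub> T y"
    and T_smult: "\<And>c x. x \<in> S \<Longrightarrow> T (sc c x) = c \<odot>\<^bsub>W\<^esub> T x"
    and T_ker: "\<And>x. x \<in> K \<Longrightarrow> T x = \<zero>\<^bsub>W\<^esub>"
  obtains g where "linear_map class_ring Q W g" "\<And>x. x \<in> S \<Longrightarrow> g (\<pi> x) = T x"
proof -
  interpret W: vectorspace class_ring W by (rule W)
  note S = presents_subspaceD[OF P]
  define g where "g v = T (SOME x. x \<in> S \<and> \<pi> x = v)" for v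
  have g: "g (\<pi> x) = T x" if x: "x \<in> S" for x
  proof -
    let ?y = "SOME y. y \<in> S \<and> \<pi> y = \<pi> x"
    have y: "?y \<in> S \<and> \<pi> ?y = \<pi> x" by (rule someI[of _ x]) (use x in simp)
    then have "?y - x \<in> K" using x presents_eq_iff[OF P] by blast
    then have "T ?y = T x"
      using T_add[of "?y - x" x] y x T[of x] T_ker[of "?y - x"] S by simp
    then show ?thesis by (simp add: g_def)
  qed
  show thesis
  proof (rule that[OF linear_map_classI])
    show "vectorspace class_ring Q" by (rule presents_vectorspace[OF P])
    show "vectorspace class_ring W" by (rule W)
    show "g (\<pi> x) = T x" if "x \<in> S" for x by (rule g[OF that])
    show "g v \<in> carrier W" if "v \<in> carrier Q" for v
      using that g T by (auto simp: presents_carrier[OF P])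
    show "g (u \<oplus>\<^bsub>Q\<^esub> v) = g u \<oplus>\<^bsub>W\<^esub> g v" if "u \<in> carrier Q" "v \<in> carrier Q" for u v
      using that g T_add S(2) by (auto simp: presents_carrier[OF P] presents_add[OF P])
    show "g (c \<odot>\<^bsub>Q\<^esub> v) = c \<odot>\<^bsub>W\<^esub> g v" if "v \<in> carrier Q" for c v
      using that g T_smult S(3) by (auto simp: presents_carrier[OF P] presents_smult[OF P])
  qed
qed

lemma linear_mapD:
  assumes "linear_map class_ring V W g"
  shows "vectorspace class_ring V" "vectorspace class_ring W"
    and "v \<in> carrier V \<Longrightarrow> g v \<in> carrier W"
    and "u \<in> carrier V \<Longrightarrow> v \<in> carrier V \<Longrightarrow> g (u \<oplus>\<^bsub>V\<^esub> v) = g u \<oplus>\<^bsub>W\<^esub> g v"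
    and "v \<in> carrier V \<Longrightarrow> g (c \<odot>\<^bsub>V\<^esub> v) = c \<odot>\<^bsub>W\<^esub> g v"
    and "g \<zero>\<^bsub>V\<^esub> = \<zero>\<^bsub>W\<^esub>"
proof -
  interpret linear_map class_ring V W g by (rule assms)
  show "vectorspace class_ring V" "vectorspace class_ring W" by unfold_locales
  show "v \<in> carrier V \<Longrightarrow> g v \<in> carrier W"
    "u \<in> carrier V \<Longrightarrow> v \<in> carrier V \<Longrightarrow> g (u \<oplus>\<^bsub>V\<^esub> v) = g u \<oplus>\<^bsub>W\<^esub> g v"
    "v \<in> carrier V \<Longrightarrow> g (c \<odot>\<^bsub>V\<^esub> v) = c \<odot>\<^bsub>W\<^esub> g v"
    "g \<zero>\<^bsub>V\<^esub> = \<zero>\<^bsub>W\<^esub>"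
    by simp_all
qed

text \<open>
  Linearity is demanded on \<open>S\<close> only: the operators on cochains are defined on all functions, but they
  are linear on cochains.
\<close>

definition linear_between ::
  "('k::field \<Rightarrow> 'v::ab_group_add \<Rightarrow> 'v) \<Rightarrow> ('k \<Rightarrow> 'w::ab_group_add \<Rightarrow> 'w) \<Rightarrow> 'v set \<Rightarrow> 'w set \<Rightarrow> ('v \<Rightarrow> 'w) \<Rightarrow> bool"
  where
  "linear_between sc sc' S S' f \<longleftrightarrow> f ` S \<subseteq> S' \<and>
     (\<forall>x\<in>S. \<forall>y\<in>S. f (x + y) = f x + f y) \<and> (\<forall>c. \<forall>x\<in>S. f (sc c x) = sc' c (f x))"

lemma presents_induced_map:
  assumes P: "presents sc S K \<pi> Q" and P': "presents sc' S' K' \<pi>' Q'"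
    and f: "linear_between sc sc' S S' f" and K: "f ` K \<subseteq> K'"
  obtains g where "linear_map class_ring Q Q' g" "\<And>x. x \<in> S \<Longrightarrow> g (\<pi> x) = \<pi>' (f x)"
proof -
  have "\<pi>' (f x) \<in> carrier Q'" if "x \<in> S" for x
    using that f by (auto simp: linear_between_def presents_carrier[OF P'])
  moreover have "\<pi>' (f (x + y)) = \<pi>' (f x) \<oplus>\<^bsub>Q'\<^esub> \<pi>' (f y)" if "x \<in> S" "y \<in> S" for x y
    using that f by (auto simp: linear_between_def presents_add[OF P'] image_subset_iff)
  moreover have "\<pi>' (f (sc c x)) = c \<odot>\<^bsub>Q'\<^esub> \<pi>' (f x)" if "x \<in> S" for c x
    using that f by (auto simp: linear_between_def presents_smult[OF P'] image_subset_iff)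
  moreover have "\<pi>' (f x) = \<zero>\<^bsub>Q'\<^esub>" if "x \<in> K" for x
    using that K by (auto simp: presents_kernel[OF P'])
  ultimately obtain g where "linear_map class_ring Q Q' g" "\<And>x. x \<in> S \<Longrightarrow> g (\<pi> x) = \<pi>' (f x)"
    using presents_descend[OF P presents_vectorspace[OF P'], of "\<lambda>x. \<pi>' (f x)"] by blast
  then show thesis by (rule that)
qed

text \<open>
  The condition on kernels makes the induced map injective.  For surjectivity, \<open>f\<close> has to reach the
  elements of \<open>S'\<close> modulo \<open>K'\<close>.
\<close>

lemma vs_iso_presents:
  assumes P: "presents sc S K \<pi> Q" and P': "presents sc' S' K' \<pi>' Q'"
    and f: "linear_between sc sc' S S' f"
    and K: "\<And>x. x \<in> S \<Longrightarrow> f x \<in> K' \<longleftrightarrow> x \<in> K"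
    and onto: "\<And>y. y \<in> S' \<Longrightarrow> \<exists>x\<in>S. y - f x \<in> K'"
  shows "vs_iso Q Q'"
proof -
  interpret M: Modules.module sc by (rule presents_module[OF P])
  interpret M': Modules.module sc' by (rule presents_module[OF P'])
  note S = presents_subspaceD[OF P] and S' = presents_subspaceD[OF P']
  have "f ` K \<subseteq> K'" using K by (auto simp: presents_kernel[OF P])
  then obtain g where g: "linear_map class_ring Q Q' g" and g_\<pi>: "\<And>x. x \<in> S \<Longrightarrow> g (\<pi> x) = \<pi>' (f x)"
    using presents_induced_map[OF P P' f] by blast
  have fS: "f x \<in> S'" if "x \<in> S" for x using that f by (auto simp: linear_between_def)
  have f_diff: "f (x - y) = f x - f y" if "x \<in> S" "y \<in> S" for x y
    using that f S(5)[of x y] by (simp add: linear_between_def) (metis add_diff_cancel diff_add_cancel)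
  have "inj_on g (carrier Q)"
  proof (rule inj_onI)
    fix u v assume "u \<in> carrier Q" "v \<in> carrier Q" and eq: "g u = g v"
    then obtain x y where xy: "x \<in> S" "y \<in> S" "u = \<pi> x" "v = \<pi> y" by (auto simp: presents_carrier[OF P])
    have "f x - f y \<in> K'"
      using eq xy fS by (simp add: g_\<pi> presents_eq_iff[OF P'])
    then have "x - y \<in> K" using xy S K[of "x - y"] by (simp add: f_diff)
    then show "u = v" using xy by (simp add: presents_eq_iff[OF P])
  qed
  moreover have "g ` carrier Q = carrier Q'"
  proof
    show "g ` carrier Q \<subseteq> carrier Q'" using linear_mapD(3)[OF g] by blast
    show "carrier Q' \<subseteq> g ` carrier Q"
    proof
      fix v assume "v \<in> carrier Q'"
      then obtain y where y: "y \<in> S'" "v = \<pi>' y" by (auto simp: presents_carrier[OF P'])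
      then obtain x where x: "x \<in> S" "y - f x \<in> K'" using onto by blast
      then have "v = g (\<pi> x)" using y fS by (simp add: g_\<pi> presents_eq_iff[OF P'])
      then show "v \<in> g ` carrier Q" using x by (auto simp: presents_carrier[OF P])
    qed
  qed
  ultimately show ?thesis using g by (auto simp: vs_iso_def bij_betw_def)
qed

text \<open>
  Dividing by the image of \<open>T\<close> keeps the representatives and enlarges the kernel to \<open>T + K\<close>.  This is
  what keeps iterated quotients under control: a coset of cosets is still represented by an
  element of \<open>S\<close>.
\<close>

lemma presents_quotient:
  assumes P: "presents sc S K \<pi> Q" and T: "Modules.module.subspace sc T" "T \<subseteq> S"
    and W: "W = \<pi> ` T"
  shows "presents sc S {t + k | t k. t \<in> T \<and> k \<in> K} (\<lambda>x. W +>\<^bsub>Q\<^esub> \<pi> x) (quotient_vs Q W)"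
proof -
  interpret Modules.module sc by (rule presents_module[OF P])
  note S = presents_subspaceD[OF P]
  note K = presents_kernel_subspace[OF P]
  define L where "L = {t + k | t k. t \<in> T \<and> k \<in> K}"
  have L: "subspace L" unfolding L_def by (rule vector_space.subspace_sums[OF presents_vector_space[OF P] T(1) K])
  have KS: "K \<subseteq> S" by (auto simp: presents_kernel[OF P])
  then have LS: "L \<subseteq> S" using T S by (auto simp: L_def)
  have coset: "W +>\<^bsub>Q\<^esub> \<pi> x = \<pi> ` {t + x | t. t \<in> T}" if "x \<in> S" for x
    unfolding a_r_coset_def' W using that T by (auto simp: presents_add[OF P] subset_iff image_iff)
  have coset_L: "W +>\<^bsub>Q\<^esub> \<pi> x = \<pi> ` {t + x | t. t \<in> L}" if "x \<in> S" for x
  proof -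
    have "\<pi> (t + k + x) = \<pi> (t + x)" if "t \<in> T" "k \<in> K" for t k
      using \<open>x \<in> S\<close> that KS T S by (subst presents_eq_iff[OF P]) (auto simp: subset_iff)
    moreover have "T \<subseteq> L" using subspace_0[OF K] by (force simp: L_def)
    ultimately show ?thesis unfolding coset[OF that] by (fastforce simp: L_def)
  qed
  have coset_eq: "W +>\<^bsub>Q\<^esub> \<pi> x = W +>\<^bsub>Q\<^esub> \<pi> y \<longleftrightarrow> x - y \<in> L" if xy: "x \<in> S" "y \<in> S" for x y
  proof
    assume "W +>\<^bsub>Q\<^esub> \<pi> x = W +>\<^bsub>Q\<^esub> \<pi> y"
    moreover have "\<pi> x \<in> W +>\<^bsub>Q\<^esub> \<pi> x"
      unfolding coset[OF that(1)] using subspace_0[OF T(1)] by force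
    ultimately have "\<pi> x \<in> W +>\<^bsub>Q\<^esub> \<pi> y" by simp
    then obtain t where t: "t \<in> T" "\<pi> x = \<pi> (t + y)" unfolding coset[OF xy(2)] by blast
    then have "x - (t + y) \<in> K" using that T S by (subst (asm) presents_eq_iff[OF P]) auto
    then have "t + (x - (t + y)) \<in> L" using t unfolding L_def by blast
    then show "x - y \<in> L" by (simp add: algebra_simps)
  next
    assume l: "x - y \<in> L"
    have "{t + x | t. t \<in> L} = {t + y | t. t \<in> L}"
    proof (intro equalityI subsetI)
      fix z assume "z \<in> {t + x | t. t \<in> L}"
      then obtain t where "t \<in> L" "z = t + x" by blast
      then have "t + (x - y) \<in> L" "z = (t + (x - y)) + y" using l L by (auto simp: subspace_add)
      then show "z \<in> {t + y | t. t \<in> L}" by blast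
    next
      fix z assume "z \<in> {t + y | t. t \<in> L}"
      then obtain t where "t \<in> L" "z = t + y" by blast
      then have "t - (x - y) \<in> L" "z = (t - (x - y)) + x" using l L by (auto simp: subspace_diff)
      then show "z \<in> {t + x | t. t \<in> L}" by blast
    qed
    then show "W +>\<^bsub>Q\<^esub> \<pi> x = W +>\<^bsub>Q\<^esub> \<pi> y" using that by (simp add: coset_L)
  qed
  have zero: "W +>\<^bsub>Q\<^esub> \<pi> 0 = W" using coset[OF S(1)] by (simp add: W)
  have add: "(W +>\<^bsub>Q\<^esub> \<pi> x) <+>\<^bsub>Q\<^esub> (W +>\<^bsub>Q\<^esub> \<pi> y) = W +>\<^bsub>Q\<^esub> \<pi> (x + y)" if xy: "x \<in> S" "y \<in> S" for x y
  proof -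
    have sum: "\<pi> (t + x) \<oplus>\<^bsub>Q\<^esub> \<pi> (t' + y) = \<pi> (t + t' + (x + y))" if "t \<in> T" "t' \<in> T" for t t'
    proof -
      have "t + x \<in> S" "t' + y \<in> S" using that xy T S by auto
      then show ?thesis by (simp add: presents_add[OF P] add_ac)
    qed
    have "(W +>\<^bsub>Q\<^esub> \<pi> x) <+>\<^bsub>Q\<^esub> (W +>\<^bsub>Q\<^esub> \<pi> y) = \<pi> ` {t + (x + y) | t. t \<in> T}"
      unfolding set_add_def' coset[OF xy(1)] coset[OF xy(2)]
    proof (intro equalityI subsetI)
      fix z assume "z \<in> (\<Union>h\<in>\<pi> ` {t + x |t. t \<in> T}. \<Union>k\<in>\<pi> ` {t + y |t. t \<in> T}. {h \<oplus>\<^bsub>Q\<^esub> k})"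
      then obtain t t' where t: "t \<in> T" "t' \<in> T" "z = \<pi> (t + x) \<oplus>\<^bsub>Q\<^esub> \<pi> (t' + y)" by blast
      then have "z = \<pi> (t + t' + (x + y))" "t + t' \<in> T" by (simp_all add: sum subspace_add[OF T(1)])
      then show "z \<in> \<pi> ` {t + (x + y) |t. t \<in> T}" by blast
    next
      fix z assume "z \<in> \<pi> ` {t + (x + y) |t. t \<in> T}"
      then obtain t where t: "t \<in> T" "z = \<pi> (t + (x + y))" by blast
      then have "z = \<pi> (t + x) \<oplus>\<^bsub>Q\<^esub> \<pi> (0 + y)" using sum[of t 0] subspace_0[OF T(1)] by simp
      then show "z \<in> (\<Union>h\<in>\<pi> ` {t + x |t. t \<in> T}. \<Union>k\<in>\<pi> ` {t + y |t. t \<in> T}. {h \<oplus>\<^bsub>Q\<^esub> k})"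
        using t(1) subspace_0[OF T(1)] by blast
    qed
    then show ?thesis using xy S by (simp add: coset)
  qed
  have smult: "(\<Union>X\<in>W +>\<^bsub>Q\<^esub> \<pi> x. W +>\<^bsub>Q\<^esub> (c \<odot>\<^bsub>Q\<^esub> X)) = W +>\<^bsub>Q\<^esub> \<pi> (sc c x)" if "x \<in> S" for c x
  proof -
    have "W +>\<^bsub>Q\<^esub> (c \<odot>\<^bsub>Q\<^esub> \<pi> (t + x)) = W +>\<^bsub>Q\<^esub> \<pi> (sc c x)" if "t \<in> T" for t
    proof -
      have tx: "t + x \<in> S" using that \<open>x \<in> S\<close> T S by auto
      have "sc c (t + x) - sc c x = sc c t + 0" by (simp add: algebra_simps)
      then have "sc c (t + x) - sc c x \<in> L"
        unfolding L_def using subspace_scale[OF T(1) that] subspace_0[OF K] by blast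
      then show ?thesis using tx \<open>x \<in> S\<close> S by (simp add: presents_smult[OF P] coset_eq)
    qed
    moreover have "W +>\<^bsub>Q\<^esub> \<pi> x \<noteq> {}" using that subspace_0[OF T(1)] by (auto simp: coset)
    ultimately show ?thesis unfolding coset[OF that] by auto
  qed
  show ?thesis unfolding L_def[symmetric]
    unfolding presents_def
  proof (intro conjI ballI allI)
    show "vector_space sc" "subspace S" by (rule presents_vector_space[OF P] presents_subspace[OF P])+
    show "carrier (quotient_vs Q W) = (\<lambda>x. W +>\<^bsub>Q\<^esub> \<pi> x) ` S"
      by (auto simp: quotient_vs_def A_RCOSETS_def' presents_carrier[OF P])
    show "L = {x \<in> S. W +>\<^bsub>Q\<^esub> \<pi> x = \<zero>\<^bsub>quotient_vs Q W\<^esub>}"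
      using LS coset_eq[of _ 0] S by (auto simp: quotient_vs_def zero)
  qed (auto simp: quotient_vs_def add smult zero)
qed

lemma presents_restrict:
  assumes P: "presents sc S K \<pi> Q" and T: "Modules.module.subspace sc T" "T \<subseteq> S"
    and Y: "Y = \<pi> ` T"
  shows "presents sc T (K \<inter> T) \<pi> (Q\<lparr>carrier := Y\<rparr>)"
  using assms unfolding presents_def by (auto simp: subset_iff)

text \<open>
  The lifts \<open>f'\<close> and \<open>g'\<close> of the two maps to representatives compute the cohomology: a
  representative is a cocycle if \<open>g'\<close> sends it into the kernel of the third presentation.
\<close>

lemma presents_cohomology_at:
  assumes U: "presents scU SU KU \<pi>U U" and V: "presents sc S K \<pi> V" and W: "presents scW SW KW \<pi>W W"
    and f: "\<And>x. x \<in> SU \<Longrightarrow> f (\<pi>U x) = \<pi> (f' x)" and f': "linear_between scU sc SU S f'"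
    and g: "\<And>x. x \<in> S \<Longrightarrow> g (\<pi> x) = \<pi>W (g' x)" and g': "linear_between sc scW S SW g'"
    and gf: "\<And>x. x \<in> SU \<Longrightarrow> g' (f' x) \<in> KW" and gK: "\<And>x. x \<in> K \<Longrightarrow> g' x \<in> KW"
  shows "presents sc {x \<in> S. g' x \<in> KW} {f' y + k | y k. y \<in> SU \<and> k \<in> K}
           (\<lambda>x. f ` carrier U +>\<^bsub>V\<lparr>carrier := {x \<in> carrier V. g x = \<zero>\<^bsub>W\<^esub>}\<rparr>\<^esub> \<pi> x) (cohomology_at U f V g W)"
proof -
  interpret MU: Modules.module scU by (rule presents_module[OF U])
  interpret MV: Modules.module sc by (rule presents_module[OF V])
  interpret MW: Modules.module scW by (rule presents_module[OF W])
  note S = presents_subspaceD[OF V] and SU = presents_subspaceD[OF U]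
  note KW = presents_kernel_subspace[OF W]
  define T where "T = {x \<in> S. g' x \<in> KW}"
  have g'0: "g' 0 = 0" using g' S unfolding linear_between_def by (metis add_cancel_right_left)
  have f'0: "f' 0 = 0" using f' SU unfolding linear_between_def by (metis add_cancel_right_left)
  have T: "MV.subspace T"
    using g' S MW.subspace_0[OF KW] MW.subspace_add[OF KW] MW.subspace_scale[OF KW]
    by (auto intro!: MV.subspaceI simp: T_def linear_between_def g'0)
  have Y: "{x \<in> carrier V. g x = \<zero>\<^bsub>W\<^esub>} = \<pi> ` T"
    using g g' by (auto simp: T_def presents_carrier[OF V] presents_kernel[OF W] linear_between_def)
  have PT: "presents sc T (K \<inter> T) \<pi> (V\<lparr>carrier := {x \<in> carrier V. g x = \<zero>\<^bsub>W\<^esub>}\<rparr>)"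
    by (rule presents_restrict[OF V T _ Y]) (auto simp: T_def)
  have KT: "K \<inter> T = K" using gK by (auto simp: T_def presents_kernel[OF V])
  have I: "MV.subspace (f' ` SU)"
    using f' SU unfolding linear_between_def
    by (auto intro!: MV.subspaceI simp: image_iff) (metis f'0, metis, metis)
  have IT: "f' ` SU \<subseteq> T" using f' gf by (auto simp: T_def linear_between_def)
  have "f ` carrier U = \<pi> ` (f' ` SU)" using f by (force simp: presents_carrier[OF U])
  note * = presents_quotient[OF PT I IT this]
  have "{t + k | t k. t \<in> f' ` SU \<and> k \<in> K \<inter> T} = {f' y + k | y k. y \<in> SU \<and> k \<in> K}"
    unfolding KT by auto
  with * show ?thesis by (simp add: cohomology_at_def T_def)
qed

section \<open>The spectral sequence of a bounded filtration\<close>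

lemma presents_image_subspace:
  assumes P: "presents sc S K \<pi> Q" and T: "Modules.module.subspace sc T" "T \<subseteq> S"
  shows "VectorSpace.subspace class_ring (\<pi> ` T) Q"
proof -
  interpret Modules.module sc by (rule presents_module[OF P])
  interpret Q: vectorspace class_ring Q by (rule presents_vectorspace[OF P])
  show ?thesis
  proof (unfold_locales, goal_cases)
    case 1
    then show ?case using T by (auto simp: presents_carrier[OF P])
  next
    case (2 v w)
    then show ?case
      using T subspace_add[OF T(1)] by (auto simp: presents_add[OF P] subset_iff)
  next
    case 3
    then show ?case using subspace_0[OF T(1)] by (auto simp flip: presents_zero[OF P])
  next
    case (4 c v)
    then show ?case
      using T subspace_scale[OF T(1)] by (auto simp: presents_smult[OF P] subset_iff)
  qed
qed

definition subquotient_vs :: "('k::field \<Rightarrow> 'v::ab_group_add \<Rightarrow> 'v) \<Rightarrow> 'v set \<Rightarrow> 'v set \<Rightarrow> ('k, 'v set) module"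
  where
  "subquotient_vs sc Z B =
     quotient_vs \<lparr>carrier = Z, mult = undefined, one = undefined, zero = 0, add = (+), smult = sc\<rparr> B"

definition coset_class :: "'v::ab_group_add set \<Rightarrow> 'v \<Rightarrow> 'v set"
  where "coset_class B x = {b + x | b. b \<in> B}"

lemma presents_subquotient:
  assumes "vector_space sc" "Modules.module.subspace sc Z" "Modules.module.subspace sc B" "B \<subseteq> Z"
  shows "presents sc Z B (coset_class B) (subquotient_vs sc Z B)"
proof -
  let ?V = "\<lparr>carrier = Z, mult = undefined, one = undefined, zero = 0, add = (+), smult = sc\<rparr> :: ('a, 'b) module"
  have "0 \<in> Z" by (rule Modules.module.subspace_0[OF vector_space_module[OF assms(1)] assms(2)])
  then have "presents sc Z {0} (\<lambda>x. x) ?V"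
    using assms by (auto simp: presents_def)
  from presents_quotient[OF this assms(3,4), of B]
  have "presents sc Z {t + k |t k. t \<in> B \<and> k \<in> {0}} (\<lambda>x. B +>\<^bsub>?V\<^esub> x) (quotient_vs ?V B)" by simp
  moreover have "{t + k |t k. t \<in> B \<and> k \<in> {0}} = B" by auto
  moreover have "(\<lambda>x. B +>\<^bsub>?V\<^esub> x) = coset_class B"
    by (auto simp: fun_eq_iff a_r_coset_def' coset_class_def)
  ultimately show ?thesis by (simp add: subquotient_vs_def)
qed

lemma presents_cong:
  assumes "presents sc S K \<pi> Q" "\<And>x. x \<in> S \<Longrightarrow> \<pi> x = \<pi>' x"
  shows "presents sc S K \<pi>' Q"
  using assms presents_subspaceD(1,2,3)[OF assms(1)]
  unfolding presents_def by (auto simp: image_iff)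

text \<open>
  For a complex of subspaces of one type, classes are plain cosets of the space of coboundaries.  This
  explicit projection is needed to evaluate induced maps on classes.
\<close>

lemma presents_cohomology:
  assumes V: "\<And>n. presents sc (C n) {0} (\<lambda>x. x) (V n)"
    and d: "\<And>n. linear_between sc sc (C n) (C (n + 1)) (d n)"
    and dd: "\<And>n x. x \<in> C n \<Longrightarrow> d (n + 1) (d n x) = 0"
  shows "presents sc {x \<in> C n. d n x = 0} (d (n - 1) ` C (n - 1))
           (coset_class (d (n - 1) ` C (n - 1))) (cohomology V d n)"
proof -
  have d0: "d n 0 = 0" for n
    using d[of n] presents_subspaceD(1)[OF V] unfolding linear_between_def by (metis add_cancel_right_left)
  have img: "d (n - 1) ` C (n - 1) \<subseteq> C n" using d[of "n - 1"] by (auto simp: linear_between_def)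
  have "presents sc {x \<in> C n. d n x \<in> {0}} {d (n - 1) y + k | y k. y \<in> C (n - 1) \<and> k \<in> {0}}
      (\<lambda>x. d (n - 1) ` carrier (V (n - 1)) +>\<^bsub>(V n)\<lparr>carrier := {x \<in> carrier (V n). d n x = \<zero>\<^bsub>V (n + 1)\<^esub>}\<rparr>\<^esub> x)
      (cohomology V d n)"
    unfolding cohomology_def
    by (rule presents_cohomology_at[OF V V V]) (use d[of "n - 1"] d[of n] dd[of _ "n - 1"] d0 in auto)
  moreover have "{d (n - 1) y + k | y k. y \<in> C (n - 1) \<and> k \<in> {0}} = d (n - 1) ` C (n - 1)" by auto
  ultimately have "presents sc {x \<in> C n. d n x = 0} (d (n - 1) ` C (n - 1))
      (\<lambda>x. d (n - 1) ` carrier (V (n - 1)) +>\<^bsub>(V n)\<lparr>carrier := {x \<in> carrier (V n). d n x = \<zero>\<^bsub>V (n + 1)\<^esub>}\<rparr>\<^esub> x)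
      (cohomology V d n)" by simp
  then show ?thesis
  proof (rule presents_cong)
    fix x assume "x \<in> {x \<in> C n. d n x = 0}"
    then have "b \<oplus>\<^bsub>V n\<^esub> x = b + x" if "b \<in> d (n - 1) ` C (n - 1)" for b
      using that img presents_add[OF V, of b n x] by auto
    then show "d (n - 1) ` carrier (V (n - 1)) +>\<^bsub>(V n)\<lparr>carrier := {x \<in> carrier (V n). d n x = \<zero>\<^bsub>V (n + 1)\<^esub>}\<rparr>\<^esub> x
        = coset_class (d (n - 1) ` C (n - 1)) x"
      using presents_carrier[OF V, of "n - 1"] by (auto simp: a_r_coset_def' coset_class_def)
  qed
qed

text \<open>
  Different representatives of a class have images that differ by a coboundary, so the union
  in the definition of the induced map is a union of equal cosets.
\<close>

lemma cohomology_map_coset: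
  assumes V: "\<And>n. presents sc (C n) {0} (\<lambda>x. x) (V n)"
    and d: "\<And>n. linear_between sc sc (C n) (C (n + 1)) (d n)"
    and f: "linear_between sc' sc S' (C n) f" and B': "B' \<subseteq> S'" "0 \<in> B'"
    and fB: "f ` B' \<subseteq> d (n - 1) ` C (n - 1)" and x: "x \<in> S'"
  shows "cohomology_map V d n f (coset_class B' x) = coset_class (d (n - 1) ` C (n - 1)) (f x)"
proof -
  interpret Modules.module sc by (rule presents_module[OF V])
  let ?B = "d (n - 1) ` C (n - 1)"
  have img: "?B \<subseteq> C n" using d[of "n - 1"] by (auto simp: linear_between_def)
  have B_add: "u + v \<in> ?B" and B_diff: "u - v \<in> ?B" if "u \<in> ?B" "v \<in> ?B" for u v
  proof -
    obtain a b where ab: "a \<in> C (n - 1)" "b \<in> C (n - 1)" "u = d (n - 1) a" "v = d (n - 1) b"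
      using \<open>u \<in> ?B\<close> \<open>v \<in> ?B\<close> by blast
    have "u + v = d (n - 1) (a + b)" "u - v = d (n - 1) (a - b)"
      using d[of "n - 1"] ab presents_subspaceD(5)[OF V ab(1,2)]
      unfolding linear_between_def by (simp, metis add_diff_cancel diff_add_cancel)
    then show "u + v \<in> ?B" "u - v \<in> ?B"
      using presents_subspaceD(2,5)[OF V ab(1,2)] by blast+
  qed
  have "d (n - 1) ` carrier (V (n - 1)) +>\<^bsub>V n\<^esub> f y = coset_class ?B (f x)"
    if y: "y \<in> coset_class B' x" for y
  proof -
    obtain b where b: "b \<in> B'" "y = b + x" using y by (auto simp: coset_class_def)
    then have fy: "f y = f b + f x" "f b \<in> ?B" "f x \<in> C n"
      using f fB x B' by (auto simp: linear_between_def)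
    then have "f y \<in> C n" using img presents_subspaceD(2)[OF V] by auto
    then have "d (n - 1) ` carrier (V (n - 1)) +>\<^bsub>V n\<^esub> f y = coset_class ?B (f y)"
      using img presents_carrier[OF V, of "n - 1"] presents_add[OF V]
      by (auto simp: a_r_coset_def' coset_class_def subset_iff)
    also have "\<dots> = coset_class ?B (f x)"
      unfolding coset_class_def
    proof (intro equalityI subsetI)
      fix z assume "z \<in> {b + f y | b. b \<in> ?B}"
      then obtain c where "c \<in> ?B" "z = c + f y" by blast
      then have "z = (c + f b) + f x" "c + f b \<in> ?B" using fy B_add by (auto simp: add.assoc)
      then show "z \<in> {b + f x | b. b \<in> ?B}" by blast
    next
      fix z assume "z \<in> {b + f x | b. b \<in> ?B}"
      then obtain c where "c \<in> ?B" "z = c + f x" by blast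
      then have "z = (c - f b) + f y" "c - f b \<in> ?B" using fy B_diff by auto
      then show "z \<in> {b + f y | b. b \<in> ?B}" by blast
    qed
    finally show ?thesis .
  qed
  moreover have "coset_class B' x \<noteq> {}" using B' by (auto simp: coset_class_def)
  ultimately show ?thesis unfolding cohomology_map_def by auto
qed

locale filtered_complex = vector_space sc
  for sc :: "'k::field \<Rightarrow> 'v::ab_group_add \<Rightarrow> 'v" +
  fixes C :: "int \<Rightarrow> 'v set" and F :: "int \<Rightarrow> int \<Rightarrow> 'v set" and D :: "'v \<Rightarrow> 'v"
  assumes subspace_C: "subspace (C n)" and subspace_F: "subspace (F p n)"
    and F_sub_C: "F p n \<subseteq> C n" and F_decreasing: "F (p + 1) n \<subseteq> F p n"
    and F_bounded: "\<exists>s t. F s n = C n \<and> F t n = {0}"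
    and D_linear: "linear_between sc sc (C n) (C (n + 1)) D"
    and D_F: "x \<in> F p n \<Longrightarrow> D x \<in> F p (n + 1)"
    and D_D: "x \<in> C n \<Longrightarrow> D (D x) = 0"
begin

lemma F_antimono:
  assumes "p \<le> p'" shows "F p' n \<subseteq> F p n"
proof -
  have "F (p + int k) n \<subseteq> F p n" for k
    using F_decreasing by (induction k) (auto simp: add.assoc[symmetric] add.commute[of 1])
  from this[of "nat (p' - p)"] show ?thesis using assms by simp
qed

lemma D_C: "x \<in> C n \<Longrightarrow> D x \<in> C (n + 1)"
  and D_add: "x \<in> C n \<Longrightarrow> y \<in> C n \<Longrightarrow> D (x + y) = D x + D y"
  and D_scale: "x \<in> C n \<Longrightarrow> D (sc c x) = sc c (D x)"
  using D_linear[of n] by (auto simp: linear_between_def)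

lemma D_0: "D 0 = 0"
  using D_scale[of 0 0 0] subspace_0[OF subspace_C] by simp

lemma D_diff: "x \<in> C n \<Longrightarrow> y \<in> C n \<Longrightarrow> D (x - y) = D x - D y"
  using D_add[of "x - y" n y] subspace_diff[OF subspace_C] by simp

lemma subspace_D_image:
  assumes T: "subspace T" "T \<subseteq> C n" shows "subspace (D ` T)"
proof (rule subspaceI)
  show "0 \<in> D ` T" using subspace_0[OF T(1)] D_0 by force
next
  fix u v assume "u \<in> D ` T" "v \<in> D ` T"
  then obtain x y where xy: "x \<in> T" "y \<in> T" "u = D x" "v = D y" by blast
  then have "x \<in> C n" "y \<in> C n" using T by blast+
  then have "u + v = D (x + y)" using xy by (simp add: D_add)
  then show "u + v \<in> D ` T" using xy subspace_add[OF T(1)] by blast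
next
  fix c v assume "v \<in> D ` T"
  then obtain x where x: "x \<in> T" "v = D x" by blast
  then have "x \<in> C n" using T by blast
  then have "sc c v = D (sc c x)" using x by (simp add: D_scale)
  then show "sc c v \<in> D ` T" using x subspace_scale[OF T(1)] by blast
qed

text \<open>
  The sets \<open>Z\<^sub>r\<^sup>p\<close> of the standard construction; the sets \<open>boundaries\<close> are the denominators
  \<open>Z\<^sub>r\<^sub>-\<^sub>1\<^sup>p\<^sup>+\<^sup>1 + D Z\<^sub>r\<^sub>-\<^sub>1\<^sup>p\<^sup>-\<^sup>r\<^sup>+\<^sup>1\<close> for \<open>r \<ge> 1\<close>.
\<close>

definition cycles :: "nat \<Rightarrow> int \<Rightarrow> int \<Rightarrow> 'v set"
  where "cycles r p n = {x \<in> F p n. D x \<in> F (p + int r) (n + 1)}"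

definition boundaries :: "nat \<Rightarrow> int \<Rightarrow> int \<Rightarrow> 'v set"
  where "boundaries r p n =
    {y + D z | y z. y \<in> cycles (r - 1) (p + 1) n \<and> z \<in> cycles (r - 1) (p - int r + 1) (n - 1)}"

lemma subspace_cycles: "subspace (cycles r p n)"
  using F_sub_C[of p n] subspace_F
  by (auto intro!: subspaceI simp: cycles_def subspace_0 D_0 subspace_add subspace_scale subset_iff
      D_add[of _ n] D_scale[of _ n])

lemma cycles_C: "x \<in> cycles r p n \<Longrightarrow> x \<in> C n"
  using F_sub_C by (auto simp: cycles_def)

lemma subspace_boundaries: "subspace (boundaries r p n)"
proof -
  have "subspace (D ` cycles (r - 1) (p - int r + 1) (n - 1))"
    using cycles_C by (intro subspace_D_image[OF subspace_cycles]) blast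
  from subspace_sums[OF subspace_cycles[of "r - 1" "p + 1" n] this]
  have "subspace {y + w | y w. y \<in> cycles (r - 1) (p + 1) n \<and> w \<in> D ` cycles (r - 1) (p - int r + 1) (n - 1)}" .
  moreover have "\<dots> = boundaries r p n" unfolding boundaries_def by blast
  finally show ?thesis .
qed

lemma boundariesI:
  "y \<in> cycles s (p + 1) n \<Longrightarrow> z \<in> cycles s (p - int s) (n - 1) \<Longrightarrow> x = y + D z \<Longrightarrow>
     x \<in> boundaries (Suc s) p n"
  unfolding boundaries_def by auto

lemma boundariesE:
  assumes "x \<in> boundaries (Suc s) p n"
  obtains y z where "y \<in> cycles s (p + 1) n" "z \<in> cycles s (p - int s) (n - 1)" "x = y + D z"
  using assms unfolding boundaries_def by auto

lemma boundaries_cycles: "boundaries (Suc s) p n \<subseteq> cycles (Suc s) p n"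
proof
  fix x assume "x \<in> boundaries (Suc s) p n"
  then obtain y z where yz: "y \<in> cycles s (p + 1) n" "z \<in> cycles s (p - int s) (n - 1)" "x = y + D z"
    by (rule boundariesE)
  have "y \<in> F p n" "D z \<in> F p n" using yz F_decreasing by (auto simp: cycles_def)
  moreover have "D x = D y"
    using yz D_add[of y n "D z"] D_D[of z "n - 1"] D_C[of z "n - 1"] cycles_C by auto
  moreover have "D y \<in> F (p + int (Suc s)) (n + 1)" using yz by (simp add: cycles_def add_ac)
  ultimately show "x \<in> cycles (Suc s) p n"
    using yz subspace_add[OF subspace_F] by (simp add: cycles_def)
qed

definition page :: "nat \<Rightarrow> int \<Rightarrow> int \<Rightarrow> ('k, 'v set) module"
  where "page r p q = subquotient_vs sc (cycles r p (p + q)) (boundaries r p (p + q))"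

lemma presents_page:
  assumes "r \<ge> 1"
  shows "presents sc (cycles r p (p + q)) (boundaries r p (p + q))
           (coset_class (boundaries r p (p + q))) (page r p q)"
  unfolding page_def using assms boundaries_cycles[of "r - 1"]
  by (intro presents_subquotient vector_space_axioms subspace_cycles subspace_boundaries) simp

lemma presents_page':
  assumes "r \<ge> 1" "p + q = n"
  shows "presents sc (cycles r p n) (boundaries r p n) (coset_class (boundaries r p n)) (page r p q)"
  using presents_page[OF assms(1), of p q] assms(2) by simp

lemma D_cycles:
  assumes "x \<in> cycles r p n" shows "D x \<in> cycles r (p + int r) (n + 1)"
  using assms cycles_C[OF assms] subspace_0[OF subspace_F] by (auto simp: cycles_def D_D)

lemma linear_between_page: "linear_between sc sc (cycles r p n) (cycles r (p + int r) (n + 1)) D"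
  using cycles_C D_cycles by (auto simp: linear_between_def D_add[of _ n] D_scale[of _ n])

lemma D_boundaries:
  assumes "r \<ge> 1" "x \<in> boundaries r p n" shows "D x \<in> boundaries r (p + int r) (n + 1)"
proof -
  obtain s where r: "r = Suc s" using assms by (cases r) auto
  obtain y z where yz: "y \<in> cycles s (p + 1) n" "z \<in> cycles s (p - int s) (n - 1)" "x = y + D z"
    using assms(2) unfolding r by (rule boundariesE)
  have "D x = 0 + D y"
    using yz D_add[of y n "D z"] D_D[of z "n - 1"] D_C[of z "n - 1"] cycles_C by auto
  then show ?thesis unfolding r
    using yz subspace_0[OF subspace_cycles] by (intro boundariesI[of 0 _ _ _ y]) auto
qed

definition page_diff :: "nat \<Rightarrow> int \<Rightarrow> int \<Rightarrow> 'v set \<Rightarrow> 'v set"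
  where "page_diff r p q =
    (SOME g. linear_map class_ring (page r p q) (page r (p + int r) (q - int r + 1)) g \<and>
       (\<forall>x\<in>cycles r p (p + q). g (coset_class (boundaries r p (p + q)) x)
          = coset_class (boundaries r (p + int r) (p + q + 1)) (D x)))"

lemma page_diff:
  assumes "r \<ge> 1" "p + q = n"
  shows "linear_map class_ring (page r p q) (page r (p + int r) (q - int r + 1)) (page_diff r p q)"
    and "x \<in> cycles r p n \<Longrightarrow> page_diff r p q (coset_class (boundaries r p n) x)
          = coset_class (boundaries r (p + int r) (n + 1)) (D x)"
proof -
  have "presents sc (cycles r (p + int r) (n + 1)) (boundaries r (p + int r) (n + 1))
          (coset_class (boundaries r (p + int r) (n + 1))) (page r (p + int r) (q - int r + 1))"
    by (rule presents_page') (use assms in auto)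
  from presents_induced_map[OF presents_page'[OF assms] this linear_between_page]
  obtain g where "linear_map class_ring (page r p q) (page r (p + int r) (q - int r + 1)) g"
    "\<And>x. x \<in> cycles r p n \<Longrightarrow> g (coset_class (boundaries r p n) x)
          = coset_class (boundaries r (p + int r) (n + 1)) (D x)"
    using D_boundaries[OF assms(1)] by blast
  then have "\<exists>g. linear_map class_ring (page r p q) (page r (p + int r) (q - int r + 1)) g \<and>
       (\<forall>x\<in>cycles r p (p + q). g (coset_class (boundaries r p (p + q)) x)
          = coset_class (boundaries r (p + int r) (p + q + 1)) (D x))"
    using assms(2) by blast
  from someI_ex[OF this]
  show "linear_map class_ring (page r p q) (page r (p + int r) (q - int r + 1)) (page_diff r p q)"
    and "x \<in> cycles r p n \<Longrightarrow> page_diff r p q (coset_class (boundaries r p n) x)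
          = coset_class (boundaries r (p + int r) (n + 1)) (D x)"
    using assms(2) unfolding page_diff_def by blast+
qed

lemma cycles_mono: "p' \<le> p \<Longrightarrow> p' + int r' \<le> p + int r \<Longrightarrow> cycles r p n \<subseteq> cycles r' p' n"
  using F_antimono[of p' p] F_antimono[of "p' + int r'" "p + int r"] by (auto simp: cycles_def)

text \<open>
  Let \<open>x\<close> represent a class killed by the differential of page \<open>r\<close>.  Then \<open>D x\<close> differs from an element
  of filtration \<open>p + r + 1\<close> by some \<open>D w\<close> with \<open>w\<close> in \<open>Z\<^sub>r\<^sub>-\<^sub>1\<^sup>p\<^sup>+\<^sup>1\<close>; such a \<open>w\<close> represents zero, and \<open>x - w\<close> lies in
  \<open>Z\<^sub>r\<^sub>+\<^sub>1\<^sup>p\<close>.  So \<open>Z\<^sub>r\<^sub>+\<^sub>1\<^sup>p\<close> represents all cocycles of the page.  An element of it is a coboundary of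
  the page if it is a sum of some \<open>D z\<close> with \<open>z\<close> in \<open>Z\<^sub>r\<^sup>p\<^sup>-\<^sup>r\<close> and some \<open>k\<close> in \<open>Z\<^sub>r\<^sub>-\<^sub>1\<^sup>p\<^sup>+\<^sup>1\<close>; then \<open>D k = D x\<close>
  has filtration \<open>p + r + 1\<close>, that is, \<open>k\<close> lies in \<open>Z\<^sub>r\<^sup>p\<^sup>+\<^sup>1\<close>.
\<close>

lemma next_page:
  assumes "r \<ge> 1"
  shows "vs_iso (page (Suc r) p q)
       (cohomology_at (page r (p - int r) (q + int r - 1)) (page_diff r (p - int r) (q + int r - 1))
          (page r p q) (page_diff r p q) (page r (p + int r) (q - int r + 1)))"
proof -
  define n where "n = p + q"
  obtain s where r: "r = Suc s" using assms by (cases r) auto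
  have U: "presents sc (cycles r (p - int r) (n - 1)) (boundaries r (p - int r) (n - 1))
     (coset_class (boundaries r (p - int r) (n - 1))) (page r (p - int r) (q + int r - 1))"
    by (rule presents_page'[OF assms]) (simp add: n_def)
  have V: "presents sc (cycles r p n) (boundaries r p n) (coset_class (boundaries r p n)) (page r p q)"
    by (rule presents_page'[OF assms]) (simp add: n_def)
  have W: "presents sc (cycles r (p + int r) (n + 1)) (boundaries r (p + int r) (n + 1))
     (coset_class (boundaries r (p + int r) (n + 1))) (page r (p + int r) (q - int r + 1))"
    by (rule presents_page'[OF assms]) (simp add: n_def)
  define Z where "Z = {x \<in> cycles r p n. D x \<in> boundaries r (p + int r) (n + 1)}"
  define B where "B = {D y + k | y k. y \<in> cycles r (p - int r) (n - 1) \<and> k \<in> boundaries r p n}"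
  obtain \<pi> where P: "presents sc Z B \<pi>
     (cohomology_at (page r (p - int r) (q + int r - 1)) (page_diff r (p - int r) (q + int r - 1))
          (page r p q) (page_diff r p q) (page r (p + int r) (q - int r + 1)))"
  proof (rule that, unfold Z_def B_def, rule presents_cohomology_at[OF U V W])
    show "linear_between sc sc (cycles r (p - int r) (n - 1)) (cycles r p n) D"
      using linear_between_page[of r "p - int r" "n - 1"] by simp
    show "linear_between sc sc (cycles r p n) (cycles r (p + int r) (n + 1)) D"
      by (rule linear_between_page)
    fix x
    show "x \<in> cycles r (p - int r) (n - 1) \<Longrightarrow>
         page_diff r (p - int r) (q + int r - 1) (coset_class (boundaries r (p - int r) (n - 1)) x) =
         coset_class (boundaries r p n) (D x)"
      using page_diff(2)[OF assms, of "p - int r" "q + int r - 1" "n - 1" x] by (simp add: n_def)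
    show "x \<in> cycles r p n \<Longrightarrow> page_diff r p q (coset_class (boundaries r p n) x) =
         coset_class (boundaries r (p + int r) (n + 1)) (D x)"
      using page_diff(2)[OF assms, of p q n x] by (simp add: n_def)
    show "x \<in> cycles r (p - int r) (n - 1) \<Longrightarrow> D (D x) \<in> boundaries r (p + int r) (n + 1)"
      using subspace_0[OF subspace_boundaries] D_D[OF cycles_C] by auto
    show "x \<in> boundaries r p n \<Longrightarrow> D x \<in> boundaries r (p + int r) (n + 1)"
      using D_boundaries[OF assms] by simp
  qed
  have P_next: "presents sc (cycles (Suc r) p n) (boundaries (Suc r) p n)
      (coset_class (boundaries (Suc r) p n)) (page (Suc r) p q)"
    by (rule presents_page') (simp_all add: n_def)
  have zero_cycle: "0 \<in> cycles r' p' n'" for r' p' n' by (rule subspace_0[OF subspace_cycles])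
  show ?thesis
  proof (rule vs_iso_presents[OF P_next P, of "\<lambda>x. x"])
    have "x \<in> Z" if x: "x \<in> cycles (Suc r) p n" for x
    proof -
      have "x \<in> cycles r p n" using x cycles_mono[of p p r "Suc r" n] by auto
      moreover have "D x \<in> cycles s (p + int r + 1) (n + 1)"
        using x cycles_C[OF x] subspace_0[OF subspace_F]
        by (auto simp: cycles_def D_D add_ac)
      then have "D x \<in> boundaries r (p + int r) (n + 1)"
        unfolding r using zero_cycle by (intro boundariesI[of _ _ _ _ 0]) (auto simp: D_0)
      ultimately show ?thesis by (simp add: Z_def)
    qed
    then show "linear_between sc sc (cycles (Suc r) p n) Z (\<lambda>x. x)" by (auto simp: linear_between_def)
  next
    fix x assume x: "x \<in> cycles (Suc r) p n"
    show "x \<in> B \<longleftrightarrow> x \<in> boundaries (Suc r) p n"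
    proof
      assume "x \<in> boundaries (Suc r) p n"
      then obtain y z where yz: "y \<in> cycles r (p + 1) n" "z \<in> cycles r (p - int r) (n - 1)" "x = y + D z"
        by (rule boundariesE)
      have "y \<in> cycles s (p + 1) n" using yz cycles_mono[of "p + 1" "p + 1" s r n] r by auto
      then have "y \<in> boundaries r p n"
        unfolding r using zero_cycle by (intro boundariesI[of _ _ _ _ 0]) (auto simp: D_0)
      moreover have "x = D z + y" using yz by simp
      ultimately show "x \<in> B" unfolding B_def using yz(2) \<open>y \<in> boundaries r p n\<close> by blast
    next
      assume "x \<in> B"
      then obtain y k where yk: "y \<in> cycles r (p - int r) (n - 1)" "k \<in> boundaries r p n" "x = D y + k"
        by (auto simp: B_def)
      obtain k1 k2 where k: "k1 \<in> cycles s (p + 1) n" "k2 \<in> cycles s (p - int s) (n - 1)" "k = k1 + D k2"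
        using yk(2) unfolding r by (rule boundariesE)
      have k2: "k2 \<in> cycles r (p - int r) (n - 1)"
        using k cycles_mono[of "p - int r" "p - int s" r s] r by auto
      have z: "y + k2 \<in> cycles r (p - int r) (n - 1)"
        using yk k2 by (simp add: subspace_add[OF subspace_cycles])
      have x_eq: "x = k1 + D (y + k2)"
        using yk k k2 cycles_C by (simp add: D_add[of _ "n - 1"])
      then have "D x = D k1"
        using D_add[of k1 n "D (y + k2)"] D_D[of "y + k2" "n - 1"] D_C[of "y + k2" "n - 1"] cycles_C[OF z]
          cycles_C[OF k(1)] by simp
      then have "k1 \<in> cycles r (p + 1) n" using x k(1) by (simp add: cycles_def add_ac)
      then show "x \<in> boundaries (Suc r) p n" using z x_eq by (intro boundariesI)
    qed
  next
    fix x assume "x \<in> Z"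
    then have x: "x \<in> cycles r p n" "D x \<in> boundaries r (p + int r) (n + 1)" by (auto simp: Z_def)
    obtain y w where yw: "y \<in> cycles s (p + int r + 1) (n + 1)"
      "w \<in> cycles s (p + int r - int s) (n + 1 - 1)" "D x = y + D w"
      using x(2) unfolding r by (rule boundariesE)
    have w: "w \<in> cycles s (p + 1) n" using yw(2) r by simp
    have wF: "w \<in> F p n" using w F_decreasing by (auto simp: cycles_def)
    have "D (x - w) = y" using yw(3) cycles_C[OF x(1)] cycles_C[OF w] by (simp add: D_diff[of _ n])
    then have "x - w \<in> cycles (Suc r) p n"
      using yw(1) x(1) wF subspace_diff[OF subspace_F] by (auto simp: cycles_def add_ac)
    moreover have "w \<in> boundaries r p n"
      unfolding r using w zero_cycle by (intro boundariesI[of _ _ _ _ 0]) (auto simp: D_0)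
    then have "x - (x - w) \<in> B" unfolding B_def using zero_cycle D_0 by force
    ultimately show "\<exists>x'\<in>cycles (Suc r) p n. x - x' \<in> B" by blast
  qed
qed

lemma spectral_sequence_pages:
  assumes "r0 \<ge> 1" shows "spectral_sequence r0 page page_diff"
  unfolding spectral_sequence_def
proof (intro allI impI conjI ballI)
  fix r p q assume "r0 \<le> r"
  with assms have r: "r \<ge> 1" by simp
  show "linear_map class_ring (page r p q) (page r (p + int r) (q - int r + 1)) (page_diff r p q)"
    by (rule page_diff[OF r refl])
  show "vs_iso (page (Suc r) p q)
       (cohomology_at (page r (p - int r) (q + int r - 1)) (page_diff r (p - int r) (q + int r - 1))
          (page r p q) (page_diff r p q) (page r (p + int r) (q - int r + 1)))"
    by (rule next_page[OF r])
  fix v assume "v \<in> carrier (page r p q)"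
  then obtain x where x: "x \<in> cycles r p (p + q)" "v = coset_class (boundaries r p (p + q)) x"
    by (auto simp: presents_carrier[OF presents_page[OF r]])
  have "page_diff r (p + int r) (q - int r + 1) (page_diff r p q v)
      = coset_class (boundaries r (p + int r + int r) (p + q + 1 + 1)) 0"
    using x(1) page_diff(2)[OF r refl x(1)] x(2) D_cycles[OF x(1)]
      page_diff(2)[OF r, of "p + int r" "q - int r + 1" "p + q + 1" "D x"] D_D[OF cycles_C[OF x(1)]]
    by simp
  also have "\<dots> = \<zero>\<^bsub>page r (p + int r + int r) (q - int r + 1 - int r + 1)\<^esub>"
    by (rule presents_zero[OF presents_page'[OF r]]) simp
  finally show "page_diff r (p + int r) (q - int r + 1) (page_diff r p q v)
      = \<zero>\<^bsub>page r (p + int r + int r) (q - int r + 1 - int r + 1)\<^esub>" .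
qed

text \<open>
  Once \<open>r\<close> exceeds the width of the filtration in the neighbouring degrees, \<open>Z\<^sub>r\<^sup>p\<close> consists of the
  cocycles of filtration \<open>p\<close>, and \<open>D Z\<^sub>r\<^sub>-\<^sub>1\<^sup>p\<^sup>-\<^sup>r\<^sup>+\<^sup>1\<close> of all coboundaries of filtration \<open>p\<close>.  Then the
  differentials of the page vanish at this spot, and its term has the same representatives and the
  same kernel as the graded piece of the cohomology.
\<close>

lemma converges_to_cohomology:
  assumes "r0 \<ge> 1" and V: "\<And>n. presents sc (C n) {0} (\<lambda>x. x) (V n)"
  shows "converges_to r0 page page_diff (cohomology V (\<lambda>_. D))"
proof -
  define H where "H = cohomology V (\<lambda>_. D)"
  define Z where "Z n = {x \<in> C n. D x = 0}" for n
  define B where "B n = D ` C (n - 1)" for n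
  have P: "presents sc (Z n) (B n) (coset_class (B n)) (H n)" for n
    unfolding H_def Z_def B_def
    by (rule presents_cohomology[where C = C and d = "\<lambda>_. D", OF V D_linear D_D])
  define ZF where "ZF p n = {x \<in> F p n. D x = 0}" for p n
  have ZF: "subspace (ZF p n)" "ZF p n \<subseteq> Z n" for p n
    using subspace_F F_sub_C[of p n]
    by (auto intro!: subspaceI simp: Z_def ZF_def subspace_0 D_0 subspace_add subspace_scale subset_iff
        D_add[of _ n] D_scale[of _ n])
  have ZF_decreasing: "ZF (p + 1) n \<subseteq> ZF p n" for p n using F_decreasing by (auto simp: ZF_def)
  define FH where "FH p n = coset_class (B n) ` ZF p n" for p n
  show ?thesis unfolding converges_to_def H_def[symmetric]
  proof (intro exI[of _ FH] conjI allI)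
    fix p n
    show "VectorSpace.subspace class_ring (FH p n) (H n)"
      unfolding FH_def by (rule presents_image_subspace[OF P ZF])
    show "FH (p + 1) n \<subseteq> FH p n" using ZF_decreasing by (auto simp: FH_def)
  next
    fix n
    obtain s t where "F s n = C n" "F t n = {0}" using F_bounded by blast
    then have "ZF s n = Z n" "ZF t n = {0}" by (auto simp: ZF_def Z_def D_0)
    then have "FH s n = carrier (H n)" "FH t n = {\<zero>\<^bsub>H n\<^esub>}"
      by (simp_all add: FH_def presents_carrier[OF P] presents_zero[OF P])
    then show "\<exists>s t. FH s n = carrier (H n) \<and> FH t n = {\<zero>\<^bsub>H n\<^esub>}" by blast
  next
    fix p q :: int
    define n where "n = p + q"
    let ?G = "quotient_vs ((H n)\<lparr>carrier := FH p n\<rparr>) (FH (p + 1) n)"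
    define BF where "BF = {t + k | t k. t \<in> ZF (p + 1) n \<and> k \<in> B n \<inter> ZF p n}"
    obtain \<sigma> where G: "presents sc (ZF p n) BF \<sigma> ?G"
      using presents_quotient[OF presents_restrict[OF P ZF FH_def] ZF(1) ZF_decreasing FH_def]
      unfolding BF_def by blast
    obtain a where a: "F a (n - 1) = C (n - 1)" using F_bounded by blast
    obtain b where b: "F b (n + 1) = {0}" using F_bounded by blast
    \<comment> \<open>Both \<open>r\<close> and \<open>r - 1\<close> have to exceed the distances of \<open>p\<close> from the two bounds.\<close>
    define r1 where "r1 = r0 + nat (p - a) + nat (b - p) + 2"
    have low: "F p' (n - 1) = C (n - 1)" if "p' \<le> a" for p'
      using a F_antimono[OF that, of "n - 1"] F_sub_C by blast
    have high: "F p' (n + 1) = {0}" if "b \<le> p'" for p'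
      using b F_antimono[OF that, of "n + 1"] subspace_0[OF subspace_F] by auto
    show "limit_term r0 page page_diff p q (quotient_vs ((H (p + q))\<lparr>carrier := FH p (p + q)\<rparr>) (FH (p + 1) (p + q)))"
      unfolding limit_term_def n_def[symmetric]
    proof (intro exI[of _ r1] conjI allI impI ballI)
      show "r0 \<le> r1" by (simp add: r1_def)
    next
      fix r assume "r1 \<le> r"
      then obtain s where r: "r = Suc s" and r1: "r \<ge> 1" "b \<le> p + int s" "p - int s \<le> a"
        by (cases r) (auto simp: r1_def)
      have low': "F (p - int s) (n - 1) = C (n - 1)" "F (p - int r) (n - 1) = C (n - 1)"
        using low r1 r by auto
      have high': "F (p + int s) (n + 1) = {0}" "F (p + int r) (n + 1) = {0}"
        using high r1 r by auto
      have C_r: "cycles r p n = ZF p n" "cycles s (p + 1) n = ZF (p + 1) n"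
        using high' by (auto simp: cycles_def ZF_def r add_ac)
      have C_in: "cycles s (p - int s) (n - 1) = {x \<in> C (n - 1). D x \<in> F p n}"
        "cycles r (p - int r) (n - 1) = {x \<in> C (n - 1). D x \<in> F p n}"
        using low' by (auto simp: cycles_def)
      {
        fix v assume "v \<in> carrier (page r p q)"
        then obtain x where x: "x \<in> cycles r p n" "v = coset_class (boundaries r p n) x"
          by (auto simp: presents_carrier[OF presents_page[OF r1(1)]] n_def)
        then have "D x = 0" using C_r by (auto simp: ZF_def)
        then have "page_diff r p q v = coset_class (boundaries r (p + int r) (n + 1)) 0"
          using page_diff(2)[OF r1(1) n_def[symmetric] x(1)] x(2) by simp
        also have "\<dots> = \<zero>\<^bsub>page r (p + int r) (q - int r + 1)\<^esub>"
          by (rule presents_zero[OF presents_page'[OF r1(1)]]) (simp add: n_def)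
        finally show "page_diff r p q v = \<zero>\<^bsub>page r (p + int r) (q - int r + 1)\<^esub>" .
      next
        fix v assume "v \<in> carrier (page r (p - int r) (q + int r - 1))"
        moreover have U: "presents sc (cycles r (p - int r) (n - 1)) (boundaries r (p - int r) (n - 1))
          (coset_class (boundaries r (p - int r) (n - 1))) (page r (p - int r) (q + int r - 1))"
          by (rule presents_page'[OF r1(1)]) (simp add: n_def)
        ultimately obtain x where x: "x \<in> cycles r (p - int r) (n - 1)"
          "v = coset_class (boundaries r (p - int r) (n - 1)) x"
          by (auto simp: presents_carrier[OF U])
        have "D x \<in> boundaries r p n"
          unfolding r using x C_in subspace_0[OF subspace_cycles] by (intro boundariesI[of 0 _ _ _ x]) auto
        moreover have "page_diff r (p - int r) (q + int r - 1) v = coset_class (boundaries r p n) (D x)"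
          using page_diff(2)[OF r1(1) _ x(1), of "q + int r - 1"] x(2) by (simp add: n_def)
        ultimately show "page_diff r (p - int r) (q + int r - 1) v = \<zero>\<^bsub>page r p q\<^esub>"
          using presents_eq_zero_iff[OF presents_page'[OF r1(1)], of p q n "D x"]
            boundaries_cycles[of s p n] by (auto simp: n_def r)
      }
      have "boundaries r p n = BF"
        unfolding r boundaries_def BF_def using C_r C_in D_D
        by (auto simp: B_def ZF_def) blast
      with C_r show "vs_iso (page r p q) ?G"
        by (intro vs_iso_presents[OF presents_page'[OF r1(1) n_def[symmetric]] G, of "\<lambda>x. x"])
          (use subspace_0[OF subspace_boundaries[of r p n]] in \<open>auto simp: linear_between_def intro!: bexI\<close>)
    qed
  qed
qed

end

section \<open>Tensor powers and multilinear maps\<close>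

lemma lin_maps_iff:
  assumes "vectorspace class_ring V" "vectorspace class_ring W"
  shows "T \<in> lin_maps V W \<longleftrightarrow> linear_map class_ring V W T \<and> (\<forall>v. v \<notin> carrier V \<longrightarrow> T v = \<zero>\<^bsub>W\<^esub>)"
  using assms unfolding lin_maps_def linear_map_def mod_hom_def mod_hom_axioms_def vectorspace_def
  by auto

lemma span_of_subspace:
  assumes "vectorspace class_ring V" "R \<subseteq> carrier V"
  shows "VectorSpace.subspace class_ring (span_of V R) V" and "R \<subseteq> span_of V R"
proof -
  interpret V: vectorspace class_ring V by (rule assms)
  show "VectorSpace.subspace class_ring (span_of V R) V" "R \<subseteq> span_of V R"
    using V.span_is_submodule[OF assms(2)] V.in_own_span[OF assms(2)] assms(1)
    by (auto simp: span_of_def VectorSpace.subspace_def)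
qed

lemma span_of_minimal:
  assumes "VectorSpace.subspace class_ring N V" "R \<subseteq> N"
  shows "span_of V R \<subseteq> N"
proof -
  interpret N: VectorSpace.subspace class_ring N V by (rule assms)
  interpret V: vectorspace class_ring V by (rule N.vs)
  show ?thesis unfolding span_of_def by (rule V.span_is_subset[OF assms(2) N.submod])
qed

lemma subspace_equalizer:
  assumes "linear_map class_ring V W f" "linear_map class_ring V W g"
  shows "VectorSpace.subspace class_ring {v \<in> carrier V. f v = g v} V"
proof -
  interpret V: vectorspace class_ring V by (rule linear_mapD[OF assms(1)])
  show ?thesis
    by unfold_locales (auto simp: linear_mapD[OF assms(1)] linear_mapD[OF assms(2)])
qed

lemma linear_map_eq_on_span:
  assumes "linear_map class_ring V W f" "linear_map class_ring V W g"
    and R: "R \<subseteq> carrier V" and eq: "\<And>v. v \<in> R \<Longrightarrow> f v = g v" and v: "v \<in> span_of V R"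
  shows "f v = g v"
  using span_of_minimal[OF subspace_equalizer[OF assms(1,2)], of R] R eq v by blast

lemma vectorspace_restrict:
  assumes "VectorSpace.subspace class_ring N V"
  shows "vectorspace class_ring (V\<lparr>carrier := N\<rparr>)"
  using assms vectorspace.subspace_is_vs VectorSpace.subspace.vs by blast

lemma linear_map_restrict:
  assumes "VectorSpace.subspace class_ring N V" "linear_map class_ring V W f"
  shows "linear_map class_ring (V\<lparr>carrier := N\<rparr>) W f"
proof -
  interpret N: VectorSpace.subspace class_ring N V by (rule assms)
  interpret N: submodule class_ring N V by (rule N.submod)
  show ?thesis
    using N.subset by (intro linear_map_classI vectorspace_restrict assms)
      (auto simp: linear_mapD[OF assms(2)] subset_iff)
qed

lemma vectorspace_field_vs: "vectorspace class_ring (field_vs :: ('k::field, 'k) module)"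
proof (rule vs_criteria, rule class_field, goal_cases)
  case 3
  show ?case by (auto simp: field_vs_def intro!: exI[of _ "- v" for v])
qed (auto simp: field_vs_def algebra_simps)

definition pm_scale :: "'k::field \<Rightarrow> ('x \<Rightarrow>\<^sub>0 'k) \<Rightarrow> ('x \<Rightarrow>\<^sub>0 'k)" where
  "pm_scale c = Poly_Mapping.map ((*) c)"

lemma lookup_pm_scale [simp]: "Poly_Mapping.lookup (pm_scale c p) x = c * Poly_Mapping.lookup p x"
  by (simp add: pm_scale_def Poly_Mapping.map.rep_eq when_def)

lemma pm_scale_single [simp]: "pm_scale c (Poly_Mapping.single x a) = Poly_Mapping.single x (c * a)"
  by (rule poly_mapping_eqI) (simp add: lookup_single when_def)

lemma keys_minus_subset:
  "Poly_Mapping.keys p \<subseteq> X \<Longrightarrow> Poly_Mapping.keys q \<subseteq> X \<Longrightarrow>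
     Poly_Mapping.keys (p - q :: 'x \<Rightarrow>\<^sub>0 'k::field) \<subseteq> X"
  using Poly_Mapping.keys_diff[of p q] by blast

lemma keys_plus_subset:
  "Poly_Mapping.keys p \<subseteq> X \<Longrightarrow> Poly_Mapping.keys q \<subseteq> X \<Longrightarrow>
     Poly_Mapping.keys (p + q :: 'x \<Rightarrow>\<^sub>0 'k::field) \<subseteq> X"
  using Poly_Mapping.keys_add[of p q] by blast

lemma keys_single_subset: "x \<in> X \<Longrightarrow> Poly_Mapping.keys (Poly_Mapping.single x c) \<subseteq> X"
  by simp

lemma vector_space_pm_scale: "vector_space pm_scale"
  by unfold_locales (auto intro!: poly_mapping_eqI simp: lookup_add algebra_simps)

lemma presents_free_vs:
  "presents pm_scale {p. Poly_Mapping.keys p \<subseteq> X} {0} (\<lambda>p. p) (free_vs X)"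
proof -
  interpret vector_space pm_scale by (rule vector_space_pm_scale)
  have "subspace {p. Poly_Mapping.keys p \<subseteq> X}"
    by (auto intro!: subspaceI simp: in_keys_iff lookup_add subset_iff) (metis add_0)
  then show ?thesis
    by (auto simp: presents_def vector_space_pm_scale free_vs_def pm_scale_def)
qed

lemma class_smult_0:
  assumes "vectorspace class_ring W" "v \<in> carrier W" shows "0 \<odot>\<^bsub>W\<^esub> v = \<zero>\<^bsub>W\<^esub>"
proof -
  interpret W: vectorspace class_ring W by (rule assms)
  show ?thesis using W.lmult_0[OF assms(2)] by simp
qed

lemma free_vs_extend:
  assumes W: "vectorspace class_ring W" and H: "\<And>x. x \<in> X \<Longrightarrow> H x \<in> carrier W"
  obtains g where "linear_map class_ring (free_vs X) W g"
    and "\<And>x. x \<in> X \<Longrightarrow> g (Poly_Mapping.single x 1) = H x"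
proof -
  interpret W: vectorspace class_ring W by (rule W)
  define T where "T p = (\<Oplus>\<^bsub>W\<^esub>x\<in>Poly_Mapping.keys p. Poly_Mapping.lookup p x \<odot>\<^bsub>W\<^esub> H x)" for p
  have closed: "Poly_Mapping.lookup p x \<odot>\<^bsub>W\<^esub> H x \<in> carrier W" if "x \<in> X" for p x
    using that H by simp
  have T_eq: "T p = (\<Oplus>\<^bsub>W\<^esub>x\<in>Y. Poly_Mapping.lookup p x \<odot>\<^bsub>W\<^esub> H x)"
    if "finite Y" "Poly_Mapping.keys p \<subseteq> Y" "Y \<subseteq> X" for p Y
    unfolding T_def using that H closed class_smult_0[OF W]
    by (intro W.M.add.finprod_mono_neutral_cong_left) (auto simp: in_keys_iff)
  have "linear_map class_ring (free_vs X) W T"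
  proof (rule linear_map_classI)
    show "vectorspace class_ring (free_vs X)" by (rule presents_vectorspace[OF presents_free_vs])
    show "vectorspace class_ring W" by (rule W)
    show "T p \<in> carrier W" if "p \<in> carrier (free_vs X)" for p
      unfolding T_def using that closed by (intro W.M.finsum_closed) (auto simp: free_vs_def)
    show "T (p \<oplus>\<^bsub>free_vs X\<^esub> q) = T p \<oplus>\<^bsub>W\<^esub> T q"
      if "p \<in> carrier (free_vs X)" "q \<in> carrier (free_vs X)" for p q
    proof -
      let ?Y = "Poly_Mapping.keys p \<union> Poly_Mapping.keys q"
      have Y: "?Y \<subseteq> X" using that by (auto simp: free_vs_def)
      have "T (p + q) = (\<Oplus>\<^bsub>W\<^esub>x\<in>?Y. Poly_Mapping.lookup (p + q) x \<odot>\<^bsub>W\<^esub> H x)"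
        using Y Poly_Mapping.keys_add[of p q] by (intro T_eq) auto
      also have "\<dots> = (\<Oplus>\<^bsub>W\<^esub>x\<in>?Y. Poly_Mapping.lookup p x \<odot>\<^bsub>W\<^esub> H x \<oplus>\<^bsub>W\<^esub> Poly_Mapping.lookup q x \<odot>\<^bsub>W\<^esub> H x)"
      proof (rule W.M.finsum_cong')
        fix x assume "x \<in> ?Y"
        then have "H x \<in> carrier W" using Y H by blast
        then show "Poly_Mapping.lookup (p + q) x \<odot>\<^bsub>W\<^esub> H x =
          Poly_Mapping.lookup p x \<odot>\<^bsub>W\<^esub> H x \<oplus>\<^bsub>W\<^esub> Poly_Mapping.lookup q x \<odot>\<^bsub>W\<^esub> H x"
          using W.smult_l_distr[of "Poly_Mapping.lookup p x" "Poly_Mapping.lookup q x" "H x"]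
          by (simp add: lookup_add)
      qed (use Y closed in auto)
      also have "\<dots> = T p \<oplus>\<^bsub>W\<^esub> T q"
        using Y closed by (subst W.M.finsum_addf) (auto simp: T_eq[of ?Y])
      finally show ?thesis by (simp add: free_vs_def)
    qed
    show "T (c \<odot>\<^bsub>free_vs X\<^esub> p) = c \<odot>\<^bsub>W\<^esub> T p" if "p \<in> carrier (free_vs X)" for c p
    proof -
      let ?Y = "Poly_Mapping.keys p"
      have Y: "?Y \<subseteq> X" using that by (auto simp: free_vs_def)
      have "T (pm_scale c p) = (\<Oplus>\<^bsub>W\<^esub>x\<in>?Y. Poly_Mapping.lookup (pm_scale c p) x \<odot>\<^bsub>W\<^esub> H x)"
        using Y by (intro T_eq) (auto simp: in_keys_iff)
      also have "\<dots> = (\<Oplus>\<^bsub>W\<^esub>x\<in>?Y. c \<odot>\<^bsub>W\<^esub> (Poly_Mapping.lookup p x \<odot>\<^bsub>W\<^esub> H x))"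
      proof (rule W.M.finsum_cong')
        fix x assume "x \<in> ?Y"
        then have "H x \<in> carrier W" using Y H by blast
        then show "Poly_Mapping.lookup (pm_scale c p) x \<odot>\<^bsub>W\<^esub> H x =
          c \<odot>\<^bsub>W\<^esub> (Poly_Mapping.lookup p x \<odot>\<^bsub>W\<^esub> H x)"
          using W.smult_assoc1[of c "Poly_Mapping.lookup p x" "H x"] by simp
      qed (use Y closed in auto)
      also have "\<dots> = c \<odot>\<^bsub>W\<^esub> T p"
        unfolding T_def using Y closed by (subst W.finsum_smult) auto
      finally show ?thesis by (simp add: free_vs_def pm_scale_def)
    qed
  qed
  moreover have "T (Poly_Mapping.single x 1) = H x" if "x \<in> X" for x
    using that H W.smult_one[of "H x"] by (simp add: T_def)
  ultimately show thesis by (rule that)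
qed

context
  fixes A :: "('k::field, 'a) module"
  assumes A: "vectorspace class_ring A"
begin

interpretation A: vectorspace class_ring A by (rule A)

abbreviation tensor_lists :: "nat \<Rightarrow> 'a list set" where
  "tensor_lists n \<equiv> {xs. set xs \<subseteq> carrier A \<and> length xs = n}"

lemma tensor_relationsE:
  assumes "r \<in> tensor_relations A n"
  obtains (add) us vs x y where "set us \<union> set vs \<union> {x, y} \<subseteq> carrier A" "length us + 1 + length vs = n"
      "r = Poly_Mapping.single (us @ (x \<oplus>\<^bsub>A\<^esub> y) # vs) 1
          - Poly_Mapping.single (us @ x # vs) 1 - Poly_Mapping.single (us @ y # vs) 1"
    | (smult) us vs c x where "set us \<union> set vs \<union> {x} \<subseteq> carrier A" "length us + 1 + length vs = n"
      "r = Poly_Mapping.single (us @ (c \<odot>\<^bsub>A\<^esub> x) # vs) 1 - Poly_Mapping.single (us @ x # vs) c"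
  using assms unfolding tensor_relations_def
  apply (elim UnE CollectE exE conjE)
   apply (rule that(1); assumption)
  apply (rule that(2); assumption)
  done

lemma tensor_relations_subset: "tensor_relations A n \<subseteq> carrier (free_vs (tensor_lists n))"
proof
  fix r :: "'a list \<Rightarrow>\<^sub>0 'k" assume "r \<in> tensor_relations A n"
  then have "Poly_Mapping.keys r \<subseteq> tensor_lists n"
  proof (cases rule: tensor_relationsE)
    case (add us vs x y)
    then show ?thesis unfolding add(3) by (intro keys_minus_subset keys_single_subset) auto
  next
    case (smult us vs c x)
    then show ?thesis unfolding smult(3) by (intro keys_minus_subset keys_single_subset) auto
  qed
  then show "r \<in> carrier (free_vs (tensor_lists n))" by (simp add: free_vs_def)
qed

lemma presents_tensor_power:
  "presents pm_scale {p. Poly_Mapping.keys p \<subseteq> tensor_lists n} (tensor_null A n)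
     (\<lambda>p. tensor_null A n +>\<^bsub>free_vs (tensor_lists n)\<^esub> p) (tensor_power A n)"
proof -
  let ?F = "free_vs (tensor_lists n) :: ('k, 'a list \<Rightarrow>\<^sub>0 'k) module"
  have F: "vectorspace class_ring ?F" by (rule presents_vectorspace[OF presents_free_vs])
  have N: "VectorSpace.subspace class_ring (tensor_null A n) ?F"
    unfolding tensor_null_def by (rule span_of_subspace(1)[OF F tensor_relations_subset])
  interpret N: VectorSpace.subspace class_ring "tensor_null A n" ?F by (rule N)
  interpret N: submodule class_ring "tensor_null A n" ?F by (rule N.submod)
  interpret pm: Modules.module pm_scale by (rule vector_space_module[OF vector_space_pm_scale])
  have sub: "tensor_null A n \<subseteq> {p. Poly_Mapping.keys p \<subseteq> tensor_lists n}"
    using N.subset by (simp add: free_vs_def)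
  have "pm.subspace (tensor_null A n)"
    using N.m_closed N.zero_closed N.smult_closed
    by (intro pm.subspaceI) (auto simp: free_vs_def pm_scale_def)
  from presents_quotient[OF presents_free_vs this sub, of "tensor_null A n"]
  show ?thesis by (simp add: tensor_power_def)
qed

lemma vectorspace_tensor_power: "vectorspace class_ring (tensor_power A n)"
  by (rule presents_vectorspace[OF presents_tensor_power])

lemma pure_tensor_eq:
  "length xs = n \<Longrightarrow>
     pure_tensor A xs = tensor_null A n +>\<^bsub>free_vs (tensor_lists n)\<^esub> Poly_Mapping.single xs 1"
  by (simp add: pure_tensor_def)

lemma pure_tensor_closed:
  "set xs \<subseteq> carrier A \<Longrightarrow> length xs = n \<Longrightarrow> pure_tensor A xs \<in> carrier (tensor_power A n)"
  using presents_in_carrier[OF presents_tensor_power, of "Poly_Mapping.single xs 1" n]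
  by (simp add: pure_tensor_eq)

lemma relation_in_null: "r \<in> tensor_relations A n \<Longrightarrow> r \<in> tensor_null A n"
  unfolding tensor_null_def
  using span_of_subspace(2)[OF presents_vectorspace[OF presents_free_vs] tensor_relations_subset] by blast

lemma pure_tensor_add:
  assumes "set us \<union> set vs \<union> {x, y} \<subseteq> carrier A" "length us + 1 + length vs = n"
  shows "pure_tensor A (us @ (x \<oplus>\<^bsub>A\<^esub> y) # vs)
       = pure_tensor A (us @ x # vs) \<oplus>\<^bsub>tensor_power A n\<^esub> pure_tensor A (us @ y # vs)"
proof -
  let ?s = "\<lambda>x. Poly_Mapping.single (us @ x # vs) (1::'k)"
  have "?s (x \<oplus>\<^bsub>A\<^esub> y) - ?s x - ?s y \<in> tensor_relations A n"
    unfolding tensor_relations_def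
    by (intro UnI1 CollectI exI[of _ us] exI[of _ vs] exI[of _ x] exI[of _ y] conjI refl assms)
  then have "?s (x \<oplus>\<^bsub>A\<^esub> y) - (?s x + ?s y) \<in> tensor_null A n"
    using relation_in_null by (simp add: diff_diff_eq)
  moreover have "?s x + ?s y \<in> {p. Poly_Mapping.keys p \<subseteq> tensor_lists n}"
    using assms by (intro CollectI keys_plus_subset keys_single_subset) auto
  ultimately show ?thesis
    using assms presents_add[OF presents_tensor_power, of "?s x" n "?s y"]
      presents_eq_iff[OF presents_tensor_power, of "?s (x \<oplus>\<^bsub>A\<^esub> y)" n "?s x + ?s y"]
    by (simp add: pure_tensor_eq)
qed

lemma pure_tensor_smult:
  assumes "set us \<union> set vs \<union> {x} \<subseteq> carrier A" "length us + 1 + length vs = n"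
  shows "pure_tensor A (us @ (c \<odot>\<^bsub>A\<^esub> x) # vs) = c \<odot>\<^bsub>tensor_power A n\<^esub> pure_tensor A (us @ x # vs)"
proof -
  let ?s = "\<lambda>x. Poly_Mapping.single (us @ x # vs) (1::'k)"
  have "?s (c \<odot>\<^bsub>A\<^esub> x) - Poly_Mapping.single (us @ x # vs) c \<in> tensor_relations A n"
    unfolding tensor_relations_def
    by (intro UnI2 CollectI exI[of _ us] exI[of _ vs] exI[of _ c] exI[of _ x] conjI refl assms)
  then have "?s (c \<odot>\<^bsub>A\<^esub> x) - pm_scale c (?s x) \<in> tensor_null A n"
    using relation_in_null by simp
  then show ?thesis
    using assms presents_smult[OF presents_tensor_power, of "?s x" n c]
      presents_eq_iff[OF presents_tensor_power, of "?s (c \<odot>\<^bsub>A\<^esub> x)" n "pm_scale c (?s x)"]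
    by (simp add: pure_tensor_eq)
qed

text \<open>
  The relations defining the tensor power measure the failure of multilinearity, so the linear
  extension of a multilinear \<open>H\<close> to the free space kills them.
\<close>

lemma tensor_power_universal:
  assumes W: "vectorspace class_ring W"
    and H: "\<And>xs. xs \<in> tensor_lists n \<Longrightarrow> H xs \<in> carrier W"
    and H_add: "\<And>us vs x y. set us \<union> set vs \<union> {x, y} \<subseteq> carrier A \<Longrightarrow> length us + 1 + length vs = n \<Longrightarrow>
      H (us @ (x \<oplus>\<^bsub>A\<^esub> y) # vs) = H (us @ x # vs) \<oplus>\<^bsub>W\<^esub> H (us @ y # vs)"
    and H_smult: "\<And>us vs c x. set us \<union> set vs \<union> {x} \<subseteq> carrier A \<Longrightarrow> length us + 1 + length vs = n \<Longrightarrow>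
      H (us @ (c \<odot>\<^bsub>A\<^esub> x) # vs) = c \<odot>\<^bsub>W\<^esub> H (us @ x # vs)"
  obtains g where "linear_map class_ring (tensor_power A n) W g"
    and "\<And>xs. xs \<in> tensor_lists n \<Longrightarrow> g (pure_tensor A xs) = H xs"
proof -
  interpret W: vectorspace class_ring W by (rule W)
  let ?F = "free_vs (tensor_lists n) :: ('k, 'a list \<Rightarrow>\<^sub>0 'k) module"
  let ?s = "\<lambda>xs. Poly_Mapping.single xs (1::'k)"
  obtain T where T: "linear_map class_ring ?F W T"
    and T_single: "\<And>xs. xs \<in> tensor_lists n \<Longrightarrow> T (?s xs) = H xs"
    using free_vs_extend[OF W, of "tensor_lists n" H] H by blast
  interpret T: linear_map class_ring ?F W T by (rule T)
  have S: "carrier ?F = {p. Poly_Mapping.keys p \<subseteq> tensor_lists n}" by (simp add: free_vs_def)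
  have T_add: "T (p + q) = T p \<oplus>\<^bsub>W\<^esub> T q" if "p \<in> carrier ?F" "q \<in> carrier ?F" for p q
    using linear_mapD(4)[OF T that] by (simp add: free_vs_def)
  have T_scale: "T (pm_scale c p) = c \<odot>\<^bsub>W\<^esub> T p" if "p \<in> carrier ?F" for c p
    using linear_mapD(5)[OF T that, of c] by (simp add: free_vs_def pm_scale_def)
  have vanish: "T (a - b) = \<zero>\<^bsub>W\<^esub>" if "a \<in> carrier ?F" "b \<in> carrier ?F" "T a = T b" for a b
  proof -
    have "a - b \<in> carrier ?F"
      using that by (simp only: S) (intro CollectI keys_minus_subset; simp)
    moreover have "T a = T (a - b) \<oplus>\<^bsub>W\<^esub> T b" using T_add[OF calculation that(2)] by simp
    moreover have "T (a - b) \<in> carrier W" "T b \<in> carrier W"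
      using linear_mapD(3)[OF T] that calculation by blast+
    ultimately show ?thesis using that W.M.add.r_cancel_one'[of "T b" "T (a - b)"] by simp
  qed
  have "tensor_relations A n \<subseteq> {p \<in> carrier ?F. T p = \<zero>\<^bsub>W\<^esub>}"
  proof
    fix r assume r: "r \<in> tensor_relations A n"
    then have "T r = \<zero>\<^bsub>W\<^esub>"
    proof (cases rule: tensor_relationsE)
      case (add us vs x y)
      have mem: "?s (us @ z # vs) \<in> carrier ?F" if "z \<in> carrier A" for z
        using that add by (auto simp: S)
      have "T (?s (us @ x # vs) + ?s (us @ y # vs)) = T (?s (us @ (x \<oplus>\<^bsub>A\<^esub> y) # vs))"
        using add mem by (subst T_add) (auto simp: T_single H_add)
      moreover have "?s (us @ x # vs) + ?s (us @ y # vs) \<in> carrier ?F"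
        using add mem by (simp only: S) (intro CollectI keys_plus_subset; simp)
      ultimately show ?thesis unfolding add(3) diff_diff_eq
        using add mem by (intro vanish) auto
    next
      case (smult us vs c x)
      have mem: "?s (us @ z # vs) \<in> carrier ?F" if "z \<in> carrier A" for z
        using that smult by (auto simp: S)
      have "T (pm_scale c (?s (us @ x # vs))) = T (?s (us @ (c \<odot>\<^bsub>A\<^esub> x) # vs))"
        using smult mem by (subst T_scale) (auto simp: T_single H_smult)
      moreover have "pm_scale c (?s (us @ x # vs)) \<in> carrier ?F"
        using smult by (auto simp: S)
      ultimately show ?thesis unfolding smult(3)
        using smult mem by (intro vanish) auto
    qed
    then show "r \<in> {p \<in> carrier ?F. T p = \<zero>\<^bsub>W\<^esub>}" using r tensor_relations_subset by blast
  qed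
  moreover have "VectorSpace.subspace class_ring {p \<in> carrier ?F. T p = \<zero>\<^bsub>W\<^esub>} ?F"
    using T.kerT_is_subspace unfolding T.ker_def .
  ultimately have null: "T p = \<zero>\<^bsub>W\<^esub>" if "p \<in> tensor_null A n" for p
    using span_of_minimal that unfolding tensor_null_def by blast
  note descend = presents_descend[OF presents_tensor_power W, of n T, folded S]
  obtain g where g: "linear_map class_ring (tensor_power A n) W g"
    and g_class: "\<And>p. p \<in> carrier ?F \<Longrightarrow> g (tensor_null A n +>\<^bsub>?F\<^esub> p) = T p"
    using descend[OF linear_mapD(3)[OF T] T_add T_scale null] by blast
  show thesis
  proof (rule that[OF g])
    fix xs assume "xs \<in> tensor_lists n"
    then show "g (pure_tensor A xs) = H xs"
      using g_class[of "?s xs"] by (simp add: pure_tensor_eq T_single S)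
  qed
qed

end

section \<open>Homogeneous tensors\<close>

lemma (in abelian_monoid) finsum_support:
  assumes "finite Y" "{i. c i \<noteq> \<zero>} \<subseteq> Y" "\<And>i. c i \<in> carrier G"
  shows "(\<Oplus>i\<in>{i. c i \<noteq> \<zero>}. c i) = (\<Oplus>i\<in>Y. c i)"
  using assms by (intro add.finprod_mono_neutral_cong_left) auto

type_synonym 'a word = "(nat \<times> 'a) list"

context dga
begin

lemma A_vectorspace: "vectorspace class_ring A" ..

lemma A_abelian_monoid: "abelian_monoid A" ..

lemma gr_closed: "x \<in> gr d \<Longrightarrow> x \<in> carrier A"
  and gr_zero: "\<zero> \<in> gr d"
  and gr_add: "x \<in> gr d \<Longrightarrow> y \<in> gr d \<Longrightarrow> x \<oplus> y \<in> gr d"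
  and gr_smult: "x \<in> gr d \<Longrightarrow> c \<odot>\<^bsub>A\<^esub> x \<in> gr d"
proof -
  interpret S: VectorSpace.subspace class_ring "gr d" A by (rule gr_subspace)
  interpret S: submodule class_ring "gr d" A by (rule S.submod)
  show "x \<in> gr d \<Longrightarrow> x \<in> carrier A" "\<zero> \<in> gr d" "x \<in> gr d \<Longrightarrow> y \<in> gr d \<Longrightarrow> x \<oplus> y \<in> gr d"
    "x \<in> gr d \<Longrightarrow> c \<odot>\<^bsub>A\<^esub> x \<in> gr d"
    using S.subset by auto
qed

definition component :: "'a \<Rightarrow> nat \<Rightarrow> 'a" where
  "component x = (THE c. (\<forall>m. c m \<in> gr m) \<and> finite {m. c m \<noteq> \<zero>} \<and> x = (\<Oplus>m\<in>{m. c m \<noteq> \<zero>}. c m))"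

lemma
  assumes "x \<in> carrier A"
  shows component_gr: "component x m \<in> gr m"
    and component_finite: "finite {m. component x m \<noteq> \<zero>}"
    and component_sum: "(\<Oplus>m\<in>{m. component x m \<noteq> \<zero>}. component x m) = x"
  using theI'[OF gr_direct_sum[OF assms]] unfolding component_def[symmetric] by auto

lemma component_unique:
  assumes "x \<in> carrier A" "\<And>m. c m \<in> gr m" "finite Y" "{m. c m \<noteq> \<zero>} \<subseteq> Y" "(\<Oplus>m\<in>Y. c m) = x"
  shows "component x = c"
  unfolding component_def
proof (rule the1_equality[OF gr_direct_sum[OF assms(1)]])
  have "(\<Oplus>m\<in>{m. c m \<noteq> \<zero>}. c m) = x"
    using abelian_monoid.finsum_support[OF A_abelian_monoid assms(3,4)] gr_closed[OF assms(2)] assms(5)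
    by simp
  then show "(\<forall>m. c m \<in> gr m) \<and> finite {m. c m \<noteq> \<zero>} \<and> x = (\<Oplus>m\<in>{m. c m \<noteq> \<zero>}. c m)"
    using assms(2) finite_subset[OF assms(4,3)] by auto
qed

lemma component_sum':
  assumes "x \<in> carrier A" "finite Y" "{m. component x m \<noteq> \<zero>} \<subseteq> Y"
  shows "(\<Oplus>m\<in>Y. component x m) = x"
  using abelian_monoid.finsum_support[OF A_abelian_monoid, OF assms(2,3)] component_sum[OF assms(1)] gr_closed[OF component_gr[OF assms(1)]]
  by simp

lemma component_add:
  assumes "x \<in> carrier A" "y \<in> carrier A"
  shows "component (x \<oplus> y) d = component x d \<oplus> component y d"
proof -
  let ?Y = "{m. component x m \<noteq> \<zero>} \<union> {m. component y m \<noteq> \<zero>}"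
  have fin: "finite ?Y" using assms component_finite by simp
  have closed: "component x m \<in> carrier A" "component y m \<in> carrier A" for m
    using gr_closed[OF component_gr] assms by auto
  have "component (x \<oplus> y) = (\<lambda>m. component x m \<oplus> component y m)"
  proof (rule component_unique[OF _ _ fin])
    show "x \<oplus> y \<in> carrier A" using assms by simp
    show "component x m \<oplus> component y m \<in> gr m" for m using assms component_gr gr_add by simp
    show "{m. component x m \<oplus> component y m \<noteq> \<zero>} \<subseteq> ?Y" by auto
    show "(\<Oplus>m\<in>?Y. component x m \<oplus> component y m) = x \<oplus> y"
      using component_sum'[OF assms(1) fin] component_sum'[OF assms(2) fin] closed
      by (subst abelian_monoid.finsum_addf[OF A_abelian_monoid]) auto
  qed
  then show ?thesis by simp
qed

lemma component_smult:
  assumes "x \<in> carrier A"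
  shows "component (c \<odot>\<^bsub>A\<^esub> x) d = c \<odot>\<^bsub>A\<^esub> component x d"
proof -
  have closed: "component x m \<in> carrier A" for m
    using gr_closed[OF component_gr] assms by auto
  have "component (c \<odot>\<^bsub>A\<^esub> x) = (\<lambda>m. c \<odot>\<^bsub>A\<^esub> component x m)"
  proof (rule component_unique[OF _ _ component_finite[OF assms]])
    show "c \<odot>\<^bsub>A\<^esub> x \<in> carrier A" using assms by simp
    show "c \<odot>\<^bsub>A\<^esub> component x m \<in> gr m" for m using assms component_gr gr_smult by simp
    show "{m. c \<odot>\<^bsub>A\<^esub> component x m \<noteq> \<zero>} \<subseteq> {m. component x m \<noteq> \<zero>}" using smult_r_null by auto
    show "(\<Oplus>m\<in>{m. component x m \<noteq> \<zero>}. c \<odot>\<^bsub>A\<^esub> component x m) = c \<odot>\<^bsub>A\<^esub> x"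
      using component_sum[OF assms] closed by (subst finsum_smult[symmetric]) auto
  qed
  then show ?thesis by simp
qed

lemma component_homog:
  assumes "x \<in> gr d"
  shows "component x d' = (if d' = d then x else \<zero>)"
proof -
  have "component x = (\<lambda>m. if m = d then x else \<zero>)"
    by (rule component_unique[of x _ "{d}"]) (use assms gr_zero gr_closed in auto)
  then show ?thesis by simp
qed

text \<open>
  A word lists the factors of a pure tensor of homogeneous elements.  It carries the degrees
  because zero is homogeneous of every degree and the Koszul signs depend on the degrees.
\<close>

definition words :: "nat \<Rightarrow> nat \<Rightarrow> 'a word set" where
  "words n m = {w. length w = n \<and> (\<forall>(d, a)\<in>set w. a \<in> gr d) \<and> sum_list (map fst w) = m}"

lemma homog_iff_words:
  "homog gr ds as \<and> length as = n \<and> sum_list ds = m \<longleftrightarrow>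
     (\<exists>w\<in>words n m. ds = map fst w \<and> as = map snd w)"
proof
  assume h: "homog gr ds as \<and> length as = n \<and> sum_list ds = m"
  then have "zip ds as \<in> words n m" "length ds = length as"
    by (auto simp: homog_def list_all2_iff words_def)
  then show "\<exists>w\<in>words n m. ds = map fst w \<and> as = map snd w" by (metis map_fst_zip map_snd_zip)
next
  assume "\<exists>w\<in>words n m. ds = map fst w \<and> as = map snd w"
  then show "homog gr ds as \<and> length as = n \<and> sum_list ds = m"
    by (auto simp: homog_def words_def list_all2_conv_all_nth)
qed

abbreviation word_tensor :: "'a word \<Rightarrow> ('a list \<Rightarrow>\<^sub>0 'k) set" where
  "word_tensor w \<equiv> pure_tensor A (map snd w)"

lemma words_carrier: "w \<in> words n m \<Longrightarrow> set (map snd w) \<subseteq> carrier A"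
  using gr_closed by (auto simp: words_def)

lemma word_generators:
  "{pure_tensor A as | ds as. homog gr ds as \<and> length as = n \<and> sum_list ds = m} = word_tensor ` words n m"
  unfolding homog_iff_words by blast

lemma word_tensor_closed: "w \<in> words n m \<Longrightarrow> word_tensor w \<in> carrier (tensor_power A n)"
  by (rule pure_tensor_closed[OF A_vectorspace words_carrier]) (auto simp: words_def)

lemma word_tensor_words_subset: "word_tensor ` words n m \<subseteq> carrier (tensor_power A n)"
  using word_tensor_closed by blast

lemma tensor_part_eq:
  "tensor_part A gr n m = (tensor_power A n)\<lparr>carrier := span_of (tensor_power A n) (word_tensor ` words n m)\<rparr>"
  by (simp add: tensor_part_def word_generators)

lemma tensor_part_subspace:
  "VectorSpace.subspace class_ring (span_of (tensor_power A n) (word_tensor ` words n m)) (tensor_power A n)"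
  by (rule span_of_subspace[OF vectorspace_tensor_power[OF A_vectorspace] word_tensor_words_subset])

lemma vectorspace_tensor_part: "vectorspace class_ring (tensor_part A gr n m)"
  unfolding tensor_part_eq by (rule vectorspace_restrict[OF tensor_part_subspace])

lemma word_tensor_tensor_part: "w \<in> words n m \<Longrightarrow> word_tensor w \<in> carrier (tensor_part A gr n m)"
  using span_of_subspace(2)[OF vectorspace_tensor_power[OF A_vectorspace] word_tensor_words_subset]
  by (auto simp: tensor_part_eq)

lemma span_of_restrict:
  assumes "VectorSpace.subspace class_ring N V" "R \<subseteq> N"
  shows "span_of (V\<lparr>carrier := N\<rparr>) R = span_of V R"
proof -
  interpret N: VectorSpace.subspace class_ring N V by (rule assms)
  interpret V: vectorspace class_ring V by (rule N.vs)
  show ?thesis unfolding span_of_def using V.span_li_not_depend(1)[OF assms(2) N.submod] by simp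
qed

lemma linear_maps_eq_on_tensor_part:
  assumes "linear_map class_ring (tensor_part A gr n m) W f" "linear_map class_ring (tensor_part A gr n m) W g"
    and "\<And>w. w \<in> words n m \<Longrightarrow> f (word_tensor w) = g (word_tensor w)" and v: "v \<in> carrier (tensor_part A gr n m)"
  shows "f v = g v"
proof (rule linear_map_eq_on_span[OF assms(1,2), of "word_tensor ` words n m"])
  show "word_tensor ` words n m \<subseteq> carrier (tensor_part A gr n m)" using word_tensor_tensor_part by blast
  then have sub: "word_tensor ` words n m \<subseteq> span_of (tensor_power A n) (word_tensor ` words n m)"
    by (simp add: tensor_part_eq)
  show "v \<in> span_of (tensor_part A gr n m) (word_tensor ` words n m)"
    using v span_of_restrict[OF tensor_part_subspace sub] by (simp add: tensor_part_eq)
qed (use assms in auto)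

definition multilinear :: "nat \<Rightarrow> nat \<Rightarrow> ('k, 'w) module \<Rightarrow> ('a word \<Rightarrow> 'w) \<Rightarrow> bool" where
  "multilinear n m W g \<longleftrightarrow> (\<forall>w\<in>words n m. g w \<in> carrier W) \<and>
     (\<forall>u d x y v. u @ (d, x) # v \<in> words n m \<and> y \<in> gr d \<longrightarrow>
        g (u @ (d, x \<oplus> y) # v) = g (u @ (d, x) # v) \<oplus>\<^bsub>W\<^esub> g (u @ (d, y) # v)) \<and>
     (\<forall>u d x c v. u @ (d, x) # v \<in> words n m \<longrightarrow>
        g (u @ (d, c \<odot>\<^bsub>A\<^esub> x) # v) = c \<odot>\<^bsub>W\<^esub> g (u @ (d, x) # v))"

lemma smult_0: "x \<in> carrier A \<Longrightarrow> 0 \<odot>\<^bsub>A\<^esub> x = \<zero>"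
  by (rule class_smult_0[OF A_vectorspace])

lemma words_change: "u @ (d, x) # v \<in> words n m \<Longrightarrow> y \<in> gr d \<Longrightarrow> u @ (d, y) # v \<in> words n m"
  by (auto simp: words_def)

lemma multilinear_zero:
  assumes "vectorspace class_ring W" "multilinear n m W g" "u @ (d, \<zero>) # v \<in> words n m"
  shows "g (u @ (d, \<zero>) # v) = \<zero>\<^bsub>W\<^esub>"
proof -
  have "g (u @ (d, \<zero>) # v) \<in> carrier W" using assms by (auto simp: multilinear_def)
  moreover have "g (u @ (d, 0 \<odot>\<^bsub>A\<^esub> \<zero>) # v) = 0 \<odot>\<^bsub>W\<^esub> g (u @ (d, \<zero>) # v)"
    using assms unfolding multilinear_def by blast
  ultimately show ?thesis by (simp add: smult_0 class_smult_0[OF assms(1)])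
qed

lemma finite_degree_lists: "finite {ds :: nat list. length ds = n \<and> sum_list ds = m}"
proof (rule finite_subset)
  show "{ds. length ds = n \<and> sum_list ds = m} \<subseteq> {ds. set ds \<subseteq> {..m} \<and> length ds = n}"
    using member_le_sum_list by fastforce
  show "finite {ds. set ds \<subseteq> {..m} \<and> length ds = n}" by (rule finite_lists_length_eq) simp
qed

text \<open>
  The homogeneous component of multidegree \<open>ds\<close> of the pure tensor with factors \<open>xs\<close>.
\<close>

definition homog_part :: "nat list \<Rightarrow> 'a list \<Rightarrow> 'a word" where
  "homog_part ds xs = map2 (\<lambda>d x. (d, component x d)) ds xs"

lemma homog_part_words:
  "length ds = n \<Longrightarrow> sum_list ds = m \<Longrightarrow> set xs \<subseteq> carrier A \<Longrightarrow> length xs = n \<Longrightarrow>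
     homog_part ds xs \<in> words n m"
  by (auto simp: homog_part_def words_def case_prod_unfold comp_def set_zip subset_iff
      intro!: component_gr)

lemma homog_part_of_word:
  "\<forall>(d, a)\<in>set w. a \<in> gr d \<Longrightarrow> homog_part (map fst w) (map snd w) = w"
  by (induction w) (auto simp: homog_part_def component_homog)

lemma homog_part_split:
  assumes "length ds = length us + 1 + length ws"
  obtains d1 d d2 where "ds = d1 @ d # d2"
    "\<And>z. homog_part ds (us @ z # ws) = homog_part d1 us @ (d, component z d) # homog_part d2 ws"
proof -
  have "ds = take (length us) ds @ ds ! length us # drop (Suc (length us)) ds"
    using assms by (intro id_take_nth_drop) simp
  moreover have "homog_part ds (us @ z # ws) = homog_part (take (length us) ds) us @
      (ds ! length us, component z (ds ! length us)) # homog_part (drop (Suc (length us)) ds) ws" for z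
    using assms by (subst calculation) (simp add: homog_part_def)
  ultimately show thesis by (rule that)
qed

text \<open>
  A multilinear function on homogeneous entries extends to all entries as the sum, over the
  multidegrees of total degree \<open>m\<close>, of its values on the homogeneous components.  This sum
  is multilinear, so it factors through the tensor power.  On a homogeneous word only the
  multidegree of that word contributes: any other one puts a zero into some slot.
\<close>

lemma multilinear_extend:
  assumes W: "vectorspace class_ring W" and g: "multilinear n m W g"
  shows "\<exists>T. linear_map class_ring (tensor_power A n) W T \<and> (\<forall>w\<in>words n m. T (word_tensor w) = g w)"
proof -
  interpret W: vectorspace class_ring W by (rule W)
  let ?D = "{ds :: nat list. length ds = n \<and> sum_list ds = m}"
  define H where "H xs = (\<Oplus>\<^bsub>W\<^esub>ds\<in>?D. g (homog_part ds xs))" for xs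
  have gc: "g w \<in> carrier W" if "w \<in> words n m" for w using g that by (simp add: multilinear_def)
  have closed: "g (homog_part ds xs) \<in> carrier W"
    if "ds \<in> ?D" "set xs \<subseteq> carrier A" "length xs = n" for ds xs
    using that by (auto intro!: gc homog_part_words)
  obtain T where T: "linear_map class_ring (tensor_power A n) W T"
    and T_pure: "\<And>xs. xs \<in> {xs. set xs \<subseteq> carrier A \<and> length xs = n} \<Longrightarrow> T (pure_tensor A xs) = H xs"
  proof (rule tensor_power_universal[OF A_vectorspace W, of n H])
    show "H xs \<in> carrier W" if "xs \<in> {xs. set xs \<subseteq> carrier A \<and> length xs = n}" for xs
      unfolding H_def using that closed by (intro W.M.finsum_closed) auto
  next
    fix us ws x y
    assume *: "set us \<union> set ws \<union> {x, y} \<subseteq> carrier A" "length us + 1 + length ws = n"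
    have "H (us @ (x \<oplus> y) # ws)
        = (\<Oplus>\<^bsub>W\<^esub>ds\<in>?D. g (homog_part ds (us @ x # ws)) \<oplus>\<^bsub>W\<^esub> g (homog_part ds (us @ y # ws)))"
      unfolding H_def
    proof (rule W.M.finsum_cong')
      fix ds assume ds: "ds \<in> ?D"
      obtain d1 d d2 where d: "ds = d1 @ d # d2"
        "\<And>z. homog_part ds (us @ z # ws) = homog_part d1 us @ (d, component z d) # homog_part d2 ws"
        using homog_part_split[of ds us ws] ds *(2) by auto
      have "homog_part ds (us @ x # ws) \<in> words n m" using ds * by (intro homog_part_words) auto
      then show "g (homog_part ds (us @ (x \<oplus> y) # ws)) =
          g (homog_part ds (us @ x # ws)) \<oplus>\<^bsub>W\<^esub> g (homog_part ds (us @ y # ws))"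
        using g * component_gr unfolding d(2) multilinear_def by (simp add: component_add)
    qed (use closed * in auto)
    also have "\<dots> = H (us @ x # ws) \<oplus>\<^bsub>W\<^esub> H (us @ y # ws)"
      unfolding H_def using closed * by (intro W.M.finsum_addf) auto
    finally show "H (us @ (x \<oplus> y) # ws) = H (us @ x # ws) \<oplus>\<^bsub>W\<^esub> H (us @ y # ws)" .
  next
    fix us ws c x
    assume *: "set us \<union> set ws \<union> {x} \<subseteq> carrier A" "length us + 1 + length ws = n"
    have "H (us @ (c \<odot>\<^bsub>A\<^esub> x) # ws) = (\<Oplus>\<^bsub>W\<^esub>ds\<in>?D. c \<odot>\<^bsub>W\<^esub> g (homog_part ds (us @ x # ws)))"
      unfolding H_def
    proof (rule W.M.finsum_cong')
      fix ds assume ds: "ds \<in> ?D"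
      obtain d1 d d2 where d: "ds = d1 @ d # d2"
        "\<And>z. homog_part ds (us @ z # ws) = homog_part d1 us @ (d, component z d) # homog_part d2 ws"
        using homog_part_split[of ds us ws] ds *(2) by auto
      have "homog_part ds (us @ x # ws) \<in> words n m" using ds * by (intro homog_part_words) auto
      then show "g (homog_part ds (us @ (c \<odot>\<^bsub>A\<^esub> x) # ws)) = c \<odot>\<^bsub>W\<^esub> g (homog_part ds (us @ x # ws))"
        using g * unfolding d(2) multilinear_def by (simp add: component_smult)
    qed (use closed * in auto)
    also have "\<dots> = c \<odot>\<^bsub>W\<^esub> H (us @ x # ws)"
      unfolding H_def using closed * by (subst W.finsum_smult) auto
    finally show "H (us @ (c \<odot>\<^bsub>A\<^esub> x) # ws) = c \<odot>\<^bsub>W\<^esub> H (us @ x # ws)" .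
  qed blast
  have "T (word_tensor w) = g w" if w: "w \<in> words n m" for w
  proof -
    have xs: "set (map snd w) \<subseteq> carrier A" "length (map snd w) = n"
      using words_carrier[OF w] w by (auto simp: words_def)
    \<comment> \<open>Some degree in \<open>ds\<close> differs from the degree of the letter, whose component is then zero.\<close>
    have "g (homog_part ds (map snd w)) = \<zero>\<^bsub>W\<^esub>" if ds: "ds \<in> ?D" "ds \<noteq> map fst w" for ds
    proof -
      have "length ds = n" "length w = n" using ds w by (auto simp: words_def)
      then obtain i where i: "i < n" "ds ! i \<noteq> fst (w ! i)"
        using ds(2) by (auto simp: list_eq_iff_nth_eq)
      define z where "z = homog_part ds (map snd w)"
      have z: "z \<in> words n m" unfolding z_def using ds xs by (intro homog_part_words) auto
      have "snd (w ! i) \<in> gr (fst (w ! i))"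
        using w i \<open>length w = n\<close> nth_mem[of i w] by (auto simp: words_def split_beta)
      then have "z ! i = (ds ! i, \<zero>)"
        using i \<open>length ds = n\<close> \<open>length w = n\<close> by (simp add: z_def homog_part_def component_homog)
      moreover have "z = take i z @ z ! i # drop (Suc i) z"
        using i z by (intro id_take_nth_drop) (simp add: words_def)
      ultimately show ?thesis
        using multilinear_zero[OF W g, of "take i z" "ds ! i" "drop (Suc i) z"] z unfolding z_def by metis
    qed
    moreover have "map fst w \<in> ?D" using w by (auto simp: words_def)
    ultimately have "H (map snd w) = (\<Oplus>\<^bsub>W\<^esub>ds\<in>{map fst w}. g (homog_part ds (map snd w)))"
      unfolding H_def using closed xs
      by (intro W.M.add.finprod_mono_neutral_cong_right finite_degree_lists) auto
    also have "\<dots> = g w"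
      using w gc[OF w] homog_part_of_word[of w] by (simp add: words_def)
    finally show ?thesis using T_pure[of "map snd w"] xs by simp
  qed
  with T show ?thesis by blast
qed

text \<open>
  The definite description in \<open>tensor_lift\<close> denotes the intended map: existence is
  \<open>multilinear_extend\<close>, and uniqueness holds because the tensors of words span.
\<close>

lemma tensor_lift:
  assumes W: "vectorspace class_ring W" and g: "multilinear n m W g"
    and h: "\<And>w. w \<in> words n m \<Longrightarrow> h (map fst w) (map snd w) = g w"
  shows "tensor_lift A gr n m W h \<in> lin_maps (tensor_part A gr n m) W"
    and "w \<in> words n m \<Longrightarrow> tensor_lift A gr n m W h (word_tensor w) = g w"
proof -
  let ?P = "tensor_part A gr n m"
  note lin = lin_maps_iff[OF vectorspace_tensor_part W]
  obtain T where T: "linear_map class_ring (tensor_power A n) W T"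
    "\<forall>w\<in>words n m. T (word_tensor w) = g w"
    using multilinear_extend[OF W g] by blast
  define T' where "T' v = (if v \<in> carrier ?P then T v else \<zero>\<^bsub>W\<^esub>)" for v
  have TP: "linear_map class_ring ?P W T"
    unfolding tensor_part_eq by (rule linear_map_restrict[OF tensor_part_subspace T(1)])
  interpret P: vectorspace class_ring ?P by (rule vectorspace_tensor_part)
  have T': "T' \<in> lin_maps ?P W"
    unfolding lin
  proof (intro conjI linear_map_classI vectorspace_tensor_part W)
    show "\<forall>v. v \<notin> carrier ?P \<longrightarrow> T' v = \<zero>\<^bsub>W\<^esub>" by (simp add: T'_def)
  qed (auto simp: T'_def linear_mapD[OF TP])
  have val: "T' (word_tensor w) = g w" if "w \<in> words n m" for w
    using that T(2) word_tensor_tensor_part by (simp add: T'_def)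
  have cond: "(\<forall>ds as. homog gr ds as \<and> length as = n \<and> sum_list ds = m \<longrightarrow> S (pure_tensor A as) = h ds as)
      \<longleftrightarrow> (\<forall>w\<in>words n m. S (word_tensor w) = g w)"
    (is "?L \<longleftrightarrow> ?R") for S
  proof
    assume L: ?L
    show ?R
    proof
      fix w assume w: "w \<in> words n m"
      then have "homog gr (map fst w) (map snd w) \<and> length (map snd w) = n \<and> sum_list (map fst w) = m"
        unfolding homog_iff_words by blast
      with L have "S (word_tensor w) = h (map fst w) (map snd w)" by blast
      with h[OF w] show "S (word_tensor w) = g w" by simp
    qed
  qed (auto simp: homog_iff_words h)
  have "tensor_lift A gr n m W h = T'"
    unfolding tensor_lift_def cond
  proof (rule the_equality)
    show "T' \<in> lin_maps ?P W \<and> (\<forall>w\<in>words n m. T' (word_tensor w) = g w)" using T' val by blast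
  next
    fix S assume S: "S \<in> lin_maps ?P W \<and> (\<forall>w\<in>words n m. S (word_tensor w) = g w)"
    show "S = T'"
    proof
      fix v
      show "S v = T' v"
      proof (cases "v \<in> carrier ?P")
        case True
        have "linear_map class_ring ?P W S" "linear_map class_ring ?P W T'"
          using S T' unfolding lin by blast+
        then show ?thesis
        proof (rule linear_maps_eq_on_tensor_part[OF _ _ _ True])
          show "S (word_tensor w) = T' (word_tensor w)" if "w \<in> words n m" for w using S val that by simp
        qed
      next
        case False
        then show ?thesis using S T' unfolding lin by simp
      qed
    qed
  qed
  with T' val show "tensor_lift A gr n m W h \<in> lin_maps ?P W"
    and "w \<in> words n m \<Longrightarrow> tensor_lift A gr n m W h (word_tensor w) = g w" by auto
qed

end

section \<open>Cyclic operators on functions of words\<close>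

context dga
begin

lemma A_ring: "ring A" ..

lemmas A_mult_assoc = monoid.m_assoc[OF ring.axioms(2)[OF A_ring]]
  and A_r_one = monoid.r_one[OF ring.axioms(2)[OF A_ring]]

abbreviation letter_mult :: "nat \<times> 'a \<Rightarrow> nat \<times> 'a \<Rightarrow> nat \<times> 'a" where
  "letter_mult x y \<equiv> (fst x + fst y, snd x \<otimes> snd y)"

abbreviation deg :: "'a word \<Rightarrow> nat" where
  "deg w \<equiv> sum_list (map fst w)"

abbreviation letters :: "'a word \<Rightarrow> bool" where
  "letters w \<equiv> (\<forall>(d, a)\<in>set w. a \<in> gr d)"

text \<open>
  The product of letters \<open>i\<close> and \<open>i + 1\<close>, in a recursive form that suits induction; \<open>face_eq\<close> is the closed form.
\<close>

fun face :: "nat \<Rightarrow> 'a word \<Rightarrow> 'a word" where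
  "face 0 (x # y # w) = letter_mult x y # w"
| "face (Suc i) (x # w) = x # face i w"
| "face _ w = w"

lemma face_append: "face (length u + i) (u @ w) = u @ face i w"
  by (induction u) auto

lemma face_append_left: "Suc i < length u \<Longrightarrow> face i (u @ w) = face i u @ w"
proof (induction i u rule: face.induct)
qed auto

lemma face_split: "face (length u) (u @ x # y # v) = u @ letter_mult x y # v"
  using face_append[of u 0 "x # y # v"] by simp

lemma word_split_pair:
  assumes "Suc i < length w" obtains u x y v where "w = u @ x # y # v" "length u = i"
proof -
  have "w = take i w @ w ! i # w ! Suc i # drop (Suc (Suc i)) w"
    using assms by (metis Cons_nth_drop_Suc Suc_lessD append_take_drop_id)
  with assms show thesis by (intro that) auto
qed

lemma face_eq:
  assumes "Suc i < length w"
  shows "face i w = take i w @ letter_mult (w ! i) (w ! Suc i) # drop (Suc (Suc i)) w"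
proof -
  obtain u x y v where "w = u @ x # y # v" "length u = i" using word_split_pair[OF assms] .
  then show ?thesis using face_split[of u x y v] by (auto simp: nth_append)
qed

lemma face_words:
  assumes "w \<in> words (Suc k) m" "i < k" shows "face i w \<in> words k m"
proof -
  have "Suc i < length w" using assms by (simp add: words_def)
  then obtain u x y v where w: "w = u @ x # y # v" "length u = i" by (rule word_split_pair)
  then show ?thesis using assms face_split[of u x y v] gr_mult by (auto simp: words_def split_beta)
qed

lemma face_face:
  assumes "letters w" "i < j" "Suc j < length w"
  shows "face i (face j w) = face (j - 1) (face i w)"
  using assms
proof (induction i arbitrary: j w)
  case 0
  then obtain x y w' where w: "w = x # y # w'" by (cases w; cases "tl w") auto
  show ?case
  proof (cases "j = 1")
    case True
    then obtain z v where "w' = z # v" using 0 w by (cases w') auto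
    then show ?thesis using 0 w True gr_closed by (auto simp: A_mult_assoc add.assoc split_beta)
  next
    case False
    then have "j = Suc (Suc (j - 2))" using 0 by simp
    then obtain j' where "j = Suc (Suc j')" ..
    then show ?thesis using w by simp
  qed
next
  case (Suc i)
  then obtain x w' j' where w: "w = x # w'" "j = Suc j'" by (cases w; cases j) auto
  then show ?case using Suc.IH[of w' j'] Suc.prems by (cases j') auto
qed

text \<open>
  This and the following operators are cut off outside the words of the right length and degree, so that
  identities between them are equations between functions.  The index \<open>n\<close> is
  that of \<open>C\<^sup>n\<close>, whose words have \<open>n + 1\<close> letters.
\<close>

definition plain_coface :: "nat \<Rightarrow> nat \<Rightarrow> nat \<Rightarrow> ('a word \<Rightarrow> 'k) \<Rightarrow> 'a word \<Rightarrow> 'k" where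
  "plain_coface n m i G = (\<lambda>w. if w \<in> words (Suc (Suc n)) m then (- 1) ^ i * G (face i w) else 0)"

text \<open>
  The operator \<open>\<tau>\<close>.
\<close>

definition rot :: "nat \<Rightarrow> nat \<Rightarrow> ('a word \<Rightarrow> 'k) \<Rightarrow> 'a word \<Rightarrow> 'k" where
  "rot n m G = (\<lambda>w. if w \<in> words (Suc n) m
     then (- 1) ^ (n + koszul (map fst w)) * G (last w # butlast w) else 0)"

text \<open>
  The summands of \<open>b\<close>.  The last one, whose product wraps around the end of the word, is obtained from
  the first one by \<open>\<tau>\<close>.  The signs are included because then the cofaces commute with \<open>\<tau>\<close>, up to a
  shift of the index, without a further sign (\<open>rot_coface_0\<close>, \<open>rot_coface_Suc\<close>).
\<close>

definition coface :: "nat \<Rightarrow> nat \<Rightarrow> nat \<Rightarrow> ('a word \<Rightarrow> 'k) \<Rightarrow> 'a word \<Rightarrow> 'k" where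
  "coface n m i G = (if i \<le> n then plain_coface n m i G else rot (Suc n) m (plain_coface n m 0 G))"

definition bword :: "nat \<Rightarrow> nat \<Rightarrow> ('a word \<Rightarrow> 'k) \<Rightarrow> 'a word \<Rightarrow> 'k" where
  "bword n m G = (\<Sum>i\<le>Suc n. coface n m i G)"

definition bword' :: "nat \<Rightarrow> nat \<Rightarrow> ('a word \<Rightarrow> 'k) \<Rightarrow> 'a word \<Rightarrow> 'k" where
  "bword' n m G = (\<Sum>i\<le>n. coface n m i G)"

definition norm_word :: "nat \<Rightarrow> nat \<Rightarrow> ('a word \<Rightarrow> 'k) \<Rightarrow> 'a word \<Rightarrow> 'k" where
  "norm_word n m G = (\<Sum>i\<le>n. (rot n m ^^ i) G)"

definition sword :: "nat \<Rightarrow> nat \<Rightarrow> ('a word \<Rightarrow> 'k) \<Rightarrow> 'a word \<Rightarrow> 'k" where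
  "sword n m G = (\<lambda>w. if w \<in> words (Suc n) m then (- 1) ^ n * G (w @ [(0, \<one>)]) else 0)"

definition Bword :: "nat \<Rightarrow> nat \<Rightarrow> ('a word \<Rightarrow> 'k) \<Rightarrow> 'a word \<Rightarrow> 'k" where
  "Bword n m G = norm_word n m (sword n m (G - rot (Suc n) m G))"

definition supported :: "nat \<Rightarrow> nat \<Rightarrow> ('a word \<Rightarrow> 'k) set" where
  "supported n m = {G. \<forall>w. w \<notin> words (Suc n) m \<longrightarrow> G w = 0}"

lemma koszul_snoc [simp]: "koszul (ds @ [d]) = d * sum_list ds"
  by (simp add: koszul_def)

lemma sum_fun_apply: "(\<Sum>i\<in>I. f i) x = (\<Sum>i\<in>I. f i x)" for f :: "'i \<Rightarrow> 'x \<Rightarrow> 'y::comm_monoid_add"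
  by (induction I rule: infinite_finite_induct) auto

lemma additive_plain_coface: "additive (plain_coface n m i)"
  by standard (auto simp: plain_coface_def fun_eq_iff algebra_simps)

lemma additive_rot: "additive (rot n m)"
  by standard (auto simp: rot_def fun_eq_iff algebra_simps)

lemma additive_comp: "additive f \<Longrightarrow> additive g \<Longrightarrow> additive (\<lambda>x. f (g x))"
  by (simp add: additive_def)

lemma additive_sum: "(\<And>i. i \<in> I \<Longrightarrow> additive (f i)) \<Longrightarrow> additive (\<lambda>x. \<Sum>i\<in>I. f i x)"
  by (simp add: additive_def sum.distrib)

lemma additive_coface: "additive (coface n m i)"
  using additive_plain_coface additive_comp[OF additive_rot additive_plain_coface]
  by (cases "i \<le> n") (simp_all add: coface_def[abs_def])

lemma additive_funpow: "additive f \<Longrightarrow> additive (f ^^ k)" for f :: "'g::ab_group_add \<Rightarrow> 'g"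
  by (induction k) (simp_all add: additive_def)

lemma additive_bword: "additive (bword n m)"
  and additive_bword': "additive (bword' n m)"
  and additive_norm_word: "additive (norm_word n m)"
  unfolding bword_def[abs_def] bword'_def[abs_def] norm_word_def[abs_def]
  by (intro additive_sum additive_coface additive_funpow additive_rot)+

lemma additive_sword: "additive (sword n m)"
  by standard (auto simp: sword_def fun_eq_iff algebra_simps)

lemma supported_coface: "coface n m i G \<in> supported (Suc n) m"
  by (auto simp: supported_def coface_def plain_coface_def rot_def)

lemma supported_rot: "rot n m G \<in> supported n m"
  by (auto simp: supported_def rot_def)

lemma supported_sword: "sword n m G \<in> supported n m"
  by (auto simp: supported_def sword_def)

lemma supported_add: "G \<in> supported n m \<Longrightarrow> H \<in> supported n m \<Longrightarrow> G + H \<in> supported n m"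
  and supported_diff: "G \<in> supported n m \<Longrightarrow> H \<in> supported n m \<Longrightarrow> G - H \<in> supported n m"
  and supported_0: "0 \<in> supported n m"
  by (auto simp: supported_def)

lemma word_snoc: "w \<in> words (Suc n) m \<Longrightarrow> \<exists>u x. w = u @ [x]"
  by (cases w rule: rev_cases) (auto simp: words_def)

lemma rot_snoc:
  "u @ [x] \<in> words (Suc n) m \<Longrightarrow> rot n m G (u @ [x]) = (- 1) ^ (n + fst x * deg u) * G (x # u)"
  by (simp add: rot_def)

lemma words_rotate: "u @ v \<in> words n m \<longleftrightarrow> v @ u \<in> words n m"
  by (auto simp: words_def)

text \<open>
  The letters of \<open>v\<close> are moved to the front one at a time.  The Koszul signs between two letters of
  \<open>v\<close> occur twice and cancel, which leaves the sign for moving the block \<open>v\<close> past the block \<open>u\<close>.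
\<close>

lemma rot_funpow:
  assumes "u @ v \<in> words (Suc n) m"
  shows "(rot n m ^^ length v) G (u @ v) = (- 1) ^ (n * length v + deg v * deg u) * G (v @ u)"
  using assms
proof (induction v arbitrary: u G)
  case (Cons x v)
  have w: "v @ u @ [x] \<in> words (Suc n) m"
    using Cons.prems words_rotate[of "u @ [x]" v] by simp
  have "(rot n m ^^ length (x # v)) G (u @ x # v) = (rot n m ^^ length v) (rot n m G) ((u @ [x]) @ v)"
    by (simp add: funpow_swap1)
  also have "\<dots> = (- 1) ^ (n * length v + deg v * deg (u @ [x])) * rot n m G ((v @ u) @ [x])"
    using Cons.IH[of "u @ [x]" "rot n m G"] Cons.prems by simp
  also have "\<dots> = (- 1) ^ (n * length v + deg v * deg (u @ [x])) *
      ((- 1) ^ (n + fst x * deg (v @ u)) * G (x # v @ u))"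
    using w by (subst rot_snoc) simp_all
  also have "\<dots> = (- 1) ^ (n * length (x # v) + deg (x # v) * deg u + 2 * (deg v * fst x)) * G ((x # v) @ u)"
    unfolding mult.assoc[symmetric] power_add[symmetric] by (simp add: algebra_simps mult_2 mult_2_right)
  finally show ?case by (simp add: power_add)
qed simp

text \<open>
  The case of \<open>rot_funpow\<close> in which the whole word is moved: the block in front is
  empty, and the remaining sign has the even exponent \<open>n (n + 1)\<close>.
\<close>

lemma rot_order:
  assumes "G \<in> supported n m" shows "(rot n m ^^ Suc n) G = G"
proof
  fix w
  show "(rot n m ^^ Suc n) G w = G w"
  proof (cases "w \<in> words (Suc n) m")
    case True
    then have "length w = Suc n" by (simp add: words_def)
    then show ?thesis using rot_funpow[of "[]" w n m G] True by simp
  next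
    case False
    then show ?thesis using assms by (simp add: rot_def supported_def)
  qed
qed

lemma rot_inject:
  assumes "G \<in> supported n m" "H \<in> supported n m" "rot n m G = rot n m H"
  shows "G = H"
proof -
  have "(rot n m ^^ Suc n) G = (rot n m ^^ Suc n) H"
    using assms(3) by (simp add: funpow_Suc_right del: funpow.simps)
  then show ?thesis using rot_order assms by simp
qed

lemma rot_coface_0: "rot (Suc n) m (coface n m 0 G) = coface n m (Suc n) G"
  by (simp add: coface_def)

text \<open>
  Rotation moves the last letter to the front, so multiplying letters \<open>i + 1\<close> and \<open>i + 2\<close> of the rotated
  word means multiplying letters \<open>i\<close> and \<open>i + 1\<close> of the word.  The parity of \<open>n\<close> and of the index change
  together.  For \<open>i = n\<close> the coface on the left is the wrapped one: rotating twice and then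
  multiplying agrees with multiplying the last two letters and then rotating.
\<close>

lemma rot_coface_Suc:
  assumes "i \<le> n"
  shows "rot (Suc n) m (coface n m (Suc i) G) = coface n m i (rot n m G)"
proof
  fix w
  show "rot (Suc n) m (coface n m (Suc i) G) w = coface n m i (rot n m G) w"
  proof (cases "w \<in> words (Suc (Suc n)) m")
    case False
    then show ?thesis using assms by (simp add: rot_def coface_def plain_coface_def)
  next
    case w: True
    obtain v z where wv: "w = v @ [z]" using word_snoc[OF w] by blast
    have len: "length v = Suc n" using w wv by (simp add: words_def)
    have zv: "z # v \<in> words (Suc (Suc n)) m" using w wv words_rotate[of v "[z]"] by simp
    show ?thesis
    proof (cases "i = n")
      case False
      with assms have i: "Suc i \<le> n" by simp
      then have f: "face i w = face i v @ [z]" unfolding wv using len by (intro face_append_left) simp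
      have fw: "face i v @ [z] \<in> words (Suc n) m" using face_words[OF w, of i] i f by simp
      have "deg (face i v) + fst z = deg v + fst z"
        using fw w wv by (simp add: words_def)
      then have deg: "deg (face i v) = deg v" by simp
      have "rot (Suc n) m (coface n m (Suc i) G) w
          = (- 1) ^ (Suc n + fst z * deg v) * ((- 1) ^ Suc i * G (z # face i v))"
        using w wv zv i by (simp add: rot_snoc coface_def plain_coface_def)
      also have "\<dots> = (- 1) ^ i * ((- 1) ^ (n + fst z * deg v) * G (z # face i v))"
        by (simp add: power_add)
      also have "\<dots> = coface n m i (rot n m G) w"
        using w fw i by (simp add: coface_def plain_coface_def f rot_snoc deg)
      finally show ?thesis .
    next
      case True
      obtain u y where v: "v = u @ [y]" using len by (cases v rule: rev_cases) auto
      have lu: "length u = n" using len v by simp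
      have yzu: "y # z # u \<in> words (Suc (Suc n)) m"
        using w wv v words_rotate[of u "[y, z]"] by simp
      have f: "face n w = u @ [letter_mult y z]" using face_split[of u y z "[]"] lu wv v by simp
      have fw: "u @ [letter_mult y z] \<in> words (Suc n) m" using face_words[OF w, of n] f by simp
      have "rot (Suc n) m (coface n m (Suc i) G) w
          = (- 1) ^ (Suc n + fst z * deg (u @ [y])) * ((- 1) ^ (Suc n + fst y * deg (z # u)) * G (letter_mult y z # u))"
        using w wv v zv yzu rot_snoc[of "z # u" y "Suc n" m] rot_snoc[of "u @ [y]" z "Suc n" m] True
        by (simp add: coface_def plain_coface_def)
      also have "\<dots> = (- 1) ^ (2 * (fst z * fst y) + 2 * Suc n + (fst y + fst z) * deg u) * G (letter_mult y z # u)"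
        unfolding mult.assoc[symmetric] power_add[symmetric] by (simp add: algebra_simps mult_2 mult_2_right)
      also have "\<dots> = (- 1) ^ n * ((- 1) ^ (n + (fst y + fst z) * deg u) * G (letter_mult y z # u))"
        unfolding mult.assoc[symmetric] power_add[symmetric]
        by (simp add: power_add power_mult flip: mult_2)
      also have "\<dots> = coface n m i (rot n m G) w"
        using w fw True by (simp add: coface_def plain_coface_def f rot_snoc)
      finally show ?thesis .
    qed
  qed
qed

lemma coface_coface_plain:
  assumes "i < j" "j \<le> Suc n"
  shows "coface (Suc n) m j (coface n m i G) = - coface (Suc n) m i (coface n m (j - 1) G)"
proof
  fix w
  show "coface (Suc n) m j (coface n m i G) w = (- coface (Suc n) m i (coface n m (j - 1) G)) w"
  proof (cases "w \<in> words (Suc (Suc (Suc n))) m")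
    case True
    have "face j w \<in> words (Suc (Suc n)) m" "face i w \<in> words (Suc (Suc n)) m"
      using face_words[OF True] assms by auto
    moreover have "face i (face j w) = face (j - 1) (face i w)"
      using True assms by (intro face_face) (auto simp: words_def)
    moreover have "(- 1) ^ j = - ((- 1) ^ (j - 1) :: 'k)" using assms by (cases j) auto
    moreover have "j - Suc 0 \<le> n" "i \<le> n" using assms by auto
    ultimately show ?thesis using True assms by (simp add: coface_def plain_coface_def)
  qed (use assms in \<open>simp add: coface_def plain_coface_def\<close>)
qed

text \<open>
  For products that do not wrap this is associativity.  The wrapped coface is \<open>\<tau>\<close> after the first
  one, and \<open>\<tau>\<close> shifts indices, which reduces the other cases to this one.
\<close>

lemma coface_coface:
  assumes "i < j" "j \<le> Suc (Suc n)"
  shows "coface (Suc n) m j (coface n m i G) = - coface (Suc n) m i (coface n m (j - 1) G)"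
proof (cases "j \<le> Suc n")
  case True
  with assms show ?thesis by (intro coface_coface_plain)
next
  case False
  with assms have j: "j = Suc (Suc n)" by simp
  interpret rot: additive "rot (Suc (Suc n)) m" by (rule additive_rot)
  \<comment> \<open>The case \<open>i = 0\<close> comes first: the case \<open>i = n + 1\<close> depends on it.\<close>
  have zero: "coface (Suc n) m (Suc (Suc n)) (coface n m 0 G) = - coface (Suc n) m 0 (coface n m (Suc n) G)"
  proof -
    have "coface (Suc n) m 0 (coface n m (Suc n) G) = rot (Suc (Suc n)) m (coface (Suc n) m 1 (coface n m 0 G))"
      using rot_coface_Suc[of 0 "Suc n" m] by (simp add: rot_coface_0[symmetric])
    also have "\<dots> = - coface (Suc n) m (Suc (Suc n)) (coface n m 0 G)"
      using coface_coface_plain[of 0 1 n m G] by (simp add: rot.minus rot_coface_0)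
    finally show ?thesis by simp
  qed
  show ?thesis
  proof (cases "i = 0")
    case True
    then show ?thesis using zero j by simp
  next
    case i: False
    have "coface (Suc n) m (Suc i) (coface n m 0 G) = - coface (Suc n) m 0 (coface n m i G)"
      using zero coface_coface_plain[of 0 "Suc i" n m G] assms j i
      by (cases "i = Suc n") auto
    then have "rot (Suc (Suc n)) m (coface (Suc n) m 0 (coface n m i G)) =
        - rot (Suc (Suc n)) m (coface (Suc n) m (Suc i) (coface n m 0 G))"
      by (simp add: rot.minus)
    then show ?thesis
      using rot_coface_Suc[of i "Suc n" m] assms j by (simp add: rot_coface_0)
  qed
qed

lemma bword_bword: "bword (Suc n) m (bword n m G) = 0"
proof -
  define X where "X j i = coface (Suc n) m j (coface n m i G)" for j i
  have "bword (Suc n) m (bword n m G) = (\<Sum>j\<le>Suc (Suc n). \<Sum>i\<le>Suc n. X j i)"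
    unfolding bword_def X_def by (simp only: additive.sum[OF additive_coface])
  also have "\<dots> = (\<Sum>(j, i)\<in>{..Suc (Suc n)} \<times> {..Suc n}. X j i)"
    by (rule sum.cartesian_product)
  also have "{..Suc (Suc n)} \<times> {..Suc n} =
      {(j, i). i < j \<and> j \<le> Suc (Suc n)} \<union> {(j, i). j \<le> i \<and> i \<le> Suc n}" by auto
  also have "(\<Sum>(j, i)\<in>\<dots>. X j i) =
      (\<Sum>(j, i)\<in>{(j, i). i < j \<and> j \<le> Suc (Suc n)}. X j i) + (\<Sum>(j, i)\<in>{(j, i). j \<le> i \<and> i \<le> Suc n}. X j i)"
    by (rule sum.union_disjoint)
      (auto intro: finite_subset[of _ "{..Suc (Suc n)} \<times> {..Suc (Suc n)}"])
  also have "(\<Sum>(j, i)\<in>{(j, i). i < j \<and> j \<le> Suc (Suc n)}. X j i)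
      = (\<Sum>(j, i)\<in>{(j, i). j \<le> i \<and> i \<le> Suc n}. - X j i)"
    by (rule sum.reindex_bij_witness[of _ "\<lambda>(j, i). (Suc i, j)" "\<lambda>(j, i). (i, j - 1)"])
      (auto simp: X_def coface_coface)
  finally show ?thesis by (simp add: sum_negf case_prod_unfold zero_fun_def)
qed

lemma bword_eq: "bword n m G = bword' n m G + coface n m (Suc n) G"
  by (simp add: bword_def bword'_def)

text \<open>
  Applying \<open>\<tau>\<close> to \<open>b G\<close> shifts the cofaces cyclically: the first becomes the wrapped one, and the others
  become \<open>b' \<tau> G\<close>.  The wrapped coface cancels in the difference.
\<close>

lemma one_minus_rot_bword:
  "bword n m G - rot (Suc n) m (bword n m G) = bword' n m (G - rot n m G)"
proof -
  have "rot (Suc n) m (bword n m G) = (\<Sum>i\<le>Suc n. rot (Suc n) m (coface n m i G))"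
    unfolding bword_def by (simp only: additive.sum[OF additive_rot])
  also have "\<dots> = coface n m (Suc n) G + bword' n m (rot n m G)"
    unfolding sum.atMost_Suc_shift bword'_def
    by (simp add: rot_coface_0 rot_coface_Suc cong: sum.cong_simp)
  finally show ?thesis
    by (simp add: bword_eq additive.diff[OF additive_bword'])
qed

lemma rot_funpow_coface:
  assumes "l \<le> i" "i \<le> Suc n"
  shows "(rot (Suc n) m ^^ l) (coface n m i G) = coface n m (i - l) ((rot n m ^^ l) G)"
  using assms
proof (induction l)
  case (Suc l)
  then have "i - l = Suc (i - Suc l)" "i - Suc l \<le> n" by auto
  then show ?case using Suc by (simp add: rot_coface_Suc)
qed simp

text \<open>
  Moving \<open>\<tau>\<^sup>j\<close> to the right of coface \<open>i\<close> lowers the index by \<open>j\<close> if \<open>j \<le> i\<close>; otherwise the index runs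
  through \<open>0\<close> to the wrapped coface, which uses up one \<open>\<tau>\<close>.  In this way every product of a
  coface \<open>k \<le> n + 1\<close> with \<open>\<tau>\<^sup>l\<close>, \<open>l \<le> n\<close>, arises exactly once.
\<close>

lemma norm_bword': "norm_word (Suc n) m (bword' n m G) = bword n m (norm_word n m G)"
proof -
  let ?t = "rot (Suc n) m" and ?s = "rot n m"
  have summand: "(?t ^^ j) (coface n m i G) =
      (if j \<le> i then coface n m (i - j) ((?s ^^ j) G) else coface n m (Suc (Suc n) + i - j) ((?s ^^ (j - 1)) G))"
    if "i \<le> n" "j \<le> Suc n" for i j
  proof (cases "j \<le> i")
    case True
    then show ?thesis using that rot_funpow_coface[of j i n] by simp
  next
    case False
    then have "j = (j - 1 - i) + 1 + i" by simp
    then obtain k where k: "j = k + 1 + i" ..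
    have "(?t ^^ j) (coface n m i G) = (?t ^^ (k + 1)) ((?t ^^ i) (coface n m i G))"
      unfolding k funpow_add by simp
    also have "\<dots> = (?t ^^ k) (?t (coface n m 0 ((?s ^^ i) G)))"
      using rot_funpow_coface[of i i n m G] that by (simp add: funpow_swap1)
    also have "\<dots> = coface n m (Suc n - k) ((?s ^^ k) ((?s ^^ i) G))"
      using rot_funpow_coface[of k "Suc n" n m] k that by (simp add: rot_coface_0)
    also have "(?s ^^ k) ((?s ^^ i) G) = (?s ^^ (k + i)) G" by (simp add: funpow_add)
    finally show ?thesis using k that by (simp add: Suc_diff_le)
  qed
  have "norm_word (Suc n) m (bword' n m G) = (\<Sum>j\<le>Suc n. \<Sum>i\<le>n. (?t ^^ j) (coface n m i G))"
    unfolding norm_word_def bword'_def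
    by (simp only: additive.sum[OF additive_funpow[OF additive_rot]])
  also have "\<dots> = (\<Sum>(j, i)\<in>{..Suc n} \<times> {..n}. (?t ^^ j) (coface n m i G))"
    by (rule sum.cartesian_product)
  also have "\<dots> = (\<Sum>(k, l)\<in>{..Suc n} \<times> {..n}. coface n m k ((?s ^^ l) G))"
    by (rule sum.reindex_bij_witness[of _
          "\<lambda>(k, l). if k + l \<le> n then (l, k + l) else (Suc l, k + l - Suc n)"
          "\<lambda>(j, i). if j \<le> i then (i - j, j) else (Suc (Suc n) + i - j, j - 1)"])
      (auto simp: summand split: if_splits)
  also have "\<dots> = (\<Sum>k\<le>Suc n. \<Sum>l\<le>n. coface n m k ((?s ^^ l) G))"
    by (rule sum.cartesian_product[symmetric])
  also have "\<dots> = bword n m (norm_word n m G)"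
    unfolding norm_word_def bword_def by (simp only: additive.sum[OF additive_coface])
  finally show ?thesis .
qed

text \<open>
  Telescoping, as \<open>\<tau>\<close> has order \<open>n + 1\<close>.
\<close>

lemma norm_one_minus_rot:
  assumes "G \<in> supported n m"
  shows "norm_word n m (G - rot n m G) = 0" and "norm_word n m G - rot n m (norm_word n m G) = 0"
proof -
  have 1: "rot n m (norm_word n m G) = norm_word n m G"
  proof -
    have "rot n m (norm_word n m G) = (\<Sum>i\<le>n. (rot n m ^^ Suc i) G)"
      unfolding norm_word_def by (simp add: additive.sum[OF additive_rot])
    moreover have "(\<Sum>i\<le>Suc n. (rot n m ^^ i) G) = G + (\<Sum>i\<le>n. (rot n m ^^ Suc i) G)"
      by (simp only: sum.atMost_Suc_shift funpow_0)
    moreover have "(\<Sum>i\<le>Suc n. (rot n m ^^ i) G) = norm_word n m G + G"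
      unfolding norm_word_def by (simp only: sum.atMost_Suc rot_order[OF assms])
    ultimately show ?thesis by (metis add.commute add_left_cancel)
  qed
  have "norm_word n m (rot n m G) = rot n m (norm_word n m G)"
    unfolding norm_word_def by (simp add: additive.sum[OF additive_rot] funpow_swap1)
  with 1 show "norm_word n m (G - rot n m G) = 0" by (simp add: additive.diff[OF additive_norm_word])
  from 1 show "norm_word n m G - rot n m (norm_word n m G) = 0" by simp
qed

lemma words_append_one: "w \<in> words n m \<Longrightarrow> w @ [(0, \<one>)] \<in> words (Suc n) m"
  using gr_one by (auto simp: words_def)

text \<open>
  Append a unit to a word.  All products but the last leave the unit in place, and these summands cancel
  between the two terms because of the sign in \<open>s\<close>; the last product removes the unit and returns the word.
\<close>

lemma contraction:
  assumes "G \<in> supported n m"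
  shows "sword n m (bword' n m G) + (case n of 0 \<Rightarrow> 0 | Suc k \<Rightarrow> bword' k m (sword k m G)) = G"
proof
  fix w
  show "(sword n m (bword' n m G) + (case n of 0 \<Rightarrow> 0 | Suc k \<Rightarrow> bword' k m (sword k m G))) w = G w"
  proof (cases "w \<in> words (Suc n) m")
    case False
    then show ?thesis using assms
      by (auto simp: supported_def sword_def bword'_def sum_fun_apply coface_def plain_coface_def split: nat.split)
  next
    case True
    obtain u x where w: "w = u @ [x]" "length u = n" using word_snoc[OF True] True by (auto simp: words_def)
    have x: "letter_mult x (0, \<one>) = x"
      using True w gr_closed by (auto simp: words_def prod_eq_iff A_r_one)
    have last: "face n (w @ [(0, \<one>)]) = w"
      using face_split[of u x "(0, \<one>)" "[]"] w x by simp
    have "sword n m (bword' n m G) w = (- 1) ^ n * (\<Sum>i\<le>n. (- 1) ^ i * G (face i (w @ [(0, \<one>)])))"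
      using True words_append_one[OF True]
      by (simp add: sword_def bword'_def sum_fun_apply coface_def plain_coface_def)
    also have "\<dots> = (- 1) ^ n * ((\<Sum>i<n. (- 1) ^ i * G (face i w @ [(0, \<one>)])) + (- 1) ^ n * G w)"
    proof -
      have "face i (w @ [(0, \<one>)]) = face i w @ [(0, \<one>)]" if "i < n" for i
        using w that by (intro face_append_left) simp
      then show ?thesis by (simp add: lessThan_Suc_atMost[symmetric] last)
    qed
    also have "\<dots> = (- 1) ^ n * (\<Sum>i<n. (- 1) ^ i * G (face i w @ [(0, \<one>)])) + G w"
      by (simp add: algebra_simps flip: power_add mult.assoc)
    finally have 1: "sword n m (bword' n m G) w
        = (- 1) ^ n * (\<Sum>i<n. (- 1) ^ i * G (face i w @ [(0, \<one>)])) + G w" .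
    show ?thesis
    proof (cases n)
      case 0
      then show ?thesis using 1 by simp
    next
      case (Suc k)
      have "bword' k m (sword k m G) w = (\<Sum>i\<le>k. (- 1) ^ i * ((- 1) ^ k * G (face i w @ [(0, \<one>)])))"
        using True face_words[OF True] Suc
        by (simp add: bword'_def sum_fun_apply coface_def plain_coface_def sword_def)
      also have "\<dots> = - ((- 1) ^ n * (\<Sum>i<n. (- 1) ^ i * G (face i w @ [(0, \<one>)])))"
        using Suc by (simp add: lessThan_Suc_atMost[symmetric] sum_distrib_left sum_negf mult_ac del: sum.lessThan_Suc)
      finally show ?thesis using 1 Suc by simp
    qed
  qed
qed

text \<open>
  With \<open>H = (1 - \<tau>) G\<close>, the identities for \<open>(1 - \<tau>) b\<close> and \<open>b N\<close> turn the sum into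
  \<open>N (s b' + b' s) H = N H = 0\<close>.
\<close>

lemma Bword_bword:
  assumes "G \<in> supported n m"
  shows "Bword n m (bword n m G) + (case n of 0 \<Rightarrow> 0 | Suc k \<Rightarrow> bword k m (Bword k m G)) = 0"
proof -
  let ?H = "G - rot n m G"
  have "Bword n m (bword n m G) = norm_word n m (sword n m (bword' n m ?H))"
    by (simp add: Bword_def one_minus_rot_bword)
  moreover have "(case n of 0 \<Rightarrow> 0 | Suc k \<Rightarrow> bword k m (Bword k m G)) =
      norm_word n m (case n of 0 \<Rightarrow> 0 | Suc k \<Rightarrow> bword' k m (sword k m ?H))"
    by (cases n) (simp_all add: Bword_def norm_bword' additive.zero[OF additive_norm_word])
  ultimately have "Bword n m (bword n m G) + (case n of 0 \<Rightarrow> 0 | Suc k \<Rightarrow> bword k m (Bword k m G))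
      = norm_word n m (sword n m (bword' n m ?H) + (case n of 0 \<Rightarrow> 0 | Suc k \<Rightarrow> bword' k m (sword k m ?H)))"
    by (simp add: additive.add[OF additive_norm_word])
  also have "\<dots> = norm_word n m ?H"
    using assms by (subst contraction) (auto intro: supported_diff supported_rot)
  also have "\<dots> = 0" by (rule norm_one_minus_rot[OF assms])
  finally show ?thesis .
qed

text \<open>
  The product contains \<open>(1 - \<tau>) N = 0\<close>.
\<close>

lemma Bword_Bword: "Bword n m (Bword (Suc n) m G) = 0"
proof -
  have "Bword n m (Bword (Suc n) m G) = norm_word n m (sword n m 0)"
    by (simp only: Bword_def norm_one_minus_rot(2)[OF supported_sword])
  then show ?thesis
    by (simp add: additive.zero[OF additive_sword] additive.zero[OF additive_norm_word])
qed

end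

section \<open>The internal differential on functions of words\<close>

context dga
begin

lemma A_semiring: "semiring A" ..

lemmas A_l_distr = semiring.l_distr[OF A_semiring]
  and A_r_distr = semiring.r_distr[OF A_semiring]
  and A_l_null = semiring.l_null[OF A_semiring]
  and A_r_null = semiring.r_null[OF A_semiring]

text \<open>
  The transpose of the differential of the tensor power; the recursion produces the Koszul signs.  Letters of
  degree \<open>0\<close> are killed by \<open>\<phi>\<close> and are skipped, since the truncated degree \<open>0 - 1\<close> would give
  a word of the wrong total degree.
\<close>

fun phi_sum :: "('a word \<Rightarrow> 'k) \<Rightarrow> 'a word \<Rightarrow> 'k" where
  "phi_sum G [] = 0"
| "phi_sum G ((d, a) # w) =
     (if d = 0 then 0 else G ((d - 1, \<phi> a) # w)) + (- 1) ^ d * phi_sum (\<lambda>v. G ((d, a) # v)) w"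

lemma phi_closed: "x \<in> gr d \<Longrightarrow> \<phi> x \<in> gr (d - 1)"
  using diff_Suc diff_0 gr_zero by (cases d) auto

lemma phi_add: "x \<in> carrier A \<Longrightarrow> y \<in> carrier A \<Longrightarrow> \<phi> (x \<oplus> y) = \<phi> x \<oplus> \<phi> y"
  and phi_smult: "x \<in> carrier A \<Longrightarrow> \<phi> (c \<odot>\<^bsub>A\<^esub> x) = c \<odot>\<^bsub>A\<^esub> \<phi> x"
  and phi_carrier: "x \<in> carrier A \<Longrightarrow> \<phi> x \<in> carrier A"
  using linear_mapD[OF diff_linear] by auto

text \<open>
  The differential evaluates \<open>G\<close> at words of the right kind only, so cutting off \<open>G\<close> elsewhere does
  not change its value.
\<close>

lemma phi_sum_cong:
  assumes "letters w"
    and "\<And>v. letters v \<Longrightarrow> length v = length w \<Longrightarrow> Suc (deg v) = deg w \<Longrightarrow> G v = H v"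
  shows "phi_sum G w = phi_sum H w"
  using assms
proof (induction w arbitrary: G H)
  case (Cons x w)
  obtain d a where x: "x = (d, a)" by force
  have "phi_sum (\<lambda>v. G ((d, a) # v)) w = phi_sum (\<lambda>v. H ((d, a) # v)) w"
    by (rule Cons.IH) (use Cons.prems x in auto)
  moreover have "d \<noteq> 0 \<Longrightarrow> G ((d - 1, \<phi> a) # w) = H ((d - 1, \<phi> a) # w)"
    by (rule Cons.prems(2)) (use Cons.prems(1) x phi_closed in auto)
  ultimately show ?case by (simp add: x)
qed simp

lemma phi_sum_add: "phi_sum (\<lambda>v. G v + H v) w = phi_sum G w + phi_sum H w"
  by (induction w arbitrary: G H) (auto simp: algebra_simps)

lemma phi_sum_mult: "phi_sum (\<lambda>v. c * G v) w = c * phi_sum G w"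
  by (induction w arbitrary: G) (auto simp: algebra_simps)

lemma phi_sum_zero: "phi_sum (\<lambda>v. 0) w = 0"
  by (induction w) auto

lemma phi_sum_append:
  "phi_sum G (u @ w) = phi_sum (\<lambda>v. G (v @ w)) u + (- 1) ^ deg u * phi_sum (\<lambda>v. G (u @ v)) w"
  by (induction u arbitrary: G) (auto simp: algebra_simps power_add)

text \<open>
  Differentiating two different letters in the two possible orders gives opposite signs, because the
  degree of the first letter drops by one in between.  Differentiating one letter twice makes it zero.
\<close>

lemma phi_sum_phi_sum:
  assumes "letters w"
    and "\<And>u d v. letters (u @ (d, \<zero>) # v) \<Longrightarrow> length (u @ (d, \<zero>) # v) = length w \<Longrightarrow>
      deg (u @ (d, \<zero>) # v) + 2 = deg w \<Longrightarrow> G (u @ (d, \<zero>) # v) = 0"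
  shows "phi_sum (phi_sum G) w = 0"
  using assms
proof (induction w arbitrary: G)
  case (Cons x w)
  obtain d a where x: "x = (d, a)" by force
  have a: "a \<in> carrier A" "a \<in> gr d" using Cons.prems(1) x gr_closed by auto
  have tail: "phi_sum (phi_sum (\<lambda>v. G ((d, a) # v))) w = 0"
  proof (rule Cons.IH)
    show "letters w" using Cons.prems(1) by simp
    fix u e v assume *: "letters (u @ (e, \<zero>) # v)" "length (u @ (e, \<zero>) # v) = length w"
      "deg (u @ (e, \<zero>) # v) + 2 = deg w"
    show "G ((d, a) # u @ (e, \<zero>) # v) = 0"
      using Cons.prems(2)[of "(d, a) # u" e v] * a x by simp
  qed
  have head: "d - 1 \<noteq> 0 \<Longrightarrow> G ((d - 1 - 1, \<phi> (\<phi> a)) # w) = 0"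
    using Cons.prems(2)[of "[]" "d - 2" w] Cons.prems(1) a x diff_diff[OF a(1)] gr_zero
    by (simp add: numeral_2_eq_2)
  have inner: "phi_sum (\<lambda>v. phi_sum G ((d, a) # v)) w = (if d = 0 then 0 else phi_sum (\<lambda>v. G ((d - 1, \<phi> a) # v)) w)"
    using tail by (simp add: phi_sum_add phi_sum_mult phi_sum_zero)
  show ?case unfolding x phi_sum.simps(2)[of "phi_sum G"] inner using head by (cases d) auto
qed simp

definition dphi :: "nat \<Rightarrow> nat \<Rightarrow> ('a word \<Rightarrow> 'k) \<Rightarrow> 'a word \<Rightarrow> 'k" where
  "dphi n m G = (\<lambda>w. if w \<in> words (Suc n) (Suc m) then phi_sum G w else 0)"

lemma words_iff: "w \<in> words n m \<longleftrightarrow> length w = n \<and> letters w \<and> deg w = m"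
  by (auto simp: words_def)

lemma phi_sum_cong_words:
  assumes "w \<in> words n (Suc m)" "\<And>v. v \<in> words n m \<Longrightarrow> G v = H v"
  shows "phi_sum G w = phi_sum H w"
  by (rule phi_sum_cong) (use assms in \<open>auto simp: words_iff\<close>)

lemma additive_dphi: "additive (dphi n m)"
  by standard (auto simp: dphi_def fun_eq_iff phi_sum_add plus_fun_def)

lemma supported_dphi: "dphi n m G \<in> supported n (Suc m)"
  by (auto simp: supported_def dphi_def)

text \<open>
  Differentiating the moved letter changes the Koszul sign of the move by the parity of the other
  letters, which is the sign for differentiating in last position.  Differentiating another letter
  changes it by the parity of the moved letter, which is the sign for differentiating after that
  letter.
\<close>

lemma dphi_rot: "dphi n m (rot n m G) = rot n (Suc m) (dphi n m G)"
proof
  fix w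
  show "dphi n m (rot n m G) w = rot n (Suc m) (dphi n m G) w"
  proof (cases "w \<in> words (Suc n) (Suc m)")
    case True
    obtain u d a where w: "w = u @ [(d, a)]" using word_snoc[OF True] by fastforce
    have uw: "length u = n" "letters u" "a \<in> gr d" "deg u + d = Suc m"
      using True w by (auto simp: words_iff)
    have wr: "(d, a) # u \<in> words (Suc n) (Suc m)" using uw by (auto simp: words_iff)
    have 1: "phi_sum (\<lambda>v. rot n m G (v @ [(d, a)])) u
        = phi_sum (\<lambda>v. (- 1) ^ (n + d * deg u + d) * G ((d, a) # v)) u"
    proof (rule phi_sum_cong[OF uw(2)])
      fix v assume v: "letters v" "length v = length u" "Suc (deg v) = deg u"
      then have "v @ [(d, a)] \<in> words (Suc n) m" using uw by (auto simp: words_iff)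
      then have "rot n m G (v @ [(d, a)]) = (- 1) ^ (n + d * deg v) * G ((d, a) # v)"
        by (simp add: rot_snoc)
      also have "(- 1) ^ (n + d * deg v) = ((- 1) ^ (n + d * deg u + d) :: 'k)"
        using v(3) by (simp add: power_add flip: v(3))
      finally show "rot n m G (v @ [(d, a)]) = (- 1) ^ (n + d * deg u + d) * G ((d, a) # v)" .
    qed
    have 2: "rot n m G (u @ [(d - 1, \<phi> a)]) = (- 1) ^ (n + (d - 1) * deg u) * G ((d - 1, \<phi> a) # u)"
      if "d \<noteq> 0"
    proof -
      have "u @ [(d - 1, \<phi> a)] \<in> words (Suc n) m" using uw that phi_closed by (auto simp: words_iff)
      then show ?thesis by (simp add: rot_snoc)
    qed
    have "dphi n m (rot n m G) w =
        (- 1) ^ (n + d * deg u + d) * phi_sum (\<lambda>v. G ((d, a) # v)) u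
        + (if d = 0 then 0 else (- 1) ^ (n + d * deg u) * G ((d - 1, \<phi> a) # u))"
    proof -
      have "(- 1) ^ deg u * (- 1) ^ (n + (d - 1) * deg u) = ((- 1) ^ (n + d * deg u) :: 'k)" if "d \<noteq> 0"
        using that by (cases d) (simp_all add: power_add mult_ac)
      then have "(- 1) ^ deg u * rot n m G (u @ [(d - 1, \<phi> a)]) = (- 1) ^ (n + d * deg u) * G ((d - 1, \<phi> a) # u)"
        if "d \<noteq> 0"
        using that 2 by (simp flip: mult.assoc)
      then show ?thesis
        using True unfolding w by (simp add: dphi_def phi_sum_append 1 phi_sum_mult)
    qed
    also have "\<dots> = rot n (Suc m) (dphi n m G) w"
      using True wr unfolding w by (auto simp: rot_snoc dphi_def algebra_simps power_add)
    finally show ?thesis .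
  qed (simp add: dphi_def rot_def)
qed

lemma dphi_sword: "dphi n m (sword n m G) = sword n (Suc m) (dphi (Suc n) m G)"
proof
  fix w
  show "dphi n m (sword n m G) w = sword n (Suc m) (dphi (Suc n) m G) w"
  proof (cases "w \<in> words (Suc n) (Suc m)")
    case True
    have "phi_sum (sword n m G) w = phi_sum (\<lambda>v. (- 1) ^ n * G (v @ [(0, \<one>)])) w"
      by (rule phi_sum_cong_words[OF True]) (simp add: sword_def)
    then show ?thesis using True words_append_one[OF True]
      by (simp add: dphi_def sword_def phi_sum_append phi_sum_mult)
  qed (simp add: dphi_def sword_def)
qed

text \<open>
  The functions of words that come from cochains.
\<close>

definition forms :: "nat \<Rightarrow> nat \<Rightarrow> ('a word \<Rightarrow> 'k) set" where
  "forms n m = {G \<in> supported n m. multilinear (Suc n) m field_vs G}"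

lemma forms_iff:
  "G \<in> forms n m \<longleftrightarrow> G \<in> supported n m \<and>
     (\<forall>u d x y v. u @ (d, x) # v \<in> words (Suc n) m \<and> y \<in> gr d \<longrightarrow>
        G (u @ (d, x \<oplus> y) # v) = G (u @ (d, x) # v) + G (u @ (d, y) # v)) \<and>
     (\<forall>u d x c v. u @ (d, x) # v \<in> words (Suc n) m \<longrightarrow>
        G (u @ (d, c \<odot>\<^bsub>A\<^esub> x) # v) = c * G (u @ (d, x) # v))"
  by (auto simp: forms_def multilinear_def field_vs_def)

lemma forms_add:
  "G \<in> forms n m \<Longrightarrow> u @ (d, x) # v \<in> words (Suc n) m \<Longrightarrow> y \<in> gr d \<Longrightarrow>
     G (u @ (d, x \<oplus> y) # v) = G (u @ (d, x) # v) + G (u @ (d, y) # v)"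
  and forms_smult:
  "G \<in> forms n m \<Longrightarrow> u @ (d, x) # v \<in> words (Suc n) m \<Longrightarrow>
     G (u @ (d, c \<odot>\<^bsub>A\<^esub> x) # v) = c * G (u @ (d, x) # v)"
  and forms_supported: "G \<in> forms n m \<Longrightarrow> G \<in> supported n m"
  unfolding forms_iff by blast+

lemma forms_zero:
  assumes "G \<in> forms n m" "u @ (d, \<zero>) # v \<in> words (Suc n) m" shows "G (u @ (d, \<zero>) # v) = 0"
  using forms_smult[OF assms, of 0] smult_0[of \<zero>] by simp

lemma forms_plus: "G \<in> forms n m \<Longrightarrow> H \<in> forms n m \<Longrightarrow> G + H \<in> forms n m"
  and forms_minus: "G \<in> forms n m \<Longrightarrow> H \<in> forms n m \<Longrightarrow> G - H \<in> forms n m"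
  and forms_0: "0 \<in> forms n m"
  by (auto simp: forms_iff supported_add supported_diff supported_0 algebra_simps)

lemma forms_sum: "(\<And>i. i \<in> I \<Longrightarrow> f i \<in> forms n m) \<Longrightarrow> (\<Sum>i\<in>I. f i) \<in> forms n m"
  by (induction I rule: infinite_finite_induct) (auto intro: forms_plus forms_0)

abbreviation gr_linear :: "nat \<Rightarrow> ('a \<Rightarrow> 'a) \<Rightarrow> bool" where
  "gr_linear d f \<equiv> (\<forall>z\<in>gr d. \<forall>z'\<in>gr d. f (z \<oplus> z') = f z \<oplus> f z') \<and>
     (\<forall>a. \<forall>z\<in>gr d. f (a \<odot>\<^bsub>A\<^esub> z) = a \<odot>\<^bsub>A\<^esub> f z)"

text \<open>
  Rotations, products of adjacent letters and appending a unit move a given letter to some slot, where it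
  enters through a linear map.  This suffices for preserving multilinearity.
\<close>

lemma forms_slotI:
  assumes G: "G \<in> forms n' m" and H: "H \<in> supported n m"
    and slot: "\<And>u d x v. u @ (d, x) # v \<in> words (Suc n) m \<Longrightarrow> \<exists>c u' d' f v'.
      (\<forall>z\<in>gr d. u' @ (d', f z) # v' \<in> words (Suc n') m \<and> H (u @ (d, z) # v) = c * G (u' @ (d', f z) # v')) \<and>
      gr_linear d f"
  shows "H \<in> forms n m"
  unfolding forms_iff
proof (intro conjI allI impI H; (elim conjE)?)
  fix u d x y v assume w: "u @ (d, x) # v \<in> words (Suc n) m" and y: "y \<in> gr d"
  have x: "x \<in> gr d" using w by (simp add: words_iff)
  obtain c u' d' f v' where f: "\<forall>z\<in>gr d. u' @ (d', f z) # v' \<in> words (Suc n') m \<and>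
      H (u @ (d, z) # v) = c * G (u' @ (d', f z) # v')"
    "\<forall>z\<in>gr d. \<forall>z'\<in>gr d. f (z \<oplus> z') = f z \<oplus> f z'"
    using slot[OF w] by (elim exE conjE)
  have "f y \<in> gr d'" using f(1) y by (auto simp: words_iff)
  then show "H (u @ (d, x \<oplus> y) # v) = H (u @ (d, x) # v) + H (u @ (d, y) # v)"
    using f x y gr_add[OF x y] forms_add[OF G, of u' d' "f x" v' "f y"] by (simp add: distrib_left)
next
  fix u d x a v assume w: "u @ (d, x) # v \<in> words (Suc n) m"
  have x: "x \<in> gr d" using w by (simp add: words_iff)
  obtain c u' d' f v' where f: "\<forall>z\<in>gr d. u' @ (d', f z) # v' \<in> words (Suc n') m \<and>
      H (u @ (d, z) # v) = c * G (u' @ (d', f z) # v')" "\<forall>a. \<forall>z\<in>gr d. f (a \<odot>\<^bsub>A\<^esub> z) = a \<odot>\<^bsub>A\<^esub> f z"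
    using slot[OF w] by (elim exE conjE)
  then show "H (u @ (d, a \<odot>\<^bsub>A\<^esub> x) # v) = a * H (u @ (d, x) # v)"
    using x gr_smult[OF x] forms_smult[OF G, of u' d' "f x" v'] by simp
qed

lemma forms_rot:
  assumes G: "G \<in> forms n m" shows "rot n m G \<in> forms n m"
proof (rule forms_slotI[OF G supported_rot])
  fix u d x v assume w: "u @ (d, x) # v \<in> words (Suc n) m"
  have "\<exists>(c::'k) u' v'. \<forall>z\<in>gr d. u' @ (d, z) # v' \<in> words (Suc n) m \<and>
      rot n m G (u @ (d, z) # v) = c * G (u' @ (d, z) # v')"
  proof (cases v rule: rev_cases)
    case Nil
    have "[] @ (d, z) # u \<in> words (Suc n) m \<and>
      rot n m G (u @ (d, z) # v) = (- 1) ^ (n + d * deg u) * G ([] @ (d, z) # u)" if "z \<in> gr d" for z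
      using words_change[OF w that] Nil words_rotate[of u "[(d, z)]"] rot_snoc[of u "(d, z)" n m G] by simp
    then show ?thesis by blast
  next
    case (snoc v' y)
    have "(y # u) @ (d, z) # v' \<in> words (Suc n) m \<and>
      rot n m G (u @ (d, z) # v) = (- 1) ^ (n + fst y * (deg u + (d + deg v'))) * G ((y # u) @ (d, z) # v')"
      if "z \<in> gr d" for z
      using words_change[OF w that] snoc words_rotate[of "u @ (d, z) # v'" "[y]"]
        rot_snoc[of "u @ (d, z) # v'" y n m G] by simp
    then show ?thesis by blast
  qed
  then obtain c :: 'k and u' v' where "\<forall>z\<in>gr d. u' @ (d, z) # v' \<in> words (Suc n) m \<and>
      rot n m G (u @ (d, z) # v) = c * G (u' @ (d, z) # v')" by (elim exE)
  then show "\<exists>c u' d' f v'. (\<forall>z\<in>gr d. u' @ (d', f z) # v' \<in> words (Suc n) m \<and>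
      rot n m G (u @ (d, z) # v) = c * G (u' @ (d', f z) # v')) \<and>
      gr_linear d f"
    by (intro exI[of _ c] exI[of _ u'] exI[of _ d] exI[of _ "\<lambda>z. z"] exI[of _ v']) simp
qed

lemma forms_sword:
  assumes G: "G \<in> forms (Suc n) m" shows "sword n m G \<in> forms n m"
proof (rule forms_slotI[OF G supported_sword])
  fix u d x v assume w: "u @ (d, x) # v \<in> words (Suc n) m"
  have "u @ (d, z) # v @ [(0, \<one>)] \<in> words (Suc (Suc n)) m \<and>
      sword n m G (u @ (d, z) # v) = (- 1) ^ n * G (u @ (d, z) # v @ [(0, \<one>)])" if "z \<in> gr d" for z
    using words_change[OF w that] words_append_one[of "u @ (d, z) # v"] by (simp add: sword_def)
  then show "\<exists>c u' d' f v'. (\<forall>z\<in>gr d. u' @ (d', f z) # v' \<in> words (Suc (Suc n)) m \<and>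
      sword n m G (u @ (d, z) # v) = c * G (u' @ (d', f z) # v')) \<and>
      gr_linear d f"
    by (intro exI[of _ "(- 1) ^ n"] exI[of _ u] exI[of _ d] exI[of _ "\<lambda>z. z"] exI[of _ "v @ [(0, \<one>)]"]) simp
qed

lemma face_slot:
  assumes w: "u @ (d, x) # v \<in> words (Suc (Suc n)) m" and i: "i \<le> n"
  shows "\<exists>u' d' f v'. (\<forall>z. face i (u @ (d, z) # v) = u' @ (d', f z) # v') \<and>
    gr_linear d f"
proof -
  have that: ?thesis if "\<And>z. face i (u @ (d, z) # v) = u' @ (d', f z) # v'"
    "\<And>z z'. z \<in> gr d \<Longrightarrow> z' \<in> gr d \<Longrightarrow> f (z \<oplus> z') = f z \<oplus> f z'"
    "\<And>c z. z \<in> gr d \<Longrightarrow> f (c \<odot>\<^bsub>A\<^esub> z) = c \<odot>\<^bsub>A\<^esub> f z" for u' d' f v'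
    using that by (intro exI[of _ u'] exI[of _ d'] exI[of _ f] exI[of _ v']) simp
  have len: "length u + length v = Suc n" and lets: "letters u" "letters v"
    using w by (auto simp: words_iff)
  consider "Suc i < length u" | "Suc i = length u" | "i = length u" | "i > length u" by linarith
  then show ?thesis
  proof cases
    case 1
    show ?thesis
      by (rule that[of "face i u" d "\<lambda>z. z" v]) (use 1 in \<open>auto simp: face_append_left\<close>)
  next
    case 2
    then obtain u' e y where u: "u = u' @ [(e, y)]" "length u' = i" by (cases u rule: rev_cases) auto
    then have y: "y \<in> gr e" "y \<in> carrier A" using lets gr_closed by auto
    show ?thesis
    proof (rule that[of u' "e + d" "\<lambda>z. y \<otimes> z" v])
      show "face i (u @ (d, z) # v) = u' @ (e + d, y \<otimes> z) # v" for z
        using u face_split[of u' "(e, y)" "(d, z)" v] by simp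
    qed (use y gr_mult gr_closed A_r_distr smult_mult_right in auto)
  next
    case 3
    then obtain e y v' where v: "v = (e, y) # v'" using len i by (cases v) auto
    then have y: "y \<in> gr e" "y \<in> carrier A" using lets gr_closed by auto
    show ?thesis
    proof (rule that[of u "d + e" "\<lambda>z. z \<otimes> y" v'])
      show "face i (u @ (d, z) # v) = u @ (d + e, z \<otimes> y) # v'" for z
        using v 3 face_split[of u "(d, z)" "(e, y)" v'] by simp
    qed (use y gr_mult gr_closed A_l_distr smult_mult_left in auto)
  next
    case 4
    show ?thesis
    proof (rule that[of u d "\<lambda>z. z" "face (i - Suc (length u)) v"])
      show "face i (u @ (d, z) # v) = u @ (d, z) # face (i - Suc (length u)) v" for z
        using face_append[of "u @ [(d, z)]" "i - Suc (length u)" v] 4 by simp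
    qed auto
  qed
qed

lemma forms_plain_coface:
  assumes G: "G \<in> forms n m" and i: "i \<le> n" shows "plain_coface n m i G \<in> forms (Suc n) m"
proof (rule forms_slotI[OF G])
  show "plain_coface n m i G \<in> supported (Suc n) m" by (simp add: supported_def plain_coface_def)
  fix u d x v assume w: "u @ (d, x) # v \<in> words (Suc (Suc n)) m"
  obtain u' d' f v' where f: "\<forall>z. face i (u @ (d, z) # v) = u' @ (d', f z) # v'"
    "\<forall>z\<in>gr d. \<forall>z'\<in>gr d. f (z \<oplus> z') = f z \<oplus> f z'"
    "\<forall>c. \<forall>z\<in>gr d. f (c \<odot>\<^bsub>A\<^esub> z) = c \<odot>\<^bsub>A\<^esub> f z"
    using face_slot[OF w i] by (elim exE conjE)
  have "u' @ (d', f z) # v' \<in> words (Suc n) m \<and>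
      plain_coface n m i G (u @ (d, z) # v) = (- 1) ^ i * G (u' @ (d', f z) # v')" if "z \<in> gr d" for z
    using words_change[OF w that] face_words[OF words_change[OF w that], of i] i f(1) by (simp add: plain_coface_def)
  with f show "\<exists>c u' d' f v'. (\<forall>z\<in>gr d. u' @ (d', f z) # v' \<in> words (Suc n) m \<and>
      plain_coface n m i G (u @ (d, z) # v) = c * G (u' @ (d', f z) # v')) \<and>
      gr_linear d f"
    by (intro exI[of _ "(- 1) ^ i"] exI[of _ u'] exI[of _ d'] exI[of _ f] exI[of _ v']) simp
qed

lemma forms_coface: "G \<in> forms n m \<Longrightarrow> coface n m i G \<in> forms (Suc n) m"
  by (simp add: coface_def forms_plain_coface forms_rot)

lemma forms_bword: "G \<in> forms n m \<Longrightarrow> bword n m G \<in> forms (Suc n) m"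
  unfolding bword_def by (intro forms_sum forms_coface)

text \<open>
  The Leibniz rule for the product of the first two letters, split by the additivity of \<open>G\<close>.  If one of
  the two has degree \<open>0\<close>, its differential is zero and contributes nothing on either side.
\<close>

lemma dphi_coface_0:
  assumes G: "G \<in> forms n m"
  shows "dphi (Suc n) m (coface n m 0 G) = coface n (Suc m) 0 (dphi n m G)"
proof
  fix w
  show "dphi (Suc n) m (coface n m 0 G) w = coface n (Suc m) 0 (dphi n m G) w"
  proof (cases "w \<in> words (Suc (Suc n)) (Suc m)")
    case w: True
    obtain d a e b v where wv: "w = (d, a) # (e, b) # v"
      using w by (cases w; cases "tl w") (auto simp: words_iff)
    have ab: "a \<in> gr d" "b \<in> gr e" "a \<in> carrier A" "b \<in> carrier A" "length v = n" "letters v"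
      "d + (e + deg v) = Suc m"
      using w wv gr_closed by (auto simp: words_iff)
    have "phi_sum (coface n m 0 G) w = phi_sum (\<lambda>w. G (face 0 w)) w"
      by (rule phi_sum_cong_words[OF w]) (simp add: coface_def plain_coface_def)
    also have "\<dots> = (if d = 0 then 0 else G ((d - 1 + e, \<phi> a \<otimes> b) # v))
        + (- 1) ^ d * (if e = 0 then 0 else G ((d + (e - 1), a \<otimes> \<phi> b) # v))
        + (- 1) ^ (d + e) * phi_sum (\<lambda>v. G ((d + e, a \<otimes> b) # v)) v"
      by (simp add: wv algebra_simps power_add)
    finally have L: "phi_sum (coface n m 0 G) w = (if d = 0 then 0 else G ((d - 1 + e, \<phi> a \<otimes> b) # v))
        + (- 1) ^ d * (if e = 0 then 0 else G ((d + (e - 1), a \<otimes> \<phi> b) # v))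
        + (- 1) ^ (d + e) * phi_sum (\<lambda>v. G ((d + e, a \<otimes> b) # v)) v" .
    have "face 0 w \<in> words (Suc n) (Suc m)" using face_words[OF w, of 0] by simp
    then have R: "coface n (Suc m) 0 (dphi n m G) w = phi_sum G ((d + e, a \<otimes> b) # v)"
      using w by (simp add: coface_def plain_coface_def dphi_def wv)
    have head: "(if d + e = 0 then 0 else G ((d + e - 1, \<phi> (a \<otimes> b)) # v))
        = (if d = 0 then 0 else G ((d - 1 + e, \<phi> a \<otimes> b) # v))
        + (- 1) ^ d * (if e = 0 then 0 else G ((d + (e - 1), a \<otimes> \<phi> b) # v))"
    proof (cases "d + e = 0")
      case False
      have pa: "\<phi> a \<otimes> b \<in> gr (d + e - 1)"
      proof (cases d)
        case 0
        then show ?thesis using diff_0[of a] ab gr_zero A_l_null by simp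
      next
        case (Suc d')
        then show ?thesis using gr_mult[OF diff_Suc[of a d'] ab(2)] ab by simp
      qed
      have pb: "a \<otimes> \<phi> b \<in> gr (d + e - 1)"
      proof (cases e)
        case 0
        then show ?thesis using diff_0[of b] ab gr_zero A_r_null by simp
      next
        case (Suc e')
        then show ?thesis using gr_mult[OF ab(1) diff_Suc[of b e']] ab by simp
      qed
      have mem: "[] @ (d + e - 1, z) # v \<in> words (Suc n) m" if "z \<in> gr (d + e - 1)" for z
        using that ab False by (auto simp: words_iff)
      have zero: "G ((d + e - 1, \<zero>) # v) = 0"
        using forms_zero[OF G mem[OF gr_zero]] by simp
      have "\<phi> (a \<otimes> b) = \<phi> a \<otimes> b \<oplus> (- 1) ^ d \<odot>\<^bsub>A\<^esub> (a \<otimes> \<phi> b)"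
        by (rule diff_mult[OF ab(1,4)])
      then have "G ((d + e - 1, \<phi> (a \<otimes> b)) # v) =
          G ((d + e - 1, \<phi> a \<otimes> b) # v) + (- 1) ^ d * G ((d + e - 1, a \<otimes> \<phi> b) # v)"
        using forms_add[OF G mem[OF pa] gr_smult[OF pb]] forms_smult[OF G mem[OF pb]] by simp
      moreover have "G ((d + e - 1, \<phi> a \<otimes> b) # v) = 0" if "d = 0"
        using that zero diff_0[of a] ab A_l_null by simp
      moreover have "G ((d + e - 1, a \<otimes> \<phi> b) # v) = 0" if "e = 0"
        using that zero diff_0[of b] ab A_r_null by simp
      moreover have "d \<noteq> 0 \<Longrightarrow> d - 1 + e = d + e - 1" "e \<noteq> 0 \<Longrightarrow> d + (e - 1) = d + e - 1" by auto
      ultimately show ?thesis using False by auto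
    qed simp
    show ?thesis using w R L head by (simp add: dphi_def)
  next
    case False
    then show ?thesis by (simp add: dphi_def coface_def plain_coface_def)
  qed
qed

text \<open>
  Since \<open>\<tau>\<close> is injective, it suffices to compare the two sides after applying \<open>\<tau>\<close>, which lowers the index
  of the coface and commutes with the differential.
\<close>

lemma dphi_coface:
  assumes "i \<le> Suc n" "G \<in> forms n m"
  shows "dphi (Suc n) m (coface n m i G) = coface n (Suc m) i (dphi n m G)"
  using assms
proof (induction i arbitrary: G)
  case 0
  then show ?case by (simp add: dphi_coface_0)
next
  case (Suc i)
  have "rot (Suc n) (Suc m) (dphi (Suc n) m (coface n m (Suc i) G)) = dphi (Suc n) m (coface n m i (rot n m G))"
    using Suc.prems by (simp add: rot_coface_Suc flip: dphi_rot)
  also have "\<dots> = coface n (Suc m) i (rot n (Suc m) (dphi n m G))"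
    using Suc.IH[of "rot n m G"] Suc.prems by (simp add: forms_rot dphi_rot)
  also have "\<dots> = rot (Suc n) (Suc m) (coface n (Suc m) (Suc i) (dphi n m G))"
    using Suc.prems by (simp add: rot_coface_Suc)
  finally show ?case
    by (rule rot_inject[OF supported_dphi supported_coface])
qed

lemma dphi_bword:
  assumes "G \<in> forms n m" shows "dphi (Suc n) m (bword n m G) = bword n (Suc m) (dphi n m G)"
  unfolding bword_def additive.sum[OF additive_dphi] using assms by (simp add: dphi_coface)

lemma dphi_rot_funpow: "dphi n m ((rot n m ^^ i) G) = (rot n (Suc m) ^^ i) (dphi n m G)"
  by (induction i) (simp_all add: dphi_rot)

lemma dphi_norm_word: "dphi n m (norm_word n m G) = norm_word n (Suc m) (dphi n m G)"
  unfolding norm_word_def additive.sum[OF additive_dphi] by (simp add: dphi_rot_funpow)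

lemma dphi_Bword: "dphi n m (Bword n m G) = Bword n (Suc m) (dphi (Suc n) m G)"
  by (simp add: Bword_def dphi_norm_word dphi_sword dphi_rot additive.diff[OF additive_dphi])

lemma dphi_dphi:
  assumes G: "G \<in> forms n m" shows "dphi n (Suc m) (dphi n m G) = 0"
proof
  fix w
  show "dphi n (Suc m) (dphi n m G) w = 0 w"
  proof (cases "w \<in> words (Suc n) (Suc (Suc m))")
    case True
    have "phi_sum (dphi n m G) w = phi_sum (phi_sum G) w"
      by (rule phi_sum_cong_words[OF True]) (simp add: dphi_def)
    also have "\<dots> = 0"
      by (rule phi_sum_phi_sum) (use True forms_zero[OF G] in \<open>auto simp: words_iff\<close>)
    finally show ?thesis by (simp add: dphi_def)
  qed (simp add: dphi_def)
qed

end

section \<open>Cochains as multilinear functions of words\<close>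

lemma linear_functional_finsum:
  assumes f: "linear_map class_ring V field_vs f" and g: "\<And>i. i \<in> I \<Longrightarrow> g i \<in> carrier V"
  shows "f (\<Oplus>\<^bsub>V\<^esub>i\<in>I. g i) = (\<Sum>i\<in>I. f (g i))"
proof -
  interpret V: vectorspace class_ring V by (rule linear_mapD[OF f])
  show ?thesis using g
  proof (induction I rule: infinite_finite_induct)
    case (insert i I)
    then have "f (\<Oplus>\<^bsub>V\<^esub>i\<in>insert i I. g i) = f (g i \<oplus>\<^bsub>V\<^esub> (\<Oplus>\<^bsub>V\<^esub>i\<in>I. g i))"
      by (subst V.M.finsum_insert) auto
    also have "\<dots> = f (g i) + f (\<Oplus>\<^bsub>V\<^esub>i\<in>I. g i)"
      using insert linear_mapD(4)[OF f, of "g i" "\<Oplus>\<^bsub>V\<^esub>i\<in>I. g i"]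
      by (simp add: field_vs_def V.M.finsum_closed Pi_iff)
    finally show ?case using insert by simp
  qed (use linear_mapD(6)[OF f] in \<open>simp_all add: field_vs_def\<close>)
qed

lemma lin_functional_iff:
  assumes "vectorspace class_ring V"
  shows "f \<in> lin_maps V field_vs \<longleftrightarrow>
    (\<forall>u\<in>carrier V. \<forall>v\<in>carrier V. f (u \<oplus>\<^bsub>V\<^esub> v) = f u + f v) \<and>
    (\<forall>c. \<forall>v\<in>carrier V. f (c \<odot>\<^bsub>V\<^esub> v) = c * f v) \<and> (\<forall>v. v \<notin> carrier V \<longrightarrow> f v = 0)"
  by (auto simp: lin_maps_def LinearCombinations.module_hom_def field_vs_def)

context dga
begin

abbreviation cochain_space :: "nat \<Rightarrow> nat \<Rightarrow> ('k, 'a) cochain set" where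
  "cochain_space n m \<equiv> carrier (cochains A gr n m)"

lemma cochains_carrier: "cochain_space n m = lin_maps (tensor_part A gr (Suc n) m) field_vs"
  by (simp add: cochains_def hom_vs_def)

lemma cochain_linear:
  "f \<in> cochain_space n m \<Longrightarrow> linear_map class_ring (tensor_part A gr (Suc n) m) field_vs f"
  unfolding cochains_carrier lin_maps_iff[OF vectorspace_tensor_part vectorspace_field_vs] by blast

lemma cochain_add: "f \<in> cochain_space n m \<Longrightarrow> g \<in> cochain_space n m \<Longrightarrow>
    (\<lambda>v. f v + g v) \<in> cochain_space n m"
  and cochain_diff: "f \<in> cochain_space n m \<Longrightarrow> g \<in> cochain_space n m \<Longrightarrow>
    (\<lambda>v. f v - g v) \<in> cochain_space n m"
  and cochain_scale: "f \<in> cochain_space n m \<Longrightarrow> (\<lambda>v. c * f v) \<in> cochain_space n m"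
  and cochain_zero: "(\<lambda>v. 0) \<in> cochain_space n m"
  by (auto simp: cochains_carrier lin_functional_iff[OF vectorspace_tensor_part] algebra_simps)

lemma cochain_sum: "(\<And>i. i \<in> I \<Longrightarrow> f i \<in> cochain_space n m) \<Longrightarrow>
    (\<lambda>v. \<Sum>i\<in>I. f i v) \<in> cochain_space n m"
  by (induction I rule: infinite_finite_induct) (auto intro: cochain_add cochain_zero)

text \<open>
  The values of a cochain on tensors of homogeneous elements.  They determine the cochain
  (\<open>cochain_eqI\<close>), so identities between operators on cochains can be checked on words.
\<close>

definition word_fun :: "nat \<Rightarrow> nat \<Rightarrow> ('k, 'a) cochain \<Rightarrow> 'a word \<Rightarrow> 'k" where
  "word_fun n m f = (\<lambda>w. if w \<in> words (Suc n) m then f (word_tensor w) else 0)"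

lemma additive_word_fun: "additive (word_fun n m)"
  by standard (auto simp: word_fun_def fun_eq_iff)

lemma word_tensor_add:
  assumes "u @ (d, x) # v \<in> words n m" "y \<in> gr d"
  shows "word_tensor (u @ (d, x \<oplus> y) # v) = word_tensor (u @ (d, x) # v) \<oplus>\<^bsub>tensor_part A gr n m\<^esub> word_tensor (u @ (d, y) # v)"
  using pure_tensor_add[OF A_vectorspace, of "map snd u" "map snd v" x y n] assms words_carrier[OF assms(1)]
    gr_closed[OF assms(2)]
  by (simp add: tensor_part_eq words_iff)

lemma word_tensor_smult:
  assumes "u @ (d, x) # v \<in> words n m"
  shows "word_tensor (u @ (d, c \<odot>\<^bsub>A\<^esub> x) # v) = c \<odot>\<^bsub>tensor_part A gr n m\<^esub> word_tensor (u @ (d, x) # v)"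
  using pure_tensor_smult[OF A_vectorspace, of "map snd u" "map snd v" x n] assms words_carrier[OF assms(1)]
  by (simp add: tensor_part_eq words_iff)

lemma word_fun_forms:
  assumes "f \<in> cochain_space n m" shows "word_fun n m f \<in> forms n m"
  unfolding forms_iff
proof (intro conjI allI impI; (elim conjE)?)
  show "word_fun n m f \<in> supported n m" by (simp add: supported_def word_fun_def)
next
  fix u d x y v assume w: "u @ (d, x) # v \<in> words (Suc n) m" and y: "y \<in> gr d"
  have x: "x \<in> gr d" using w by (simp add: words_iff)
  show "word_fun n m f (u @ (d, x \<oplus> y) # v) = word_fun n m f (u @ (d, x) # v) + word_fun n m f (u @ (d, y) # v)"
    using words_change[OF w gr_add[OF x y]] words_change[OF w y] w word_tensor_add[OF w y]
      linear_mapD(4)[OF cochain_linear[OF assms] word_tensor_tensor_part[OF w] word_tensor_tensor_part[OF words_change[OF w y]]]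
    by (simp add: word_fun_def field_vs_def)
next
  fix u d x c v assume w: "u @ (d, x) # v \<in> words (Suc n) m"
  have x: "x \<in> gr d" using w by (simp add: words_iff)
  show "word_fun n m f (u @ (d, c \<odot>\<^bsub>A\<^esub> x) # v) = c * word_fun n m f (u @ (d, x) # v)"
    using words_change[OF w gr_smult[OF x]] w word_tensor_smult[OF w]
      linear_mapD(5)[OF cochain_linear[OF assms] word_tensor_tensor_part[OF w]]
    by (simp add: word_fun_def field_vs_def)
qed

lemma cochain_eqI:
  assumes f: "f \<in> cochain_space n m" and g: "g \<in> cochain_space n m"
    and eq: "word_fun n m f = word_fun n m g"
  shows "f = g"
proof
  fix v
  show "f v = g v"
  proof (cases "v \<in> carrier (tensor_part A gr (Suc n) m)")
    case True
    show ?thesis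
    proof (rule linear_maps_eq_on_tensor_part[OF cochain_linear[OF f] cochain_linear[OF g] _ True])
      fix w assume "w \<in> words (Suc n) m"
      then show "f (word_tensor w) = g (word_tensor w)" using fun_cong[OF eq, of w] by (simp add: word_fun_def)
    qed
  next
    case False
    then show ?thesis
      using f g by (simp add: cochains_carrier lin_functional_iff[OF vectorspace_tensor_part])
  qed
qed

text \<open>
  Together with \<open>word_fun_forms\<close> and \<open>cochain_eqI\<close> this makes \<open>word_fun\<close> a bijection from cochains onto
  forms, with \<open>tensor_lift\<close> as its inverse.
\<close>

lemma tensor_lift_cochain:
  assumes G: "G \<in> forms n m" and h: "\<And>w. w \<in> words (Suc n) m \<Longrightarrow> h (map fst w) (map snd w) = G w"
  shows "tensor_lift A gr (n + 1) m field_vs h \<in> cochain_space n m"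
    and "word_fun n m (tensor_lift A gr (n + 1) m field_vs h) = G"
proof -
  have g: "multilinear (Suc n) m field_vs G" using G by (simp add: forms_def)
  show "tensor_lift A gr (n + 1) m field_vs h \<in> cochain_space n m"
    using tensor_lift(1)[OF vectorspace_field_vs g h] by (simp add: cochains_carrier)
  show "word_fun n m (tensor_lift A gr (n + 1) m field_vs h) = G"
    using tensor_lift(2)[OF vectorspace_field_vs g h] forms_supported[OF G]
    by (auto simp: word_fun_def supported_def fun_eq_iff)
qed

lemma op_tau:
  assumes "f \<in> cochain_space n m"
  shows "op_tau A gr n m f \<in> cochain_space n m"
    and "word_fun n m (op_tau A gr n m f) = rot n m (word_fun n m f)"
proof -
  have "(- 1) ^ (n + koszul (map fst w)) * f (pure_tensor A (last (map snd w) # butlast (map snd w)))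
      = rot n m (word_fun n m f) w" if w: "w \<in> words (Suc n) m" for w
  proof -
    obtain u x where u: "w = u @ [x]" using word_snoc[OF w] by blast
    then have "x # u \<in> words (Suc n) m" using w words_rotate[of u "[x]"] by simp
    then show ?thesis using w u by (simp add: rot_def word_fun_def)
  qed
  from tensor_lift_cochain[OF forms_rot[OF word_fun_forms[OF assms]], of "\<lambda>ds as.
      (- 1) ^ (n + koszul ds) * f (pure_tensor A (last as # butlast as))", OF this]
  show "op_tau A gr n m f \<in> cochain_space n m"
    and "word_fun n m (op_tau A gr n m f) = rot n m (word_fun n m f)"
    by (simp_all add: op_tau_def)
qed

lemma op_s:
  assumes "f \<in> cochain_space (Suc n) m"
  shows "op_s A gr n m f \<in> cochain_space n m"
    and "word_fun n m (op_s A gr n m f) = sword n m (word_fun (Suc n) m f)"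
proof -
  have "(- 1) ^ n * f (pure_tensor A (map snd w @ [\<one>])) = sword n m (word_fun (Suc n) m f) w"
    if w: "w \<in> words (Suc n) m" for w
    using words_append_one[OF w] w by (simp add: sword_def word_fun_def)
  from tensor_lift_cochain[OF forms_sword[OF word_fun_forms[OF assms]], of "\<lambda>ds as.
      (- 1) ^ n * f (pure_tensor A (as @ [\<one>]))", OF this]
  show "op_s A gr n m f \<in> cochain_space n m"
    and "word_fun n m (op_s A gr n m f) = sword n m (word_fun (Suc n) m f)"
    by (simp_all add: op_s_def)
qed

lemma op_b:
  assumes "f \<in> cochain_space n m"
  shows "op_b A gr (Suc n) m f \<in> cochain_space (Suc n) m"
    and "word_fun (Suc n) m (op_b A gr (Suc n) m f) = bword n m (word_fun n m f)"
proof -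
  let ?h = "\<lambda>ds as. (\<Sum>i<Suc n. (- 1) ^ i *
                 f (pure_tensor A (take i as @ (as ! i \<otimes> as ! (i + 1)) # drop (i + 2) as)))
            + (- 1) ^ (Suc n + koszul ds) *
                 f (pure_tensor A ((as ! Suc n \<otimes> as ! 0) # butlast (tl as)))"
  have "?h (map fst w) (map snd w) = bword n m (word_fun n m f) w" if w: "w \<in> words (Suc (Suc n)) m" for w
  proof -
    have len: "length w = Suc (Suc n)" using w by (simp add: words_iff)
    have plain: "(- 1) ^ i * f (pure_tensor A (take i (map snd w) @
          (map snd w ! i \<otimes> map snd w ! (i + 1)) # drop (i + 2) (map snd w)))
        = coface n m i (word_fun n m f) w" if "i \<le> n" for i
      using that len w face_words[OF w, of i] face_eq[of i w]
      by (simp add: coface_def plain_coface_def word_fun_def take_map drop_map)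
    obtain u z where wz: "w = u @ [z]" using word_snoc[OF w] by blast
    then obtain x v where u: "u = x # v" using len by (cases u) auto
    have lv: "length v = n" using len wz u by simp
    have zu: "z # x # v \<in> words (Suc (Suc n)) m" using w words_rotate[of u "[z]"] wz u by simp
    have wrap: "(- 1) ^ (Suc n + koszul (map fst w)) *
          f (pure_tensor A ((map snd w ! Suc n \<otimes> map snd w ! 0) # butlast (tl (map snd w))))
        = coface n m (Suc n) (word_fun n m f) w"
      using w zu face_words[OF zu, of 0] lv
      by (simp add: coface_def rot_def plain_coface_def word_fun_def wz u nth_append)
    have "(\<Sum>i<Suc n. (- 1) ^ i * f (pure_tensor A (take i (map snd w) @
          (map snd w ! i \<otimes> map snd w ! (i + 1)) # drop (i + 2) (map snd w))))
        = (\<Sum>i\<le>n. coface n m i (word_fun n m f) w)"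
      unfolding lessThan_Suc_atMost by (rule sum.cong[OF refl plain]) simp
    with wrap show ?thesis
      by (simp only: bword_def sum.atMost_Suc plus_fun_apply sum_fun_apply)
  qed
  from tensor_lift_cochain[OF forms_bword[OF word_fun_forms[OF assms]], of ?h, OF this]
  show "op_b A gr (Suc n) m f \<in> cochain_space (Suc n) m"
    and "word_fun (Suc n) m (op_b A gr (Suc n) m f) = bword n m (word_fun n m f)"
    by (simp_all only: op_b_def)
qed

lemma op_tau_funpow:
  assumes "f \<in> cochain_space n m"
  shows "(op_tau A gr n m ^^ i) f \<in> cochain_space n m"
    and "word_fun n m ((op_tau A gr n m ^^ i) f) = (rot n m ^^ i) (word_fun n m f)"
  using assms by (induction i) (simp_all add: op_tau)

lemma word_fun_sum: "word_fun n m (\<lambda>v. \<Sum>i\<in>I. f i v) = (\<Sum>i\<in>I. word_fun n m (f i))"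
  by (auto simp: word_fun_def fun_eq_iff sum_fun_apply)

lemma op_N:
  assumes "f \<in> cochain_space n m"
  shows "op_N A gr n m f \<in> cochain_space n m"
    and "word_fun n m (op_N A gr n m f) = norm_word n m (word_fun n m f)"
  unfolding op_N_def norm_word_def
  using assms by (auto intro: cochain_sum simp: op_tau_funpow word_fun_sum)

lemma op_B:
  assumes "f \<in> cochain_space (Suc n) m"
  shows "op_B A gr (Suc n) m f \<in> cochain_space n m"
    and "word_fun n m (op_B A gr (Suc n) m f) = Bword n m (word_fun (Suc n) m f)"
proof -
  let ?g = "\<lambda>v. f v - op_tau A gr (Suc n) m f v"
  have g: "?g \<in> cochain_space (Suc n) m"
    using assms by (intro cochain_diff op_tau)
  have "word_fun (Suc n) m ?g = word_fun (Suc n) m f - rot (Suc n) m (word_fun (Suc n) m f)"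
    unfolding op_tau(2)[OF assms, symmetric] by (auto simp: word_fun_def fun_eq_iff)
  then show "op_B A gr (Suc n) m f \<in> cochain_space n m"
    and "word_fun n m (op_B A gr (Suc n) m f) = Bword n m (word_fun (Suc n) m f)"
    using g by (simp_all add: op_B_def Bword_def op_N op_s)
qed

lemma phi_sum_eq:
  "phi_sum G w = (\<Sum>i<length w. (- 1) ^ sum_list (take i (map fst w)) *
     (if fst (w ! i) = 0 then 0 else G (w[i := (fst (w ! i) - 1, \<phi> (snd (w ! i)))])))"
proof (induction w arbitrary: G)
  case (Cons x w)
  obtain d a where x: "x = (d, a)" by force
  show ?case
    unfolding x phi_sum.simps Cons.IH length_Cons sum.lessThan_Suc_shift
    by (simp add: sum_distrib_left power_add mult_ac cong: if_cong)
qed simp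

lemma update_slot:
  assumes "i < length us + 1 + length ws" "set us \<union> set ws \<subseteq> carrier A"
  shows "\<exists>us' ws' f. (\<forall>z. (us @ z # ws)[i := \<phi> ((us @ z # ws) ! i)] = us' @ f z # ws') \<and>
    (f = (\<lambda>z. z) \<or> f = \<phi>) \<and> set us' \<union> set ws' \<subseteq> carrier A \<and>
    length us' + 1 + length ws' = length us + 1 + length ws"
proof -
  have upd: "set (xs[j := \<phi> (xs ! j)]) \<subseteq> carrier A" if "set xs \<subseteq> carrier A" for xs j
    using that phi_carrier set_update_subset_insert[of xs j "\<phi> (xs ! j)"]
    by (cases "j < length xs") (auto dest: nth_mem simp: list_update_beyond)
  consider "i < length us" | "i = length us" | "i > length us" by linarith
  then show ?thesis
  proof cases
    case 1
    with assms upd show ?thesis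
      by (intro exI[of _ "us[i := \<phi> (us ! i)]"] exI[of _ ws] exI[of _ "\<lambda>z. z"])
        (simp add: list_update_append nth_append)
  next
    case 2
    with assms show ?thesis
      by (intro exI[of _ us] exI[of _ ws] exI[of _ \<phi>]) simp
  next
    case 3
    define j where "j = i - Suc (length us)"
    have "i = length us + Suc j" using 3 by (simp add: j_def)
    with assms upd show ?thesis
      by (intro exI[of _ us] exI[of _ "ws[j := \<phi> (ws ! j)]"] exI[of _ "\<lambda>z. z"])
        (simp add: list_update_append nth_append)
  qed
qed

lemma pure_tensor_zero:
  assumes "set us \<union> set ws \<subseteq> carrier A" "length us + 1 + length ws = n"
  shows "pure_tensor A (us @ \<zero> # ws) = \<zero>\<^bsub>tensor_power A n\<^esub>"
proof -
  have "pure_tensor A (us @ (0 \<odot>\<^bsub>A\<^esub> \<zero>) # ws) = 0 \<odot>\<^bsub>tensor_power A n\<^esub> pure_tensor A (us @ \<zero> # ws)"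
    using assms by (intro pure_tensor_smult[OF A_vectorspace]) auto
  also have "\<dots> = \<zero>\<^bsub>tensor_power A n\<^esub>"
    using assms
    by (intro class_smult_0[OF vectorspace_tensor_power[OF A_vectorspace]] pure_tensor_closed[OF A_vectorspace]) auto
  finally show ?thesis by (simp add: smult_0)
qed

text \<open>
  Applying \<open>\<phi>\<close> to a letter of degree \<open>0\<close> gives a zero factor, hence the zero tensor, which lies in every
  degree; otherwise the total degree drops by one.
\<close>

lemma update_word:
  assumes w: "w \<in> words n (Suc m)" and i: "i < n"
  shows "fst (w ! i) \<noteq> 0 \<Longrightarrow> w[i := (fst (w ! i) - 1, \<phi> (snd (w ! i)))] \<in> words n m"
    and "fst (w ! i) = 0 \<Longrightarrow>
      pure_tensor A ((map snd w)[i := \<phi> (map snd w ! i)]) = \<zero>\<^bsub>tensor_part A gr n m\<^esub>"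
    and "pure_tensor A ((map snd w)[i := \<phi> (map snd w ! i)]) \<in> carrier (tensor_part A gr n m)"
proof -
  have len: "length w = n" using w by (simp add: words_iff)
  obtain u x v where x: "w = u @ x # v" "length u = i"
    using id_take_nth_drop[of i w] len i by (metis length_take min.absorb4)
  have gx: "snd x \<in> gr (fst x)" using w x by (auto simp: words_iff)
  show 1: "fst (w ! i) \<noteq> 0 \<Longrightarrow> w[i := (fst (w ! i) - 1, \<phi> (snd (w ! i)))] \<in> words n m"
    using w x gx phi_closed[of "snd x" "fst x"] by (simp add: words_iff ball_Un split_beta list_update_append nth_append)
  show 2: "fst (w ! i) = 0 \<Longrightarrow>
      pure_tensor A ((map snd w)[i := \<phi> (map snd w ! i)]) = \<zero>\<^bsub>tensor_part A gr n m\<^esub>"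
  proof -
    assume "fst (w ! i) = 0"
    then have "\<phi> (map snd w ! i) = \<zero>" using gx x diff_0 by (simp add: nth_append)
    moreover have "(map snd w)[i := z] = map snd u @ z # map snd v" for z
      using x by (simp add: list_update_append)
    ultimately show ?thesis
      using pure_tensor_zero[of "map snd u" "map snd v" n] words_carrier[OF w] x len
      by (simp add: tensor_part_eq)
  qed
  show "pure_tensor A ((map snd w)[i := \<phi> (map snd w ! i)]) \<in> carrier (tensor_part A gr n m)"
  proof (cases "fst (w ! i) = 0")
    case True
    interpret P: vectorspace class_ring "tensor_part A gr n m" by (rule vectorspace_tensor_part)
    show ?thesis using 2[OF True] by simp
  next
    case False
    from word_tensor_tensor_part[OF 1[OF this]] show ?thesis using i len by (simp add: map_update)
  qed
qed

text \<open>
  Each summand of the prescribed value applies \<open>\<phi>\<close> to one fixed factor and is therefore multilinear,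
  so \<open>tensor_lift\<close> applies.
\<close>

lemma tensor_diff:
  shows "tensor_diff A gr \<phi> n m \<in> lin_maps (tensor_part A gr n (Suc m)) (tensor_part A gr n m)"
    and "w \<in> words n (Suc m) \<Longrightarrow> tensor_diff A gr \<phi> n m (word_tensor w) =
      (\<Oplus>\<^bsub>tensor_part A gr n m\<^esub>i\<in>{..<n}. (- 1) ^ sum_list (take i (map fst w)) \<odot>\<^bsub>tensor_part A gr n m\<^esub>
         pure_tensor A ((map snd w)[i := \<phi> (map snd w ! i)]))"
proof -
  let ?P = "tensor_part A gr n m"
  interpret P: vectorspace class_ring ?P by (rule vectorspace_tensor_part)
  define t where "t w i = (- 1) ^ sum_list (take i (map fst w)) \<odot>\<^bsub>?P\<^esub>
         pure_tensor A ((map snd w)[i := \<phi> (map snd w ! i)])" for w :: "'a word" and i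
  have closed: "t w i \<in> carrier ?P" if "w \<in> words n (Suc m)" "i < n" for w i
    unfolding t_def using update_word(3)[OF that] by (intro P.smult_closed) auto
  have P_add: "x \<oplus>\<^bsub>?P\<^esub> y = x \<oplus>\<^bsub>tensor_power A n\<^esub> y" "c \<odot>\<^bsub>?P\<^esub> x = c \<odot>\<^bsub>tensor_power A n\<^esub> x" for x y c
    by (simp_all add: tensor_part_eq)
  have slot: "\<exists>us' ws' f. (\<forall>z. (map snd u @ z # map snd v)[i := \<phi> ((map snd u @ z # map snd v) ! i)] = us' @ f z # ws') \<and>
    (f = (\<lambda>z. z) \<or> f = \<phi>) \<and> set us' \<union> set ws' \<subseteq> carrier A \<and> length us' + 1 + length ws' = n"
    if "u @ (d, x) # v \<in> words n (Suc m)" "i < n" for u d x v i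
  proof -
    have "length u + 1 + length v = n" using that by (simp add: words_iff)
    from update_slot[of i "map snd u" "map snd v", unfolded length_map this]
    show ?thesis using that(2) words_carrier[OF that(1)] by simp
  qed
  have mult: "multilinear n (Suc m) ?P (\<lambda>w. \<Oplus>\<^bsub>?P\<^esub>i\<in>{..<n}. t w i)"
    unfolding multilinear_def
  proof (intro conjI ballI allI impI; (elim conjE)?)
    show "(\<Oplus>\<^bsub>?P\<^esub>i\<in>{..<n}. t w i) \<in> carrier ?P" if "w \<in> words n (Suc m)" for w
      using closed[OF that] by (intro P.M.finsum_closed) auto
  next
    fix u d x y v assume w: "u @ (d, x) # v \<in> words n (Suc m)" and y: "y \<in> gr d"
    have x: "x \<in> gr d" using w by (simp add: words_iff)
    note wy = words_change[OF w y] and wxy = words_change[OF w gr_add[OF x y]]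
    have "t (u @ (d, x \<oplus> y) # v) i = t (u @ (d, x) # v) i \<oplus>\<^bsub>?P\<^esub> t (u @ (d, y) # v) i" if i: "i < n" for i
    proof -
      obtain us' ws' f where f: "\<forall>z. (map snd u @ z # map snd v)[i := \<phi> ((map snd u @ z # map snd v) ! i)] = us' @ f z # ws'"
        "f = (\<lambda>z. z) \<or> f = \<phi>" "set us' \<union> set ws' \<subseteq> carrier A" "length us' + 1 + length ws' = n"
        using slot[OF w i] by (elim exE conjE)
      have "f (x \<oplus> y) = f x \<oplus> f y" "f x \<in> carrier A" "f y \<in> carrier A"
        using f(2) x y gr_closed phi_add phi_carrier by auto
      then have "pure_tensor A (us' @ f (x \<oplus> y) # ws')
          = pure_tensor A (us' @ f x # ws') \<oplus>\<^bsub>?P\<^esub> pure_tensor A (us' @ f y # ws')"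
        using f(3,4) unfolding P_add by (simp add: pure_tensor_add[OF A_vectorspace])
      moreover have "pure_tensor A (us' @ f x # ws') \<in> carrier ?P" "pure_tensor A (us' @ f y # ws') \<in> carrier ?P"
        using update_word(3)[OF w i] update_word(3)[OF wy i] f(1) by simp_all
      ultimately show ?thesis
        unfolding t_def using f(1) by (simp add: P.smult_r_distr)
    qed
    then have "(\<Oplus>\<^bsub>?P\<^esub>i\<in>{..<n}. t (u @ (d, x \<oplus> y) # v) i)
        = (\<Oplus>\<^bsub>?P\<^esub>i\<in>{..<n}. t (u @ (d, x) # v) i \<oplus>\<^bsub>?P\<^esub> t (u @ (d, y) # v) i)"
      using closed[OF w] closed[OF wy] by (intro P.M.finsum_cong') auto
    also have "\<dots> = (\<Oplus>\<^bsub>?P\<^esub>i\<in>{..<n}. t (u @ (d, x) # v) i) \<oplus>\<^bsub>?P\<^esub> (\<Oplus>\<^bsub>?P\<^esub>i\<in>{..<n}. t (u @ (d, y) # v) i)"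
      using closed[OF w] closed[OF wy] by (intro P.M.finsum_addf) auto
    finally show "(\<Oplus>\<^bsub>?P\<^esub>i\<in>{..<n}. t (u @ (d, x \<oplus> y) # v) i)
        = (\<Oplus>\<^bsub>?P\<^esub>i\<in>{..<n}. t (u @ (d, x) # v) i) \<oplus>\<^bsub>?P\<^esub> (\<Oplus>\<^bsub>?P\<^esub>i\<in>{..<n}. t (u @ (d, y) # v) i)" .
  next
    fix u d x c v assume w: "u @ (d, x) # v \<in> words n (Suc m)"
    have x: "x \<in> gr d" using w by (simp add: words_iff)
    have "t (u @ (d, c \<odot>\<^bsub>A\<^esub> x) # v) i = c \<odot>\<^bsub>?P\<^esub> t (u @ (d, x) # v) i" if i: "i < n" for i
    proof -
      obtain us' ws' f where f: "\<forall>z. (map snd u @ z # map snd v)[i := \<phi> ((map snd u @ z # map snd v) ! i)] = us' @ f z # ws'"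
        "f = (\<lambda>z. z) \<or> f = \<phi>" "set us' \<union> set ws' \<subseteq> carrier A" "length us' + 1 + length ws' = n"
        using slot[OF w i] by (elim exE conjE)
      have "f (c \<odot>\<^bsub>A\<^esub> x) = c \<odot>\<^bsub>A\<^esub> f x" "f x \<in> carrier A"
        using f(2) x gr_closed phi_smult phi_carrier by auto
      then have "pure_tensor A (us' @ f (c \<odot>\<^bsub>A\<^esub> x) # ws') = c \<odot>\<^bsub>?P\<^esub> pure_tensor A (us' @ f x # ws')"
        using f(3,4) unfolding P_add by (simp add: pure_tensor_smult[OF A_vectorspace])
      moreover have "pure_tensor A (us' @ f x # ws') \<in> carrier ?P"
        using update_word(3)[OF w i] f(1) by simp
      moreover have "a \<odot>\<^bsub>?P\<^esub> (c \<odot>\<^bsub>?P\<^esub> q) = c \<odot>\<^bsub>?P\<^esub> (a \<odot>\<^bsub>?P\<^esub> q)" if "q \<in> carrier ?P" for a q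
        using P.smult_assoc1[of a c q] P.smult_assoc1[of c a q] that by (simp add: mult.commute)
      ultimately show ?thesis
        unfolding t_def using f(1) by simp
    qed
    then have "(\<Oplus>\<^bsub>?P\<^esub>i\<in>{..<n}. t (u @ (d, c \<odot>\<^bsub>A\<^esub> x) # v) i) = (\<Oplus>\<^bsub>?P\<^esub>i\<in>{..<n}. c \<odot>\<^bsub>?P\<^esub> t (u @ (d, x) # v) i)"
      using closed[OF w] by (intro P.M.finsum_cong') auto
    also have "\<dots> = c \<odot>\<^bsub>?P\<^esub> (\<Oplus>\<^bsub>?P\<^esub>i\<in>{..<n}. t (u @ (d, x) # v) i)"
      using closed[OF w] by (subst P.finsum_smult) auto
    finally show "(\<Oplus>\<^bsub>?P\<^esub>i\<in>{..<n}. t (u @ (d, c \<odot>\<^bsub>A\<^esub> x) # v) i) = c \<odot>\<^bsub>?P\<^esub> (\<Oplus>\<^bsub>?P\<^esub>i\<in>{..<n}. t (u @ (d, x) # v) i)" .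
  qed
  note lift = tensor_lift[OF vectorspace_tensor_part mult, of "\<lambda>ds as. \<Oplus>\<^bsub>?P\<^esub>i\<in>{..<n}.
        (- 1) ^ sum_list (take i ds) \<odot>\<^bsub>?P\<^esub> pure_tensor A (as[i := \<phi> (as ! i)])"]
  show "tensor_diff A gr \<phi> n m \<in> lin_maps (tensor_part A gr n (Suc m)) ?P"
    unfolding tensor_diff_def by (rule lift(1)) (simp add: t_def)
  show "w \<in> words n (Suc m) \<Longrightarrow> tensor_diff A gr \<phi> n m (word_tensor w) =
      (\<Oplus>\<^bsub>?P\<^esub>i\<in>{..<n}. (- 1) ^ sum_list (take i (map fst w)) \<odot>\<^bsub>?P\<^esub>
         pure_tensor A ((map snd w)[i := \<phi> (map snd w ! i)]))"
    unfolding tensor_diff_def using lift(2)[of w] by (simp add: t_def)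
qed

lemma op_delta:
  assumes f: "f \<in> cochain_space n m"
  shows "op_delta A gr \<phi> n m f \<in> cochain_space n (Suc m)"
    and "word_fun n (Suc m) (op_delta A gr \<phi> n m f) = (\<lambda>w. (- 1) ^ m * dphi n m (word_fun n m f) w)"
proof -
  let ?P = "tensor_part A gr (Suc n) m" and ?P' = "tensor_part A gr (Suc n) (Suc m)"
  let ?T = "tensor_diff A gr \<phi> (Suc n) m"
  interpret P: vectorspace class_ring ?P by (rule vectorspace_tensor_part)
  note f_lin = cochain_linear[OF f]
  have T: "linear_map class_ring ?P' ?P ?T" "\<And>v. v \<notin> carrier ?P' \<Longrightarrow> ?T v = \<zero>\<^bsub>?P\<^esub>"
    using tensor_diff(1)[of "Suc n" m] unfolding lin_maps_iff[OF vectorspace_tensor_part vectorspace_tensor_part]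
    by auto
  have f_zero: "f \<zero>\<^bsub>?P\<^esub> = 0" using linear_mapD(6)[OF f_lin] by (simp add: field_vs_def)
  have f_add: "f (u \<oplus>\<^bsub>?P\<^esub> v) = f u + f v" if "u \<in> carrier ?P" "v \<in> carrier ?P" for u v
    using linear_mapD(4)[OF f_lin that] by (simp add: field_vs_def)
  have f_smult: "f (c \<odot>\<^bsub>?P\<^esub> u) = c * f u" if "u \<in> carrier ?P" for u c
    using linear_mapD(5)[OF f_lin that] by (simp add: field_vs_def)
  have "(\<lambda>v. f (?T v)) \<in> cochain_space n (Suc m)"
    unfolding cochains_carrier lin_functional_iff[OF vectorspace_tensor_part]
    using T(2) by (auto simp: linear_mapD[OF T(1)] f_add f_smult f_zero)
  then show "op_delta A gr \<phi> n m f \<in> cochain_space n (Suc m)"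
    unfolding op_delta_def by (intro cochain_scale) simp
  show "word_fun n (Suc m) (op_delta A gr \<phi> n m f) = (\<lambda>w. (- 1) ^ m * dphi n m (word_fun n m f) w)"
  proof
    fix w
    show "word_fun n (Suc m) (op_delta A gr \<phi> n m f) w = (- 1) ^ m * dphi n m (word_fun n m f) w"
    proof (cases "w \<in> words (Suc n) (Suc m)")
      case w: True
      have len: "length w = Suc n" using w by (simp add: words_iff)
      let ?p = "\<lambda>i. pure_tensor A ((map snd w)[i := \<phi> (map snd w ! i)])"
      have p: "?p i \<in> carrier ?P" if "i < Suc n" for i using update_word(3)[OF w that] .
      have "f (?T (word_tensor w)) = (\<Sum>i<Suc n. f ((- 1) ^ sum_list (take i (map fst w)) \<odot>\<^bsub>?P\<^esub> ?p i))"
        unfolding tensor_diff(2)[OF w]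
        by (rule linear_functional_finsum[OF f_lin]) (use p in \<open>auto intro: P.smult_closed\<close>)
      also have "\<dots> = (\<Sum>i<Suc n. (- 1) ^ sum_list (take i (map fst w)) *
          (if fst (w ! i) = 0 then 0 else word_fun n m f (w[i := (fst (w ! i) - 1, \<phi> (snd (w ! i)))])))"
      proof (rule sum.cong[OF refl])
        fix i assume "i \<in> {..<Suc n}"
        then have i: "i < Suc n" by simp
        have "f (?p i) = (if fst (w ! i) = 0 then 0 else word_fun n m f (w[i := (fst (w ! i) - 1, \<phi> (snd (w ! i)))]))"
          using update_word(1,2)[OF w i] i len by (simp add: f_zero word_fun_def map_update)
        then show "f ((- 1) ^ sum_list (take i (map fst w)) \<odot>\<^bsub>?P\<^esub> ?p i) = (- 1) ^ sum_list (take i (map fst w)) *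
          (if fst (w ! i) = 0 then 0 else word_fun n m f (w[i := (fst (w ! i) - 1, \<phi> (snd (w ! i)))]))"
          using p[OF i] by (simp add: f_smult)
      qed
      also have "\<dots> = phi_sum (word_fun n m f) w" by (simp only: phi_sum_eq len)
      finally show ?thesis using w by (simp add: word_fun_def dphi_def op_delta_def)
    qed (simp add: word_fun_def dphi_def)
  qed
qed

end

section \<open>The differentials of the tricomplex\<close>

definition fun_scale :: "'k::field \<Rightarrow> ('i \<Rightarrow> 's \<Rightarrow> 'k) \<Rightarrow> 'i \<Rightarrow> 's \<Rightarrow> 'k" where
  "fun_scale c x = (\<lambda>i v. c * x i v)"

lemma vector_space_fun_scale: "vector_space fun_scale"
  by unfold_locales (auto simp: fun_scale_def fun_eq_iff algebra_simps)

text \<open>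
  If all but finitely many summands are zero, finite support is automatic, and the direct sum is a space
  of functions with pointwise operations.
\<close>

lemma presents_direct_sum:
  fixes V :: "'i \<Rightarrow> ('k::field, 's \<Rightarrow> 'k) module"
  assumes zero: "\<And>i. \<zero>\<^bsub>V i\<^esub> = 0" and zero_mem: "\<And>i. 0 \<in> carrier (V i)"
    and add: "\<And>i f g. f \<in> carrier (V i) \<Longrightarrow> g \<in> carrier (V i) \<Longrightarrow> f \<oplus>\<^bsub>V i\<^esub> g = f + g \<and> f + g \<in> carrier (V i)"
    and smult: "\<And>i c f. f \<in> carrier (V i) \<Longrightarrow> c \<odot>\<^bsub>V i\<^esub> f = (\<lambda>v. c * f v) \<and> (\<lambda>v. c * f v) \<in> carrier (V i)"
    and J: "finite J" "\<And>i. i \<in> I \<Longrightarrow> i \<notin> J \<Longrightarrow> carrier (V i) = {0}"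
  shows "presents fun_scale {x. \<forall>i. x i \<in> carrier (V i) \<and> (i \<notin> I \<longrightarrow> x i = 0)} {0} (\<lambda>x. x) (direct_sum_vs I V)"
proof -
  interpret vector_space "fun_scale :: 'k \<Rightarrow> ('i \<Rightarrow> 's \<Rightarrow> 'k) \<Rightarrow> _" by (rule vector_space_fun_scale)
  let ?S = "{x. \<forall>i. x i \<in> carrier (V i) \<and> (i \<notin> I \<longrightarrow> x i = 0)}"
  have S: "subspace ?S"
    using zero_mem add smult by (auto intro!: subspaceI simp: fun_scale_def fun_eq_iff zero_fun_def)
  have "finite {i \<in> I. x i \<noteq> 0}" if "x \<in> ?S" for x
    using J that by (intro finite_subset[OF _ J(1)]) auto
  then have "carrier (direct_sum_vs I V) = ?S"
    using zero_mem by (auto simp: direct_sum_vs_def zero)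
  with S show ?thesis
    using add smult zero zero_mem
    by (auto simp: presents_def vector_space_fun_scale direct_sum_vs_def fun_scale_def fun_eq_iff)
qed

context dga
begin

lemma bword_scale: "bword n m (\<lambda>w. c * G w) = (\<lambda>w. c * bword n m G w)"
proof -
  have "coface n m i (\<lambda>w. c * G w) = (\<lambda>w. c * coface n m i G w)" for i
    by (auto simp: coface_def plain_coface_def rot_def fun_eq_iff)
  then show ?thesis by (auto simp: bword_def sum_fun_apply sum_distrib_left distrib_left fun_eq_iff)
qed

lemma Bword_scale: "Bword n m (\<lambda>w. c * G w) = (\<lambda>w. c * Bword n m G w)"
proof -
  have rot: "rot n m (\<lambda>w. c * G w) = (\<lambda>w. c * rot n m G w)" for n G
    by (auto simp: rot_def fun_eq_iff)
  have "(rot n m ^^ i) (\<lambda>w. c * G w) = (\<lambda>w. c * (rot n m ^^ i) G w)" for n G i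
    by (induction i) (simp_all add: rot)
  then have norm: "norm_word n m (\<lambda>w. c * G w) = (\<lambda>w. c * norm_word n m G w)" for n G
    by (auto simp: norm_word_def sum_fun_apply sum_distrib_left fun_eq_iff)
  have s: "sword n m (\<lambda>w. c * G w) = (\<lambda>w. c * sword n m G w)" for n G
    by (auto simp: sword_def fun_eq_iff)
  have diff: "(\<lambda>w. c * G w) - rot (Suc n) m (\<lambda>w. c * G w) = (\<lambda>w. c * (G - rot (Suc n) m G) w)"
    by (simp add: rot fun_eq_iff algebra_simps)
  show ?thesis by (simp only: Bword_def diff s norm)
qed

lemma word_fun_scale: "word_fun n m (\<lambda>v. c * f v) = (\<lambda>w. c * word_fun n m f w)"
  by (auto simp: word_fun_def)

lemma additive_Bword: "additive (Bword n m)"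
  by standard (simp add: Bword_def additive.add[OF additive_rot] additive.add[OF additive_sword]
      additive.add[OF additive_norm_word] add_diff_add)

abbreviation cell :: "int \<Rightarrow> int \<Rightarrow> int \<Rightarrow> ('k, 'a) cochain set" where
  "cell p q r \<equiv> carrier (EC A gr p q r)"

lemma cell_cases:
  assumes "f \<in> cell p q r"
  obtains (zero) "\<not> (0 \<le> p \<and> p \<le> q \<and> 0 \<le> r)" "f = 0"
    | (cochain) n m where "0 \<le> p" "q = p + int n" "r = int m" "f \<in> cochain_space n m"
proof (cases "0 \<le> p \<and> p \<le> q \<and> 0 \<le> r")
  case True
  then show thesis
    using assms cochain[of "nat (q - p)" "nat r"] by (simp add: EC_def)
next
  case False
  then show thesis using assms zero by (auto simp: EC_def zero_vs_def zero_fun_def)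
qed

lemma cell_cochains: "0 \<le> p \<Longrightarrow> cell p (p + int n) (int m) = cochain_space n m"
  by (simp add: EC_def)

lemma cell_outside: "\<not> (0 \<le> p \<and> p \<le> q \<and> 0 \<le> r) \<Longrightarrow> cell p q r = {0}"
  by (auto simp: EC_def zero_vs_def zero_fun_def)

lemma cell_zero [simp]: "0 \<in> cell p q r"
  using cochain_zero by (auto simp: EC_def zero_vs_def zero_fun_def)

lemma cell_add: "f \<in> cell p q r \<Longrightarrow> g \<in> cell p q r \<Longrightarrow> f + g \<in> cell p q r"
  and cell_scale: "f \<in> cell p q r \<Longrightarrow> (\<lambda>v. c * f v) \<in> cell p q r"
  using cochain_add cochain_scale by (auto simp: EC_def zero_vs_def plus_fun_def)

lemma EC_zero: "\<zero>\<^bsub>EC A gr p q r\<^esub> = 0"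
  by (auto simp: EC_def zero_vs_def cochains_def hom_vs_def field_vs_def zero_fun_def)

lemma EC_add: "f \<in> cell p q r \<Longrightarrow> g \<in> cell p q r \<Longrightarrow> f \<oplus>\<^bsub>EC A gr p q r\<^esub> g = f + g"
  by (auto simp: EC_def zero_vs_def cochains_def hom_vs_def field_vs_def plus_fun_def split: if_splits)

lemma EC_smult: "f \<in> cell p q r \<Longrightarrow> c \<odot>\<^bsub>EC A gr p q r\<^esub> f = (\<lambda>v. c * f v)"
  by (auto simp: EC_def zero_vs_def cochains_def hom_vs_def field_vs_def split: if_splits)

lemma EC_b_eq: "0 \<le> p \<Longrightarrow> EC_b A gr p (p + int n) (int m) f = op_b A gr (Suc n) m f"
  and EC_B_eq: "0 \<le> p \<Longrightarrow> EC_B A gr p (p + int n) (int m) f = op_B A gr n m f"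
  and EC_delta_eq: "0 \<le> p \<Longrightarrow>
    EC_delta A gr \<phi> p (p + int n) (int m) f = (\<lambda>v. (- 1) ^ n * op_delta A gr \<phi> n m f v)"
  by (simp_all add: EC_b_def EC_B_def EC_delta_def)

lemma EC_outside:
  assumes "\<not> (0 \<le> p \<and> p \<le> q \<and> 0 \<le> r)"
  shows "EC_b A gr p q r f = 0" "EC_B A gr p q r f = 0" "EC_delta A gr \<phi> p q r f = 0"
  using assms by (auto simp: EC_b_def EC_B_def EC_delta_def zero_fun_def)

lemma cochain_zeroI:
  assumes "f \<in> cochain_space n m" "word_fun n m f = 0" shows "f = 0"
  using cochain_eqI[OF assms(1), of 0] assms(2) cochain_zero additive.zero[OF additive_word_fun]
  by (simp add: zero_fun_def)

lemma EC_b_cell: assumes "f \<in> cell p q r" shows "EC_b A gr p q r f \<in> cell p (q + 1) r"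
  using assms
proof (cases rule: cell_cases)
  case (cochain n m)
  then show ?thesis using op_b(1)[of f n m] cell_cochains[of p "Suc n" m] by (simp add: EC_b_eq add_ac)
qed (simp add: EC_outside)

lemma EC_B_cell: assumes "f \<in> cell p q r" shows "EC_B A gr p q r f \<in> cell (p + 1) q r"
  using assms
proof (cases rule: cell_cases)
  case (cochain n m)
  show ?thesis
  proof (cases n)
    case 0
    then show ?thesis using cochain by (simp add: EC_B_def op_B_def flip: zero_fun_def)
  next
    case (Suc k)
    then show ?thesis
      using cochain op_B(1)[of f k m] cell_cochains[of "p + 1" k m]
      by (simp only: EC_B_eq) (simp add: add_ac)
  qed
qed (simp add: EC_outside)

lemma EC_delta_cell: assumes "f \<in> cell p q r" shows "EC_delta A gr \<phi> p q r f \<in> cell p q (r + 1)"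
  using assms
proof (cases rule: cell_cases)
  case (cochain n m)
  then show ?thesis
    using cochain_scale[OF op_delta(1)[of f n m]] cell_cochains[of p n "Suc m"]
    by (simp add: EC_delta_eq add_ac)
qed (simp add: EC_outside)

lemma cochain_plus: "f \<in> cochain_space n m \<Longrightarrow> g \<in> cochain_space n m \<Longrightarrow>
    f + g \<in> cochain_space n m"
  using cochain_add by (simp add: plus_fun_def)

lemma EC_b_add:
  assumes "f \<in> cell p q r" "g \<in> cell p q r"
  shows "EC_b A gr p q r (f + g) = EC_b A gr p q r f + EC_b A gr p q r g"
  using assms(1)
proof (cases rule: cell_cases)
  case (cochain n m)
  then have g: "g \<in> cochain_space n m" using assms(2) by (simp add: cell_cochains)
  have "op_b A gr (Suc n) m (f + g) = op_b A gr (Suc n) m f + op_b A gr (Suc n) m g"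
    using cochain(4) g
    by (intro cochain_eqI[of _ "Suc n" m])
      (simp_all add: op_b cochain_plus additive.add[OF additive_word_fun] additive.add[OF additive_bword])
  then show ?thesis using cochain by (simp add: EC_b_eq)
qed (simp add: EC_outside)

lemma EC_b_scale:
  assumes "f \<in> cell p q r"
  shows "EC_b A gr p q r (\<lambda>v. c * f v) = (\<lambda>v. c * EC_b A gr p q r f v)"
  using assms
proof (cases rule: cell_cases)
  case (cochain n m)
  have "op_b A gr (Suc n) m (\<lambda>v. c * f v) = (\<lambda>v. c * op_b A gr (Suc n) m f v)"
    using cochain(4)
    by (intro cochain_eqI[of _ "Suc n" m]) (simp_all add: op_b cochain_scale word_fun_scale bword_scale)
  then show ?thesis using cochain by (simp add: EC_b_eq)
qed (simp add: EC_outside fun_eq_iff)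

lemma EC_B_add:
  assumes "f \<in> cell p q r" "g \<in> cell p q r"
  shows "EC_B A gr p q r (f + g) = EC_B A gr p q r f + EC_B A gr p q r g"
  using assms(1)
proof (cases rule: cell_cases)
  case (cochain n m)
  then have g: "g \<in> cochain_space n m" using assms(2) by (simp add: cell_cochains)
  have "op_B A gr n m (f + g) = op_B A gr n m f + op_B A gr n m g"
  proof (cases n)
    case (Suc k)
    then show ?thesis using cochain(4) g
      by (intro cochain_eqI[of _ k m])
        (simp_all add: op_B cochain_plus additive.add[OF additive_word_fun] additive.add[OF additive_Bword])
  qed (simp add: op_B_def fun_eq_iff)
  then show ?thesis using cochain by (simp add: EC_B_eq)
qed (simp add: EC_outside)

lemma EC_B_scale:
  assumes "f \<in> cell p q r"
  shows "EC_B A gr p q r (\<lambda>v. c * f v) = (\<lambda>v. c * EC_B A gr p q r f v)"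
  using assms
proof (cases rule: cell_cases)
  case (cochain n m)
  have "op_B A gr n m (\<lambda>v. c * f v) = (\<lambda>v. c * op_B A gr n m f v)"
  proof (cases n)
    case (Suc k)
    then show ?thesis using cochain(4)
      by (intro cochain_eqI[of _ k m]) (simp_all add: op_B cochain_scale word_fun_scale Bword_scale)
  qed (simp add: op_B_def fun_eq_iff)
  then show ?thesis using cochain by (simp add: EC_B_eq)
qed (simp add: EC_outside fun_eq_iff)

lemma EC_delta_add: "EC_delta A gr \<phi> p q r (f + g) = EC_delta A gr \<phi> p q r f + EC_delta A gr \<phi> p q r g"
  by (auto simp: EC_delta_def op_delta_def fun_eq_iff algebra_simps)

lemma EC_delta_scale: "EC_delta A gr \<phi> p q r (\<lambda>v. c * f v) = (\<lambda>v. c * EC_delta A gr \<phi> p q r f v)"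
  by (auto simp: EC_delta_def op_delta_def fun_eq_iff algebra_simps)

lemma EC_0 [simp]:
  "EC_b A gr p q r 0 = 0" "EC_B A gr p q r 0 = 0" "EC_delta A gr \<phi> p q r 0 = 0"
  using EC_b_add[of 0 p q r 0] EC_B_add[of 0 p q r 0] EC_delta_add[of p q r 0 0] by simp_all

lemma EC_b_b: assumes "f \<in> cell p q r" shows "EC_b A gr p (q + 1) r (EC_b A gr p q r f) = 0"
  using assms
proof (cases rule: cell_cases)
  case (cochain n m)
  have "op_b A gr (Suc (Suc n)) m (op_b A gr (Suc n) m f) = 0"
    using cochain(4) by (intro cochain_zeroI[of _ "Suc (Suc n)" m]) (simp_all add: op_b bword_bword)
  then show ?thesis using cochain EC_b_eq[of p "Suc n" m] by (simp add: EC_b_eq add_ac)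
qed (simp add: EC_outside)

lemma EC_B_B: assumes "f \<in> cell p q r" shows "EC_B A gr (p + 1) q r (EC_B A gr p q r f) = 0"
  using assms
proof (cases rule: cell_cases)
  case (cochain n m)
  have "op_B A gr (n - 1) m (op_B A gr n m f) = 0" if "n \<noteq> 0"
  proof (cases "n = 1")
    case True
    then show ?thesis by (simp add: op_B_def zero_fun_def)
  next
    case False
    with that have "n = Suc (Suc (n - 2))" by simp
    then obtain k where n: "n = Suc (Suc k)" ..
    show ?thesis
      using cochain(4) unfolding n
      by (intro cochain_zeroI[of _ k m]) (simp_all add: op_B Bword_Bword)
  qed
  then show ?thesis
    using cochain EC_B_eq[of "p + 1" "n - 1" m]
    by (cases "n = 0") (simp_all add: EC_B_eq EC_outside of_nat_diff)
qed (simp add: EC_outside)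

text \<open>
  On the diagonal \<open>p = q\<close> the operator \<open>B\<close> is zero and its target lies outside the tricomplex; the remaining
  summand \<open>B b\<close> vanishes by the case \<open>n = 0\<close> of \<open>Bword_bword\<close>.
\<close>

lemma EC_b_B:
  assumes "f \<in> cell p q r"
  shows "EC_b A gr (p + 1) q r (EC_B A gr p q r f) + EC_B A gr p (q + 1) r (EC_b A gr p q r f) = 0"
  using assms
proof (cases rule: cell_cases)
  case (cochain n m)
  have supp: "word_fun n m f \<in> supported n m" by (rule forms_supported[OF word_fun_forms[OF cochain(4)]])
  have Bb: "EC_B A gr p (q + 1) r (EC_b A gr p q r f) = op_B A gr (Suc n) m (op_b A gr (Suc n) m f)"
    using cochain EC_B_eq[of p "Suc n" m] by (simp add: EC_b_eq add_ac)
  show ?thesis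
  proof (cases n)
    case 0
    have "op_B A gr (Suc n) m (op_b A gr (Suc n) m f) = 0"
      using cochain(4) 0 Bword_bword[OF supp]
      by (intro cochain_zeroI[of _ n m]) (simp_all add: op_b op_B)
    then show ?thesis using Bb cochain 0 by (simp add: EC_outside)
  next
    case (Suc k)
    have bB: "EC_b A gr (p + 1) q r (EC_B A gr p q r f) = op_b A gr (Suc k) m (op_B A gr (Suc k) m f)"
      using cochain EC_b_eq[of "p + 1" k m] EC_B_eq[of p "Suc k" m] Suc by (simp add: add_ac)
    have "op_b A gr (Suc k) m (op_B A gr (Suc k) m f) + op_B A gr (Suc n) m (op_b A gr (Suc n) m f) = 0"
      using cochain(4) Bword_bword[OF supp] unfolding Suc
      by (intro cochain_zeroI[of _ "Suc k" m])
        (simp_all add: op_b op_B cochain_plus additive.add[OF additive_word_fun] add.commute)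
    then show ?thesis using Bb bB by simp
  qed
qed (simp add: EC_outside)

text \<open>
  The differential \<open>\<delta>\<close> commutes with \<open>b\<close>; the sign \<open>(- 1) ^ (q - p)\<close> turns this into anticommutation,
  because \<open>b\<close> changes the parity of \<open>q - p\<close>.
\<close>

lemma EC_delta_b:
  assumes "f \<in> cell p q r"
  shows "EC_delta A gr \<phi> p (q + 1) r (EC_b A gr p q r f) + EC_b A gr p q (r + 1) (EC_delta A gr \<phi> p q r f) = 0"
  using assms
proof (cases rule: cell_cases)
  case (cochain n m)
  let ?e = "\<lambda>n f v. (- 1) ^ n * op_delta A gr \<phi> n m f v"
  have e: "?e n f \<in> cochain_space n (Suc m)"
    and e_word: "word_fun n (Suc m) (?e n f) = (\<lambda>w. (- 1) ^ n * ((- 1) ^ m * dphi n m (word_fun n m f) w))"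
    if "f \<in> cochain_space n m" for n f
    using that by (simp_all add: cochain_scale word_fun_scale op_delta)
  have eq: "EC_delta A gr \<phi> p (q + 1) r (EC_b A gr p q r f) = ?e (Suc n) (op_b A gr (Suc n) m f)"
    "EC_b A gr p q (r + 1) (EC_delta A gr \<phi> p q r f) = op_b A gr (Suc n) (Suc m) (?e n f)"
    using cochain EC_delta_eq[of p "Suc n" m] EC_delta_eq[of p n m] EC_b_eq[of p n m] EC_b_eq[of p n "Suc m"]
    by (simp_all add: add_ac)
  have "?e (Suc n) (op_b A gr (Suc n) m f) + op_b A gr (Suc n) (Suc m) (?e n f) = 0"
  proof (rule cochain_zeroI[of _ "Suc n" "Suc m"])
    show "?e (Suc n) (op_b A gr (Suc n) m f) + op_b A gr (Suc n) (Suc m) (?e n f)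
        \<in> cochain_space (Suc n) (Suc m)"
      by (intro cochain_plus e op_b cochain(4))
    have "word_fun (Suc n) (Suc m) (?e (Suc n) (op_b A gr (Suc n) m f)) =
        (\<lambda>w. (- 1) ^ Suc n * ((- 1) ^ m * bword n (Suc m) (dphi n m (word_fun n m f)) w))"
      unfolding e_word[OF op_b(1)[OF cochain(4)]] op_b(2)[OF cochain(4)]
        dphi_bword[OF word_fun_forms[OF cochain(4)]] ..
    moreover have "word_fun (Suc n) (Suc m) (op_b A gr (Suc n) (Suc m) (?e n f)) =
        (\<lambda>w. (- 1) ^ n * ((- 1) ^ m * bword n (Suc m) (dphi n m (word_fun n m f)) w))"
      unfolding op_b(2)[OF e[OF cochain(4)]] e_word[OF cochain(4)] bword_scale ..
    ultimately show "word_fun (Suc n) (Suc m)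
        (?e (Suc n) (op_b A gr (Suc n) m f) + op_b A gr (Suc n) (Suc m) (?e n f)) = 0"
      by (simp add: additive.add[OF additive_word_fun] fun_eq_iff)
  qed
  then show ?thesis unfolding eq .
qed (simp add: EC_outside)

lemma EC_delta_B:
  assumes "f \<in> cell p q r"
  shows "EC_delta A gr \<phi> (p + 1) q r (EC_B A gr p q r f) + EC_B A gr p q (r + 1) (EC_delta A gr \<phi> p q r f) = 0"
  using assms
proof (cases rule: cell_cases)
  case (cochain n m)
  let ?e = "\<lambda>n f v. (- 1) ^ n * op_delta A gr \<phi> n m f v"
  have e: "?e n f \<in> cochain_space n (Suc m)"
    and e_word: "word_fun n (Suc m) (?e n f) = (\<lambda>w. (- 1) ^ n * ((- 1) ^ m * dphi n m (word_fun n m f) w))"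
    if "f \<in> cochain_space n m" for n f
    using that by (simp_all add: cochain_scale word_fun_scale op_delta)
  show ?thesis
  proof (cases n)
    case 0
    have "EC_B A gr p q (r + 1) (EC_delta A gr \<phi> p q r f) = 0"
      using 0 cochain by (simp add: EC_B_def op_B_def zero_fun_def)
    moreover have "EC_delta A gr \<phi> (p + 1) q r (EC_B A gr p q r f) = 0"
      using 0 cochain by (simp add: EC_outside)
    ultimately show ?thesis by simp
  next
    case (Suc k)
    have f: "f \<in> cochain_space (Suc k) m" using cochain(4) Suc by simp
    have eq: "EC_delta A gr \<phi> (p + 1) q r (EC_B A gr p q r f) = ?e k (op_B A gr (Suc k) m f)"
      "EC_B A gr p q (r + 1) (EC_delta A gr \<phi> p q r f) = op_B A gr (Suc k) (Suc m) (?e (Suc k) f)"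
      using cochain EC_delta_eq[of "p + 1" k m] EC_delta_eq[of p "Suc k" m] EC_B_eq[of p "Suc k" m]
        EC_B_eq[of p "Suc k" "Suc m"] Suc
      by (simp_all add: add_ac)
    have "?e k (op_B A gr (Suc k) m f) + op_B A gr (Suc k) (Suc m) (?e (Suc k) f) = 0"
    proof (rule cochain_zeroI[of _ k "Suc m"])
      show "?e k (op_B A gr (Suc k) m f) + op_B A gr (Suc k) (Suc m) (?e (Suc k) f)
          \<in> cochain_space k (Suc m)"
        by (intro cochain_plus e op_B f)
      have "word_fun k (Suc m) (?e k (op_B A gr (Suc k) m f)) =
          (\<lambda>w. (- 1) ^ k * ((- 1) ^ m * Bword k (Suc m) (dphi (Suc k) m (word_fun (Suc k) m f)) w))"
        unfolding e_word[OF op_B(1)[OF f]] op_B(2)[OF f] dphi_Bword ..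
      moreover have "word_fun k (Suc m) (op_B A gr (Suc k) (Suc m) (?e (Suc k) f)) =
          (\<lambda>w. (- 1) ^ Suc k * ((- 1) ^ m * Bword k (Suc m) (dphi (Suc k) m (word_fun (Suc k) m f)) w))"
        unfolding op_B(2)[OF e[OF f]] e_word[OF f] Bword_scale ..
      ultimately show "word_fun k (Suc m) (?e k (op_B A gr (Suc k) m f) + op_B A gr (Suc k) (Suc m) (?e (Suc k) f)) = 0"
        by (simp add: additive.add[OF additive_word_fun] fun_eq_iff)
    qed
    then show ?thesis unfolding eq .
  qed
qed (simp add: EC_outside)

lemma EC_delta_delta:
  assumes "f \<in> cell p q r"
  shows "EC_delta A gr \<phi> p q (r + 1) (EC_delta A gr \<phi> p q r f) = 0"
  using assms
proof (cases rule: cell_cases)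
  case (cochain n m)
  note f = cochain(4)
  note c = cochain_scale[OF op_delta(1)[OF f], of "(- 1) ^ n"]
  have zero: "dphi n (Suc m) (dphi n m (word_fun n m f)) = 0" by (rule dphi_dphi[OF word_fun_forms[OF f]])
  have "dphi n (Suc m) (\<lambda>w. c * G w) = (\<lambda>w. c * dphi n (Suc m) G w)" for c G
    by (auto simp: dphi_def phi_sum_mult)
  then have "(\<lambda>v. (- 1) ^ n * op_delta A gr \<phi> n (Suc m) (\<lambda>v. (- 1) ^ n * op_delta A gr \<phi> n m f v) v) = 0"
    by (intro cochain_zeroI[of _ n "Suc (Suc m)"])
      (simp_all add: cochain_scale op_delta[OF c] op_delta[OF f] word_fun_scale zero fun_eq_iff)
  then show ?thesis
    using cochain EC_delta_eq[of p n "Suc m"] by (simp add: EC_delta_eq add_ac)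
qed (simp add: EC_outside)

end

section \<open>The filtration by the third index\<close>

context dga
begin

definition tot :: "int \<Rightarrow> (int \<times> int \<times> int \<Rightarrow> ('k, 'a) cochain) set" where
  "tot n = {x. \<forall>p q r. x (p, q, r) \<in> cell p q r \<and> (p + q + r \<noteq> n \<longrightarrow> x (p, q, r) = 0)}"

text \<open>
  The cochains of total degree \<open>n\<close> of the bicomplex with third index \<open>r\<close>.
\<close>

definition bitot :: "int \<Rightarrow> int \<Rightarrow> (int \<times> int \<Rightarrow> ('k, 'a) cochain) set" where
  "bitot r n = {x. \<forall>p q. x (p, q) \<in> cell p q r \<and> (p + q \<noteq> n \<longrightarrow> x (p, q) = 0)}"

lemma presents_tot: "presents fun_scale (tot n) {0} (\<lambda>x. x) (tot_EC A gr n)"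
proof -
  have "presents fun_scale
      {x. \<forall>i. x i \<in> carrier ((\<lambda>(p, q, r). EC A gr p q r) i) \<and> (i \<notin> {(p, q, r). p + q + r = n} \<longrightarrow> x i = 0)}
      {0} (\<lambda>x. x) (tot_EC A gr n)"
    unfolding tot_EC_def
    by (rule presents_direct_sum[where J = "{0..n} \<times> {0..n} \<times> {0..n}"])
      (auto simp: EC_zero EC_add EC_smult cell_add cell_scale cell_outside split: prod.splits)
  moreover have "{x. \<forall>i. x i \<in> carrier ((\<lambda>(p, q, r). EC A gr p q r) i) \<and>
      (i \<notin> {(p, q, r). p + q + r = n} \<longrightarrow> x i = 0)} = tot n"
    by (simp add: tot_def split_paired_all)
  ultimately show ?thesis by simp
qed

lemma presents_bitot: "presents fun_scale (bitot r n) {0} (\<lambda>x. x) (tot_BP A gr r n)"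
proof -
  have "presents fun_scale
      {x. \<forall>i. x i \<in> carrier ((\<lambda>(p, q). BP A gr r p q) i) \<and> (i \<notin> {(p, q). p + q = n} \<longrightarrow> x i = 0)}
      {0} (\<lambda>x. x) (tot_BP A gr r n)"
    unfolding tot_BP_def
    by (rule presents_direct_sum[where J = "{0..n} \<times> {0..n}"])
      (auto simp: BP_def EC_zero EC_add EC_smult cell_add cell_scale cell_outside split: prod.splits)
  moreover have "{x. \<forall>i. x i \<in> carrier ((\<lambda>(p, q). BP A gr r p q) i) \<and>
      (i \<notin> {(p, q). p + q = n} \<longrightarrow> x i = 0)} = bitot r n"
    by (simp add: bitot_def split_paired_all BP_def)
  ultimately show ?thesis by simp
qed

abbreviation D :: "(int \<times> int \<times> int \<Rightarrow> ('k, 'a) cochain) \<Rightarrow> int \<times> int \<times> int \<Rightarrow> ('k, 'a) cochain" where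
  "D \<equiv> tot_EC_diff A gr \<phi>"

abbreviation bB :: "int \<Rightarrow> (int \<times> int \<Rightarrow> ('k, 'a) cochain) \<Rightarrow> int \<times> int \<Rightarrow> ('k, 'a) cochain" where
  "bB r \<equiv> tot_BP_diff A gr r"

definition sdelta :: "int \<Rightarrow> (int \<times> int \<Rightarrow> ('k, 'a) cochain) \<Rightarrow> int \<times> int \<Rightarrow> ('k, 'a) cochain" where
  "sdelta r x = (\<lambda>(i, j). EC_delta A gr \<phi> i j r (x (i, j)))"

text \<open>
  An element of the total complex is the family of its slices.  In terms of slices the differential has
  just two terms, one from the same slice and one from the slice below (\<open>slice_D\<close>).
\<close>

definition slice :: "int \<Rightarrow> (int \<times> int \<times> int \<Rightarrow> ('k, 'a) cochain) \<Rightarrow> int \<times> int \<Rightarrow> ('k, 'a) cochain" where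
  "slice r x = (\<lambda>(i, j). x (i, j, r))"

definition unslice :: "int \<Rightarrow> (int \<times> int \<Rightarrow> ('k, 'a) cochain) \<Rightarrow> int \<times> int \<times> int \<Rightarrow> ('k, 'a) cochain" where
  "unslice r y = (\<lambda>(i, j, k). if k = r then y (i, j) else 0)"

lemma bitot_cell: "x \<in> bitot r n \<Longrightarrow> x (p, q) \<in> cell p q r"
  and bitot_degree: "x \<in> bitot r n \<Longrightarrow> p + q \<noteq> n \<Longrightarrow> x (p, q) = 0"
  by (auto simp: bitot_def)

lemma bB_apply: "bB r x (p, q) = EC_b A gr p (q - 1) r (x (p, q - 1)) + EC_B A gr (p - 1) q r (x (p - 1, q))"
  by (simp add: tot_BP_diff_def fun_eq_iff)

lemma sdelta_apply: "sdelta r x (p, q) = EC_delta A gr \<phi> p q r (x (p, q))"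
  by (simp add: sdelta_def)

lemma D_apply: "D x (p, q, r) = EC_b A gr p (q - 1) r (x (p, q - 1, r))
    + EC_B A gr (p - 1) q r (x (p - 1, q, r)) + EC_delta A gr \<phi> p q (r - 1) (x (p, q, r - 1))"
  by (simp add: tot_EC_diff_def fun_eq_iff)

lemma slice_D: "slice r (D x) = bB r (slice r x) + sdelta (r - 1) (slice (r - 1) x)"
  by (simp add: fun_eq_iff split_paired_all slice_def D_apply bB_apply sdelta_apply)

lemma slice_add: "slice r (x + y) = slice r x + slice r y"
  and slice_diff: "slice r (x - y) = slice r x - slice r y"
  and slice_scale: "slice r (fun_scale c x) = fun_scale c (slice r x)"
  and slice_0: "slice r 0 = 0"
  by (auto simp: slice_def fun_eq_iff fun_scale_def)

lemma slice_unslice: "slice k (unslice r y) = (if k = r then y else 0)"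
  by (auto simp: slice_def unslice_def fun_eq_iff)

lemma eq_0_slices: "x = 0 \<longleftrightarrow> (\<forall>r. slice r x = 0)"
  by (auto simp: slice_def fun_eq_iff)

lemma slice_bitot: "x \<in> tot n \<Longrightarrow> slice r x \<in> bitot r (n - r)"
  by (auto simp: tot_def bitot_def slice_def)

lemma tot_slices: "x \<in> tot n \<longleftrightarrow> (\<forall>r. slice r x \<in> bitot r (n - r))"
  by (auto simp: tot_def bitot_def slice_def)

lemma unslice_tot: "y \<in> bitot r n \<Longrightarrow> unslice r y \<in> tot (n + r)"
  by (auto simp: tot_def bitot_def unslice_def)

lemma bitot_closed:
  shows "0 \<in> bitot r n" and "x \<in> bitot r n \<Longrightarrow> y \<in> bitot r n \<Longrightarrow> x + y \<in> bitot r n"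
    and "x \<in> bitot r n \<Longrightarrow> fun_scale c x \<in> bitot r n"
    and "x \<in> bitot r n \<Longrightarrow> y \<in> bitot r n \<Longrightarrow> x - y \<in> bitot r n"
    and "x \<in> bitot r n \<Longrightarrow> - x \<in> bitot r n"
  using presents_subspaceD[OF presents_bitot] by blast+

lemma bB_bitot: assumes "x \<in> bitot r n" shows "bB r x \<in> bitot r (n + 1)"
  unfolding bitot_def
proof (intro CollectI allI conjI impI)
  fix p q
  show "bB r x (p, q) \<in> cell p q r"
    unfolding bB_apply
    using EC_b_cell[OF bitot_cell[OF assms, of p "q - 1"]] EC_B_cell[OF bitot_cell[OF assms, of "p - 1" q]]
    by (simp add: cell_add)
  assume "p + q \<noteq> n + 1"
  then show "bB r x (p, q) = 0"
    using bitot_degree[OF assms, of p "q - 1"] bitot_degree[OF assms, of "p - 1" q] by (simp add: bB_apply)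
qed

lemma sdelta_bitot: assumes "x \<in> bitot r n" shows "sdelta r x \<in> bitot (r + 1) n"
  unfolding bitot_def
proof (intro CollectI allI conjI impI)
  fix p q
  show "sdelta r x (p, q) \<in> cell p q (r + 1)"
    unfolding sdelta_apply by (rule EC_delta_cell[OF bitot_cell[OF assms]])
  assume "p + q \<noteq> n"
  then show "sdelta r x (p, q) = 0" using bitot_degree[OF assms] by (simp add: sdelta_apply)
qed

lemma bB_add:
  assumes "x \<in> bitot r n" "y \<in> bitot r n" shows "bB r (x + y) = bB r x + bB r y"
  using bitot_cell[OF assms(1)] bitot_cell[OF assms(2)]
  by (simp add: fun_eq_iff[of "bB r (x + y)"] split_paired_all bB_apply EC_b_add EC_B_add)

lemma bB_scale:
  assumes "x \<in> bitot r n" shows "bB r (fun_scale c x) = fun_scale c (bB r x)"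
proof (intro ext, clarify)
  fix p q v
  show "bB r (fun_scale c x) (p, q) v = fun_scale c (bB r x) (p, q) v"
    using EC_b_scale[OF bitot_cell[OF assms, of p "q - 1"], of c]
      EC_B_scale[OF bitot_cell[OF assms, of "p - 1" q], of c]
    by (simp add: bB_apply fun_scale_def distrib_left)
qed

lemma sdelta_add: "sdelta r (x + y) = sdelta r x + sdelta r y"
  by (simp add: fun_eq_iff[of "sdelta r (x + y)"] split_paired_all sdelta_apply EC_delta_add)

lemma sdelta_scale: "sdelta r (fun_scale c x) = fun_scale c (sdelta r x)"
  by (simp add: fun_eq_iff split_paired_all sdelta_apply fun_scale_def EC_delta_scale)

lemma linear_bB: "linear_between fun_scale fun_scale (bitot r n) (bitot r (n + 1)) (bB r)"
  using bB_bitot bB_add bB_scale by (auto simp: linear_between_def)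

lemma sdelta_0: "sdelta r 0 = 0"
  by (simp add: fun_eq_iff[of "sdelta r 0"] split_paired_all sdelta_apply)

lemma bB_0: "bB r 0 = 0"
  by (simp add: fun_eq_iff[of "bB r 0"] split_paired_all bB_apply)

lemma bB_uminus: assumes "x \<in> bitot r n" shows "bB r (- x) = - bB r x"
  using bB_add[OF assms bitot_closed(5)[OF assms]] by (simp add: bB_0 eq_neg_iff_add_eq_0 add.commute)

lemma bB_bB: assumes "x \<in> bitot r n" shows "bB r (bB r x) = 0"
proof (rule ext, clarify)
  fix p q
  note c = bitot_cell[OF assms]
  have 1: "EC_b A gr p (q - 1) r (bB r x (p, q - 1)) =
      EC_b A gr p (q - 1) r (EC_B A gr (p - 1) (q - 1) r (x (p - 1, q - 1)))"
    using EC_b_cell[OF c[of p "q - 1 - 1"]] EC_B_cell[OF c[of "p - 1" "q - 1"]] EC_b_b[OF c[of p "q - 1 - 1"]]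
    by (simp add: bB_apply EC_b_add)
  have 2: "EC_B A gr (p - 1) q r (bB r x (p - 1, q)) =
      EC_B A gr (p - 1) q r (EC_b A gr (p - 1) (q - 1) r (x (p - 1, q - 1)))"
    using EC_b_cell[OF c[of "p - 1" "q - 1"]] EC_B_cell[OF c[of "p - 1 - 1" q]] EC_B_B[OF c[of "p - 1 - 1" q]]
    by (simp add: bB_apply EC_B_add)
  show "bB r (bB r x) (p, q) = 0 (p, q)"
    unfolding bB_apply[of r "bB r x"] 1 2 using EC_b_B[OF c[of "p - 1" "q - 1"]] by simp
qed

lemma bB_sdelta: assumes "x \<in> bitot r n" shows "bB (r + 1) (sdelta r x) + sdelta r (bB r x) = 0"
proof (rule ext, clarify)
  fix p q
  note c = bitot_cell[OF assms]
  have 1: "sdelta r (bB r x) (p, q) = EC_delta A gr \<phi> p q r (EC_b A gr p (q - 1) r (x (p, q - 1)))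
      + EC_delta A gr \<phi> p q r (EC_B A gr (p - 1) q r (x (p - 1, q)))"
    by (simp add: sdelta_apply bB_apply EC_delta_add)
  have 2: "bB (r + 1) (sdelta r x) (p, q) = EC_b A gr p (q - 1) (r + 1) (EC_delta A gr \<phi> p (q - 1) r (x (p, q - 1)))
      + EC_B A gr (p - 1) q (r + 1) (EC_delta A gr \<phi> (p - 1) q r (x (p - 1, q)))"
    by (simp only: bB_apply sdelta_apply)
  have "(bB (r + 1) (sdelta r x) + sdelta r (bB r x)) (p, q) =
      (EC_delta A gr \<phi> p q r (EC_b A gr p (q - 1) r (x (p, q - 1)))
        + EC_b A gr p (q - 1) (r + 1) (EC_delta A gr \<phi> p (q - 1) r (x (p, q - 1))))
      + (EC_delta A gr \<phi> p q r (EC_B A gr (p - 1) q r (x (p - 1, q)))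
        + EC_B A gr (p - 1) q (r + 1) (EC_delta A gr \<phi> (p - 1) q r (x (p - 1, q))))"
    unfolding plus_fun_apply 1 2 by (simp only: add_ac)
  also have "\<dots> = 0"
    using EC_delta_b[OF c[of p "q - 1"]] EC_delta_B[OF c[of "p - 1" q]] by simp
  finally show "(bB (r + 1) (sdelta r x) + sdelta r (bB r x)) (p, q) = 0 (p, q)" by simp
qed

lemma sdelta_sdelta: assumes "x \<in> bitot r n" shows "sdelta (r + 1) (sdelta r x) = 0"
  using EC_delta_delta[OF bitot_cell[OF assms]]
  by (simp add: fun_eq_iff[of "sdelta (r + 1) _"] split_paired_all sdelta_apply)

lemma D_tot: assumes "x \<in> tot n" shows "D x \<in> tot (n + 1)"
  unfolding tot_slices
proof
  fix r
  have "bB r (slice r x) \<in> bitot r (n + 1 - r)"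
    using bB_bitot[OF slice_bitot[OF assms, of r]] by (simp add: algebra_simps)
  moreover have "sdelta (r - 1) (slice (r - 1) x) \<in> bitot r (n + 1 - r)"
    using sdelta_bitot[OF slice_bitot[OF assms, of "r - 1"]] by (simp add: algebra_simps)
  ultimately show "slice r (D x) \<in> bitot r (n + 1 - r)" unfolding slice_D by (rule bitot_closed)
qed

lemma D_D: assumes "x \<in> tot n" shows "D (D x) = 0"
  unfolding eq_0_slices
proof
  fix r
  note s = slice_bitot[OF assms]
  have "bB r (slice r (D x)) = bB r (sdelta (r - 1) (slice (r - 1) x))"
    unfolding slice_D
    using bB_add[OF bB_bitot[OF s[of r]], of "sdelta (r - 1) (slice (r - 1) x)"] sdelta_bitot[OF s[of "r - 1"]] bB_bB[OF s]
    by (simp add: algebra_simps)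
  moreover have "sdelta (r - 1) (slice (r - 1) (D x)) = sdelta (r - 1) (bB (r - 1) (slice (r - 1) x))"
    unfolding slice_D sdelta_add using sdelta_sdelta[OF s[of "r - 1 - 1"]] by simp
  ultimately show "slice r (D (D x)) = 0"
    using bB_sdelta[OF s[of "r - 1"]] by (simp add: slice_D[of r "D x"])
qed

definition filt :: "int \<Rightarrow> int \<Rightarrow> (int \<times> int \<times> int \<Rightarrow> ('k, 'a) cochain) set" where
  "filt s n = {x \<in> tot n. \<forall>r<s. slice r x = 0}"

lemma tot_closed:
  shows "0 \<in> tot n" and "x \<in> tot n \<Longrightarrow> y \<in> tot n \<Longrightarrow> x + y \<in> tot n"
    and "x \<in> tot n \<Longrightarrow> fun_scale c x \<in> tot n"
    and "x \<in> tot n \<Longrightarrow> y \<in> tot n \<Longrightarrow> x - y \<in> tot n"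
  using presents_subspaceD[OF presents_tot] by blast+

lemma fun_scale_0: "fun_scale c 0 = 0"
  by (simp add: fun_scale_def fun_eq_iff)

lemma linear_D: "linear_between fun_scale fun_scale (tot n) (tot (n + 1)) D"
  unfolding linear_between_def
proof (intro conjI ballI allI)
  show "D ` tot n \<subseteq> tot (n + 1)" using D_tot by blast
next
  fix x y assume x: "x \<in> tot n" and y: "y \<in> tot n"
  have "slice r (D (x + y) - (D x + D y)) = 0" for r
    using bB_add[OF slice_bitot[OF x] slice_bitot[OF y]]
    by (simp add: slice_diff slice_add slice_D sdelta_add)
  then have "D (x + y) - (D x + D y) = 0" unfolding eq_0_slices by blast
  then show "D (x + y) = D x + D y" by simp
next
  fix c x assume x: "x \<in> tot n"
  interpret S: vector_space "fun_scale :: 'k \<Rightarrow> (int \<times> int \<Rightarrow> ('k, 'a) cochain) \<Rightarrow> _" by (rule vector_space_fun_scale)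
  have "slice r (D (fun_scale c x) - fun_scale c (D x)) = 0" for r
    using bB_scale[OF slice_bitot[OF x]]
    by (simp add: slice_diff slice_scale slice_D sdelta_scale S.scale_right_distrib)
  then have "D (fun_scale c x) - fun_scale c (D x) = 0" unfolding eq_0_slices by blast
  then show "D (fun_scale c x) = fun_scale c (D x)" by simp
qed

lemma tot_slice_outside:
  assumes "x \<in> tot n" "r < 0 \<or> n < r" shows "slice r x = 0"
proof (rule ext, clarify)
  fix p q
  have mem: "x (p, q, r) \<in> cell p q r" "p + q + r \<noteq> n \<longrightarrow> x (p, q, r) = 0"
    using assms(1) by (auto simp: tot_def)
  show "slice r x (p, q) = 0 (p, q)"
  proof (cases "0 \<le> p \<and> p \<le> q \<and> 0 \<le> r")
    case True
    with assms(2) mem(2) show ?thesis by (simp add: slice_def)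
  next
    case False
    with mem(1) show ?thesis by (simp add: slice_def cell_outside)
  qed
qed

lemma filtered_complex_tot: "filtered_complex fun_scale tot filt D"
proof -
  interpret S: vector_space "fun_scale :: 'k \<Rightarrow> (int \<times> int \<times> int \<Rightarrow> ('k, 'a) cochain) \<Rightarrow> _"
    by (rule vector_space_fun_scale)
  show ?thesis
  proof
    fix p n x
    show "S.subspace (tot n)" by (rule presents_subspace[OF presents_tot])
    show "S.subspace (filt p n)"
      by (intro S.subspaceI) (auto simp: filt_def tot_closed slice_0 slice_add slice_scale fun_scale_0)
    show "filt p n \<subseteq> tot n" "filt (p + 1) n \<subseteq> filt p n" by (auto simp: filt_def)
    have "filt 0 n = tot n" using tot_slice_outside by (auto simp: filt_def)
    moreover have "filt (n + 1) n = {0}"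
    proof -
      have "x = 0" if "x \<in> filt (n + 1) n" for x
        unfolding eq_0_slices
      proof
        fix r show "slice r x = 0"
          using that tot_slice_outside[of x n r] by (cases "r < n + 1") (auto simp: filt_def)
      qed
      then show ?thesis by (auto simp: filt_def tot_closed slice_0)
    qed
    ultimately show "\<exists>s t. filt s n = tot n \<and> filt t n = {0}" by blast
    show "linear_between fun_scale fun_scale (tot n) (tot (n + 1)) D" by (rule linear_D)
    show "D x \<in> filt p (n + 1)" if "x \<in> filt p n"
      using that D_tot by (auto simp: filt_def slice_D bB_0 sdelta_0)
    show "D (D x) = 0" if "x \<in> tot n" using D_D[OF that] .
  qed
qed

abbreviation bitot_cycles :: "int \<Rightarrow> int \<Rightarrow> (int \<times> int \<Rightarrow> ('k, 'a) cochain) set" where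
  "bitot_cycles r n \<equiv> {x \<in> bitot r n. bB r x = 0}"

abbreviation bitot_boundaries :: "int \<Rightarrow> int \<Rightarrow> (int \<times> int \<Rightarrow> ('k, 'a) cochain) set" where
  "bitot_boundaries r n \<equiv> bB r ` bitot r (n - 1)"

lemma presents_HCP:
  "presents fun_scale (bitot_cycles r n) (bitot_boundaries r n) (coset_class (bitot_boundaries r n)) (HCP A gr r n)"
  unfolding HCP_def 
  by (rule presents_cohomology[where C = "bitot r" and V = "tot_BP A gr r" and d = "\<lambda>_. bB r",
        OF presents_bitot linear_bB bB_bB])

lemma bitot_boundaries_cycles: "bitot_boundaries r n \<subseteq> bitot_cycles r n"
  using bB_bitot[of _ r "n - 1"] bB_bB by auto

lemma bB_sdelta': "x \<in> bitot r n \<Longrightarrow> sdelta r (bB r x) = - bB (r + 1) (sdelta r x)"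
  using bB_sdelta[of x r n] by (simp add: eq_neg_iff_add_eq_0 add.commute)

lemma sdelta_boundaries: "sdelta r ` bitot_boundaries r n \<subseteq> bitot_boundaries (r + 1) n"
proof
  fix y assume "y \<in> sdelta r ` bitot_boundaries r n"
  then obtain x where x: "x \<in> bitot r (n - 1)" "y = sdelta r (bB r x)" by blast
  then have "y = bB (r + 1) (- sdelta r x)" using bB_uminus[OF sdelta_bitot[OF x(1)]] by (simp add: bB_sdelta'[OF x(1)])
  then show "y \<in> bitot_boundaries (r + 1) n" using sdelta_bitot[OF x(1)] bitot_closed(5) by blast
qed

lemma linear_sdelta_cycles:
  "linear_between fun_scale fun_scale (bitot_cycles r n) (bitot_cycles (r + 1) n) (sdelta r)"
proof -
  have "bB (r + 1) (sdelta r x) = 0" if "x \<in> bitot r n" "bB r x = 0" for x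
    using bB_sdelta[OF that(1)] that(2) by (simp add: sdelta_0)
  then show ?thesis using sdelta_bitot sdelta_scale by (auto simp: linear_between_def sdelta_add)
qed

lemma HCP_diff_class:
  assumes "x \<in> bitot_cycles r n"
  shows "HCP_diff A gr \<phi> r n (coset_class (bitot_boundaries r n) x)
      = coset_class (bitot_boundaries (r + 1) n) (sdelta r x)"
proof -
  have "linear_between fun_scale fun_scale (bitot_cycles r n) (bitot (r + 1) n) (sdelta r)"
    using linear_sdelta_cycles[of r n] by (auto simp: linear_between_def)
  moreover have "0 \<in> bitot_boundaries r n" using bitot_closed(1)[of r "n - 1"] bB_0 by force
  ultimately show ?thesis
    unfolding HCP_diff_def sdelta_def[symmetric, abs_def]
    using assms bitot_boundaries_cycles sdelta_boundaries
    by (intro cohomology_map_coset[where C = "bitot (r + 1)" and V = "tot_BP A gr (r + 1)"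
          and d = "\<lambda>_. bB (r + 1)", OF presents_bitot linear_bB]) auto
qed

text \<open>
  Both layers of cosets are removed: a class is represented by a cocycle \<open>x\<close> for \<open>b + B\<close> with \<open>\<delta> x\<close> a
  coboundary for \<open>b + B\<close>.
\<close>

lemma presents_H_HCP:
  "\<exists>\<pi>. presents fun_scale {x \<in> bitot_cycles p q. sdelta p x \<in> bitot_boundaries (p + 1) q}
     {sdelta (p - 1) y + k | y k. y \<in> bitot_cycles (p - 1) q \<and> k \<in> bitot_boundaries p q} \<pi> (H_HCP A gr \<phi> p q)"
proof (rule exI)
  show "presents fun_scale {x \<in> bitot_cycles p q. sdelta p x \<in> bitot_boundaries (p + 1) q}
     {sdelta (p - 1) y + k | y k. y \<in> bitot_cycles (p - 1) q \<and> k \<in> bitot_boundaries p q}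
     (\<lambda>x. HCP_diff A gr \<phi> (p - 1) q ` carrier (HCP A gr (p - 1) q)
       +>\<^bsub>(HCP A gr p q)\<lparr>carrier := {x \<in> carrier (HCP A gr p q). HCP_diff A gr \<phi> p q x = \<zero>\<^bsub>HCP A gr (p + 1) q\<^esub>}\<rparr>\<^esub>
       coset_class (bitot_boundaries p q) x) (H_HCP A gr \<phi> p q)"
    unfolding H_HCP_def cohomology_def
  proof (rule presents_cohomology_at[OF presents_HCP presents_HCP presents_HCP])
    fix x
    show "HCP_diff A gr \<phi> (p - 1) q (coset_class (bitot_boundaries (p - 1) q) x)
        = coset_class (bitot_boundaries p q) (sdelta (p - 1) x)" if "x \<in> bitot_cycles (p - 1) q"
      using HCP_diff_class[OF that] by simp
    show "linear_between fun_scale fun_scale (bitot_cycles (p - 1) q) (bitot_cycles p q) (sdelta (p - 1))"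
      using linear_sdelta_cycles[of "p - 1" q] by simp
    show "HCP_diff A gr \<phi> p q (coset_class (bitot_boundaries p q) x)
        = coset_class (bitot_boundaries (p + 1) q) (sdelta p x)" if "x \<in> bitot_cycles p q"
      using HCP_diff_class[OF that] .
    show "linear_between fun_scale fun_scale (bitot_cycles p q) (bitot_cycles (p + 1) q) (sdelta p)"
      by (rule linear_sdelta_cycles)
    show "sdelta p (sdelta (p - 1) x) \<in> bitot_boundaries (p + 1) q" if "x \<in> bitot_cycles (p - 1) q"
    proof -
      have "sdelta p (sdelta (p - 1) x) = bB (p + 1) 0" using that sdelta_sdelta[of x "p - 1" q] by (simp add: bB_0)
      then show ?thesis using bitot_closed(1) by blast
    qed
    show "sdelta p x \<in> bitot_boundaries (p + 1) q" if "x \<in> bitot_boundaries p q"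
      using sdelta_boundaries that by blast
  qed
qed

interpretation T: filtered_complex "fun_scale :: 'k \<Rightarrow> _" tot filt D
  by (rule filtered_complex_tot)

text \<open>
  The isomorphism takes the leading slice.  If \<open>x\<close> has filtration \<open>p\<close> and \<open>D x\<close> has filtration \<open>p + 2\<close>, the
  vanishing of slices \<open>p\<close> and \<open>p + 1\<close> of \<open>D x\<close> says that \<open>x\<^sub>p\<close> is a cocycle for \<open>b + B\<close> and that \<open>\<delta> x\<^sub>p\<close> is the
  coboundary of \<open>- x\<^sub>p\<^sub>+\<^sub>1\<close>.  Conversely such an \<open>x\<^sub>p\<close>, with \<open>\<delta> x\<^sub>p\<close> the coboundary of \<open>w\<close>, is the leading slice of
  \<open>x\<^sub>p - w\<close>.  In the same way a relation \<open>x\<^sub>p = \<delta> y + (b + B) w\<close> comes from \<open>D (y + w)\<close>.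
\<close>

lemma page_2: "vs_iso (T.page 2 p q) (H_HCP A gr \<phi> p q)"
proof -
  define n where "n = p + q"
  let ?S = "{x \<in> bitot_cycles p q. sdelta p x \<in> bitot_boundaries (p + 1) q}"
  let ?K = "{sdelta (p - 1) y + k | y k. y \<in> bitot_cycles (p - 1) q \<and> k \<in> bitot_boundaries p q}"
  obtain \<pi> where H: "presents fun_scale ?S ?K \<pi> (H_HCP A gr \<phi> p q)" using presents_H_HCP by blast
  have P: "presents fun_scale (T.cycles 2 p n) (T.boundaries 2 p n) (coset_class (T.boundaries 2 p n)) (T.page 2 p q)"
    by (rule T.presents_page') (simp_all add: n_def)
  have cyc: "x \<in> tot n" "\<And>k. k < p \<Longrightarrow> slice k x = 0" "\<And>k. k < p + 2 \<Longrightarrow> slice k (D x) = 0"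
    if "x \<in> T.cycles 2 p n" for x
    using that by (auto simp: T.cycles_def filt_def)
  have sl: "slice (p + 1) x \<in> bitot (p + 1) (q - 1)" "slice p x \<in> bitot p q" if "x \<in> tot n" for x
    using slice_bitot[OF that, of "p + 1"] slice_bitot[OF that, of p] by (simp_all add: n_def)
  show ?thesis
  proof (rule vs_iso_presents[OF P H, of "slice p"])
    have "slice p x \<in> ?S" if x: "x \<in> T.cycles 2 p n" for x
    proof -
      have "bB p (slice p x) = 0"
        using cyc(3)[OF x, of p] cyc(2)[OF x, of "p - 1"] by (simp add: slice_D sdelta_0)
      moreover have "bB (p + 1) (slice (p + 1) x) + sdelta p (slice p x) = 0"
        using cyc(3)[OF x, of "p + 1"] by (simp add: slice_D)
      then have "- bB (p + 1) (slice (p + 1) x) = sdelta p (slice p x)" by (rule group_add_class.minus_unique)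
      then have "sdelta p (slice p x) = bB (p + 1) (- slice (p + 1) x)"
        by (simp only: bB_uminus[OF sl(1)[OF cyc(1)[OF x]]])
      moreover have "- slice (p + 1) x \<in> bitot (p + 1) (q - 1)"
        using sl(1)[OF cyc(1)[OF x]] by (rule bitot_closed)
      ultimately show ?thesis using sl(2)[OF cyc(1)[OF x]] by blast
    qed
    then show "linear_between fun_scale fun_scale (T.cycles 2 p n) ?S (slice p)"
      by (auto simp: linear_between_def slice_add slice_scale)
  next
    fix x assume x: "x \<in> T.cycles 2 p n"
    show "slice p x \<in> ?K \<longleftrightarrow> x \<in> T.boundaries 2 p n"
    proof
      assume "x \<in> T.boundaries 2 p n"
      then have "x \<in> T.boundaries (Suc 1) p n" by (simp add: numeral_2_eq_2)
      then obtain y z where yz: "y \<in> T.cycles 1 (p + 1) n" "z \<in> T.cycles 1 (p - int 1) (n - 1)" "x = y + D z"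
        by (rule T.boundariesE)
      have z: "z \<in> tot (n - 1)" "\<And>k. k < p - 1 \<Longrightarrow> slice k z = 0" "\<And>k. k < p \<Longrightarrow> slice k (D z) = 0"
        using yz(2) by (auto simp: T.cycles_def filt_def)
      have "slice p y = 0" using yz(1) by (auto simp: T.cycles_def filt_def)
      then have "slice p x = sdelta (p - 1) (slice (p - 1) z) + bB p (slice p z)"
        by (simp add: yz(3) slice_add slice_D add.commute)
      moreover have "bB (p - 1) (slice (p - 1) z) = 0"
        using z(3)[of "p - 1"] z(2)[of "p - 1 - 1"] by (simp add: slice_D sdelta_0)
      moreover have "slice (p - 1) z \<in> bitot (p - 1) q" "slice p z \<in> bitot p (q - 1)"
        using slice_bitot[OF z(1), of "p - 1"] slice_bitot[OF z(1), of p] by (simp_all add: n_def algebra_simps)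
      ultimately show "slice p x \<in> ?K" by blast
    next
      assume "slice p x \<in> ?K"
      then obtain y w where yw: "y \<in> bitot (p - 1) q" "bB (p - 1) y = 0" "w \<in> bitot p (q - 1)"
        "slice p x = sdelta (p - 1) y + bB p w" by auto
      define z where "z = unslice (p - 1) y + unslice p w"
      have z: "z \<in> tot (n - 1)"
        using unslice_tot[OF yw(1)] unslice_tot[OF yw(3)] unfolding z_def
        by (intro tot_closed) (simp_all add: n_def algebra_simps)
      have slice_z: "slice k z = (if k = p - 1 then y else if k = p then w else 0)" for k
        by (simp add: z_def slice_add slice_unslice)
      have Dz: "slice k (D z) = 0" if "k < p" for k
        using that yw(2) by (simp add: slice_D slice_z bB_0 sdelta_0)
      have Dz_p: "slice p (D z) = slice p x"
        by (simp add: slice_D slice_z yw(4) add.commute)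
      have Dz_tot: "D z \<in> tot n" using D_tot[OF z] by simp
      have "z \<in> T.cycles 1 (p - int 1) (n - 1)"
        using z Dz Dz_tot by (simp add: T.cycles_def filt_def slice_z)
      moreover have "x - D z \<in> T.cycles 1 (p + 1) n"
      proof -
        have "slice k (x - D z) = 0" if "k < p + 1" for k
          using that Dz[of k] Dz_p cyc(2)[OF x, of k] by (cases "k = p") (simp_all add: slice_diff)
        moreover have "D (x - D z) = D x"
          using T.D_diff[OF cyc(1)[OF x] Dz_tot] D_D[OF z] by simp
        ultimately show ?thesis
          using tot_closed(4)[OF cyc(1)[OF x] Dz_tot] D_tot[OF cyc(1)[OF x]] cyc(3)[OF x]
          by (simp add: T.cycles_def filt_def add.assoc)
      qed
      ultimately have "x \<in> T.boundaries (Suc 1) p n" by (intro T.boundariesI) auto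
      then show "x \<in> T.boundaries 2 p n" by (simp add: numeral_2_eq_2)
    qed
  next
    fix s assume "s \<in> ?S"
    then obtain w where s: "s \<in> bitot p q" "bB p s = 0" "w \<in> bitot (p + 1) (q - 1)" "sdelta p s = bB (p + 1) w"
      by auto
    \<comment> \<open>The second slice corrects \<open>\<delta> s = (b + B) w\<close> in slice \<open>p + 1\<close> of the differential.\<close>
    define x where "x = unslice p s - unslice (p + 1) w"
    have x: "x \<in> tot n"
      using unslice_tot[OF s(1)] unslice_tot[OF s(3)] unfolding x_def
      by (intro tot_closed) (simp_all add: n_def algebra_simps)
    have slice_x: "slice k x = (if k = p then s else if k = p + 1 then - w else 0)" for k
      by (simp add: x_def slice_diff slice_unslice)
    have "slice k (D x) = 0" if k: "k < p + 2" for k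
    proof -
      consider "k < p" | "k = p" | "k = p + 1" using k by linarith
      then show ?thesis
        using s by cases (simp_all add: slice_D slice_x bB_0 sdelta_0 bB_uminus[OF s(3)])
    qed
    then have "x \<in> T.cycles 2 p n"
      using x D_tot[OF x] by (simp add: T.cycles_def filt_def slice_x)
    moreover have "s - slice p x \<in> ?K"
    proof -
      have "s - slice p x = sdelta (p - 1) 0 + bB p 0" by (simp add: slice_x bB_0 sdelta_0)
      moreover have "0 \<in> bitot_cycles (p - 1) q" "bB p 0 \<in> bitot_boundaries p q"
        using bitot_closed(1) bB_0 by blast+
      ultimately show ?thesis by blast
    qed
    ultimately show "\<exists>x\<in>T.cycles 2 p n. s - slice p x \<in> ?K" by blast
  qed
qed

lemma spectral_sequence_HC:
  "spectral_sequence 2 T.page T.page_diff \<and> (\<forall>p q. vs_iso (T.page 2 p q) (H_HCP A gr \<phi> p q)) \<and>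
     converges_to 2 T.page T.page_diff (HC_dg A gr \<phi>)"
proof (intro conjI allI page_2)
  show "spectral_sequence 2 T.page T.page_diff" by (rule T.spectral_sequence_pages) simp
  have "HC_dg A gr \<phi> = cohomology (tot_EC A gr) (\<lambda>_. D)" by (simp add: HC_dg_def fun_eq_iff)
  then show "converges_to 2 T.page T.page_diff (HC_dg A gr \<phi>)"
    using T.converges_to_cohomology[of 2, OF _ presents_tot] by simp
qed

end

theorem theorem4p17:
  fixes A :: "('k::field_char_0, 'a) module"
    and gr :: "nat \<Rightarrow> 'a set"
    and \<phi> :: "'a \<Rightarrow> 'a"
  assumes "dga A gr \<phi>"
  shows "\<exists>(E :: nat \<Rightarrow> int \<Rightarrow> int \<Rightarrow> ('k, (int \<times> int \<times> int \<Rightarrow> ('k, 'a) cochain) set) module) d.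
           spectral_sequence 2 E d \<and>
           (\<forall>p q. vs_iso (E 2 p q) (H_HCP A gr \<phi> p q)) \<and>
           converges_to 2 E d (HC_dg A gr \<phi>)"
  using dga.spectral_sequence_HC[OF assms] by blast

end
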